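(* Fix $0<r<t\le s<S$ with $s>2r$, fix $M>0$, and let $0<\alpha,\alpha'<1$ satisfy $2\alpha+\alpha'<1$. Suppose $a_n\ge0$ and $a_n=o\{\rho_n(r)\}$. There is no sequence of confidence sets $C_n$ that is honest at level $1-\alpha$ under the uniform design over $$\Theta_n=\mathcal F_s(M)\cup\{f\in\mathcal F_r(M):\operatorname{dist}_2(f,\mathcal B_t(M))\ge a_n\},$$ i.e. satisfies $\liminf_{n\to\infty}\inf_{f\in\Theta_n}\mathbb P_{f,1}(f\in C_n)\ge1-\alpha$, and for which there is a constant $K<\infty$ satisfying $$\limsup_{n\to\infty}\ \sup_{f\in\mathcal F_s(M)}\mathbb P_{f,1}\{\operatorname{diam}_2(C_n)>K\varepsilon_n(s)\}\le\alpha'.$$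
   Context: **Model.** Fix an integer $d\ge1$ and $\mathcal X=[0,1]^d$. For each $n$ one observes independent pairs $(X_i,Y_i)_{i=1}^n$ with $X_i\sim g$ and $Y_i\mid X_i=x\sim\mathrm{Bernoulli}(f(x))$; the law is $\mathbb P_{f,g}$, and $\mathbb P_{f,1}$ denotes the law under the uniform design density $g\equiv1$. Write $\|h\|_2^2=\int_{\mathcal X}h(x)^2dx$, $\operatorname{diam}_2(C)=\sup_{u,v\in C}\|u-v\|_2$ for nonempty $C\subset L^2(dx)$, $\operatorname{diam}_2(\varnothing)=0$, and $\operatorname{dist}_2(f,\mathcal A)=\inf_{h\in\mathcal A}\|f-h\|_2$. Confidence sets are Effros-measurable random closed subsets of $L^2(dx)$ (for every open $O$ the event $\{C_n\cap O\ne\varnothing\}$ is measurable), determined by the $n$ observations. **Rates.** $\varepsilon_n(s)=n^{-s/(2s+d)}$ and $\rho_n(s)=n^{-2s/(4s+d)}$. **Wavelets.** $S>0$ is fixed, together with a compactly supported, tensor-product, boundary-corrected orthonormal wavelet basis of Cohen–Daubechies–Vial type on $[0,1]^d$, built from a compactly supported orthonormal Daubechies system on $\mathbb R$ (scaling function $\varphi$, wavelet $\psi$) with Hölder–Zygmund regularity $R_{\mathrm w}>S$ and an integer number $N_{\mathrm w}>S$ of vanishing moments. Thus for an integer $J_0\ge0$ and every $j\ge J_0$ there are orthonormal families $(\varphi^I_{j,k})_{k\in\mathcal I_j}$, $(\psi^I_{j,k})_{k\in\mathcal I_j}$ in $L^2([0,1])$, $|\mathcal I_j|=2^j$, each consisting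 of the ordinary functions $2^{j/2}\varphi(2^jx-k)$ (resp. $2^{j/2}\psi(2^jx-k)$) with support in $(0,1)$ together with a number, independent of $j$, of boundary functions that are $L^2$-normalized level-$j$ dilates of fixed compactly supported prototypes; $J_0$ is large enough that left- and right-boundary functions have disjoint supports at every level $j\ge J_0$. The spans $V^I_j,W^I_j$ satisfy $V^I_{j+1}=V^I_j\oplus W^I_j$ (orthogonal), $L^2([0,1])=V^I_{J_0}\oplus\bigoplus_{j\ge J_0}W^I_j$, and $V^I_j$ contains all polynomials of degree at most $N_{\mathrm w}-1$. On $[0,1]^d$ put $\Lambda_j=\mathcal I_j^d$, $\varphi_{j,\lambda}(x)=\prod_{\ell=1}^d\varphi^I_{j,k_\ell}(x_\ell)$ for $\lambda=(k_1,\dots,k_d)$, $V_j=\operatorname{span}\{\varphi_{j,\lambda}:\lambda\in\Lambda_j\}$; $P_J$ is the $L^2(dx)$-orthogonal projection onto $V_J$ and $Q_j=P_{j+1}-P_j$. **Function classes.** For $u\ge0$, $\|h\|_{\mathbb B^u_{2,\infty}}=2^{J_0u}\|P_{J_0}h\|_2+\sup_{j\ge J_0}2^{ju}\|Q_jh\|_2$, $\mathcal B_u(M)=\{h\in L^2(dx):\|h\|_{\mathbb B^u_{2,\infty}}\le M\}$, and $\mathcal F_u(M)=\{f\in\mathcal B_u(M):0\le f\le1\text{ a.e.}\}$. *)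

theory Defs
  imports "HOL-Probability.Probability" "HOL-Library.Landau_Symbols"
    "HOL-Computational_Algebra.Polynomial"
begin

section \<open>Square-integrable functions\<close>

text \<open>
  Elements of \<open>L\<^sup>2(M)\<close> are represented by measurable functions.  Every set of
  functions that stands for a subset of \<open>L\<^sup>2\<close> below (spans, closed sets, open sets, function
  classes) is invariant under changing a member on a null set.
\<close>

definition l2 :: "'a measure \<Rightarrow> ('a \<Rightarrow> real) set" where
  "l2 M = {h \<in> borel_measurable M. integrable M (\<lambda>x. (h x)\<^sup>2)}"

definition l2_inner :: "'a measure \<Rightarrow> ('a \<Rightarrow> real) \<Rightarrow> ('a \<Rightarrow> real) \<Rightarrow> real" where
  "l2_inner M f g = (\<integral>x. f x * g x \<partial>M)"

definition l2_norm :: "'a measure \<Rightarrow> ('a \<Rightarrow> real) \<Rightarrow> real" where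
  "l2_norm M h = sqrt (\<integral>x. (h x)\<^sup>2 \<partial>M)"

definition l2_dist :: "'a measure \<Rightarrow> ('a \<Rightarrow> real) \<Rightarrow> ('a \<Rightarrow> real) \<Rightarrow> real" where
  "l2_dist M f g = l2_norm M (\<lambda>x. f x - g x)"

text \<open>
  The topology of the pseudometric \<open>l2_dist\<close>; its open and closed sets are the preimages of
  the open and closed subsets of the quotient modulo a.e. equality.
\<close>

definition l2_topology :: "'a measure \<Rightarrow> ('a \<Rightarrow> real) topology" where
  "l2_topology M = topology (\<lambda>U. U \<subseteq> l2 M \<and>
     (\<forall>f\<in>U. \<exists>e>0. \<forall>g\<in>l2 M. l2_dist M f g < e \<longrightarrow> g \<in> U))"

lemma openin_l2_topology:
  "openin (l2_topology M) U \<longleftrightarrow>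
     U \<subseteq> l2 M \<and> (\<forall>f\<in>U. \<exists>e>0. \<forall>g\<in>l2 M. l2_dist M f g < e \<longrightarrow> g \<in> U)"
proof -
  have "istopology (\<lambda>U. U \<subseteq> l2 M \<and>
     (\<forall>f\<in>U. \<exists>e>0. \<forall>g\<in>l2 M. l2_dist M f g < e \<longrightarrow> g \<in> U))"
    (is "istopology ?P")
    unfolding istopology_def
  proof (intro conjI allI impI)
    fix S T assume S: "?P S" and T: "?P T"
    show "S \<inter> T \<subseteq> l2 M" using S by blast
    show "\<forall>f\<in>S \<inter> T. \<exists>e>0. \<forall>g\<in>l2 M. l2_dist M f g < e \<longrightarrow> g \<in> S \<inter> T"
    proof
      fix f assume f: "f \<in> S \<inter> T"
      obtain e1 where e1: "e1 > 0" "\<forall>g\<in>l2 M. l2_dist M f g < e1 \<longrightarrow> g \<in> S"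
        using S f by blast
      obtain e2 where e2: "e2 > 0" "\<forall>g\<in>l2 M. l2_dist M f g < e2 \<longrightarrow> g \<in> T"
        using T f by blast
      show "\<exists>e>0. \<forall>g\<in>l2 M. l2_dist M f g < e \<longrightarrow> g \<in> S \<inter> T"
        using e1 e2 by (intro exI[of _ "min e1 e2"]) auto
    qed
  next
    fix K assume K: "\<forall>k\<in>K. ?P k"
    show "\<Union> K \<subseteq> l2 M" using K by blast
    show "\<forall>f\<in>\<Union> K. \<exists>e>0. \<forall>g\<in>l2 M. l2_dist M f g < e \<longrightarrow> g \<in> \<Union> K"
      using K by (metis Union_iff)
  qed
  then show ?thesis
    unfolding l2_topology_def by (simp add: topology_inverse')
qed

definition l2_diam :: "'a measure \<Rightarrow> ('a \<Rightarrow> real) set \<Rightarrow> ereal" where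
  "l2_diam M C =
     (if C = {} then 0 else (SUP u\<in>C. SUP v\<in>C. ereal (l2_dist M u v)))"

definition l2_setdist :: "'a measure \<Rightarrow> ('a \<Rightarrow> real) \<Rightarrow> ('a \<Rightarrow> real) set \<Rightarrow> ereal" where
  "l2_setdist M f A = (INF h\<in>A. ereal (l2_dist M f h))"

definition l2_orthonormal :: "'a measure \<Rightarrow> 'i set \<Rightarrow> ('i \<Rightarrow> 'a \<Rightarrow> real) \<Rightarrow> bool" where
  "l2_orthonormal M I F \<longleftrightarrow>
     (\<forall>i\<in>I. F i \<in> l2 M) \<and>
     (\<forall>i\<in>I. \<forall>k\<in>I. l2_inner M (F i) (F k) = (if i = k then 1 else 0))"

text \<open>The linear span of a finite family, closed under a.e. equality.\<close>

definition l2_span :: "'a measure \<Rightarrow> 'i set \<Rightarrow> ('i \<Rightarrow> 'a \<Rightarrow> real) \<Rightarrow> ('a \<Rightarrow> real) set" where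
  "l2_span M I F = {h \<in> l2 M. \<exists>c. AE x in M. h x = (\<Sum>i\<in>I. c i * F i x)}"

text \<open>A representative of the orthogonal projection of \<open>h\<close> onto \<open>V\<close>; it is unique up to
  null sets.\<close>

definition l2_proj :: "'a measure \<Rightarrow> ('a \<Rightarrow> real) set \<Rightarrow> ('a \<Rightarrow> real) \<Rightarrow> 'a \<Rightarrow> real" where
  "l2_proj M V h = (SOME p. p \<in> V \<and> (\<forall>v\<in>V. l2_inner M (\<lambda>x. h x - p x) v = 0))"

definition unit_cube :: "'a::euclidean_space measure" where
  "unit_cube = restrict_space lborel (cbox 0 One)"


section \<open>Wavelets\<close>

definition fsupp :: "(real \<Rightarrow> real) \<Rightarrow> real set" where
  "fsupp f = closure {x. f x \<noteq> 0}"

text \<open>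
  The Hoelder--Zygmund space of order \<open>R = m + \<beta>\<close> with \<open>0 < \<beta> \<le> 1\<close>.  For
  \<open>\<beta> < 1\<close> the second-difference condition on the bounded function \<open>D m\<close> is equivalent to a
  \<open>\<beta>\<close>-Hoelder condition; for \<open>\<beta> = 1\<close> it is Zygmund's condition.
\<close>

definition holder_zygmund :: "real \<Rightarrow> (real \<Rightarrow> real) \<Rightarrow> bool" where
  "holder_zygmund R f \<longleftrightarrow>
     (\<exists>(m::nat) \<beta> D. R = real m + \<beta> \<and> 0 < \<beta> \<and> \<beta> \<le> 1 \<and> D 0 = f \<and>
        (\<forall>i<m. \<forall>x. (D i has_real_derivative D (Suc i) x) (at x)) \<and>
        continuous_on UNIV (D m) \<and>
        (\<forall>i\<le>m. bounded (range (D i))) \<and>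
        (\<exists>L. \<forall>x h. \<bar>D m (x + h) - 2 * D m x + D m (x - h)\<bar> \<le> L * \<bar>h\<bar> powr \<beta>))"

text \<open>
  Compactly supported orthonormal scaling function and wavelet on the line, generated by a
  finite filter \<open>h\<close> through the refinement and quadrature-mirror equations.  The integer \<open>q\<close>
  and the sign \<open>\<sigma>\<close> cover the usual normalizations of the wavelet.  The filter need not have
  minimal length \<open>2 * N\<close>, so besides the extremal-phase family this includes the symmlets and
  coiflets.
\<close>

locale daubechies_system =
  fixes \<phi> \<psi> :: "real \<Rightarrow> real" and N :: nat and R :: real
  assumes compact_supp: "compact (fsupp \<phi>)" "compact (fsupp \<psi>)"
    and integral_scaling: "integral\<^sup>L lborel \<phi> = 1"
    and refinement: "\<exists>(K::int set) h q \<sigma>. finite K \<and> \<bar>\<sigma>\<bar> = 1 \<and>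
          (\<forall>x. \<phi> x = sqrt 2 * (\<Sum>k\<in>K. h k * \<phi> (2 * x - of_int k))) \<and>
          (\<forall>x. \<psi> x = \<sigma> * sqrt 2 *
             (\<Sum>k\<in>K. (- 1) powi k * h k * \<phi> (2 * x - of_int q + of_int k))) \<and> odd (q::int)"
    and orthonormal_scaling:
      "l2_orthonormal lborel UNIV (\<lambda>(k::int) x. \<phi> (x - of_int k))"
    and orthonormal_wavelet:
      "l2_orthonormal lborel UNIV
         (\<lambda>(j::int, k::int) x. 2 powr (of_int j / 2) * \<psi> (2 powi j * x - of_int k))"
    and vanishing_moments: "\<forall>m<N. (\<integral>x. x ^ m * \<psi> x \<partial>lborel) = 0"
    and regularity: "holder_zygmund R \<phi>" "holder_zygmund R \<psi>"

text \<open>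
  Data of a boundary-corrected wavelet basis of \<open>[0,1]\<close>: the system on the line, the coarsest
  level, and the prototypes of the boundary functions.  Left prototypes live on \<open>[0,\<infinity>)\<close> and
  are dilated about 0, right ones live on \<open>(-\<infinity>,0]\<close> and are dilated and moved to 1.
\<close>

record wavelet_data =
  scaling_fun :: "real \<Rightarrow> real"
  wavelet_fun :: "real \<Rightarrow> real"
  moments :: nat
  level0 :: nat
  scaling_left :: "(real \<Rightarrow> real) list"
  scaling_right :: "(real \<Rightarrow> real) list"
  wavelet_left :: "(real \<Rightarrow> real) list"
  wavelet_right :: "(real \<Rightarrow> real) list"

datatype windex = Interior int | Left_Edge nat | Right_Edge nat

fun interval_fun ::
  "(real \<Rightarrow> real) \<Rightarrow> (real \<Rightarrow> real) list \<Rightarrow> (real \<Rightarrow> real) list \<Rightarrow> nat \<Rightarrow> windex \<Rightarrow> real \<Rightarrow> real"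
where
  "interval_fun f Ls Rs j (Interior k) x = 2 powr (real j / 2) * f (2 ^ j * x - of_int k)"
| "interval_fun f Ls Rs j (Left_Edge m) x = 2 powr (real j / 2) * (Ls ! m) (2 ^ j * x)"
| "interval_fun f Ls Rs j (Right_Edge m) x = 2 powr (real j / 2) * (Rs ! m) (2 ^ j * (x - 1))"

definition interval_idx ::
  "(real \<Rightarrow> real) \<Rightarrow> (real \<Rightarrow> real) list \<Rightarrow> (real \<Rightarrow> real) list \<Rightarrow> nat \<Rightarrow> windex set" where
  "interval_idx f Ls Rs j =
     Interior ` {k. fsupp (interval_fun f Ls Rs j (Interior k)) \<subseteq> {0<..<1}} \<union>
     Left_Edge ` {..<length Ls} \<union> Right_Edge ` {..<length Rs}"

definition phiI :: "wavelet_data \<Rightarrow> nat \<Rightarrow> windex \<Rightarrow> real \<Rightarrow> real" where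
  "phiI B = interval_fun (scaling_fun B) (scaling_left B) (scaling_right B)"

definition psiI :: "wavelet_data \<Rightarrow> nat \<Rightarrow> windex \<Rightarrow> real \<Rightarrow> real" where
  "psiI B = interval_fun (wavelet_fun B) (wavelet_left B) (wavelet_right B)"

definition idx_phi :: "wavelet_data \<Rightarrow> nat \<Rightarrow> windex set" where
  "idx_phi B = interval_idx (scaling_fun B) (scaling_left B) (scaling_right B)"

definition idx_psi :: "wavelet_data \<Rightarrow> nat \<Rightarrow> windex set" where
  "idx_psi B = interval_idx (wavelet_fun B) (wavelet_left B) (wavelet_right B)"

definition VI :: "wavelet_data \<Rightarrow> nat \<Rightarrow> (real \<Rightarrow> real) set" where
  "VI B j = l2_span unit_cube (idx_phi B j) (phiI B j)"

definition WI :: "wavelet_data \<Rightarrow> nat \<Rightarrow> (real \<Rightarrow> real) set" where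
  "WI B j = l2_span unit_cube (idx_psi B j) (psiI B j)"

text \<open>
  Orthogonality of the summands in \<open>complete\<close> follows from \<open>orthogonal_sum\<close>, so it only
  remains to say there that the algebraic sum of the spaces is dense.
\<close>

locale cdv_basis =
  fixes B :: wavelet_data and R :: real
  assumes daubechies: "daubechies_system (scaling_fun B) (wavelet_fun B) (moments B) R"
    and left_prototypes: "\<forall>e \<in> set (scaling_left B) \<union> set (wavelet_left B).
          e \<in> borel_measurable borel \<and> compact (fsupp e) \<and> fsupp e \<subseteq> {0..}"
    and right_prototypes: "\<forall>e \<in> set (scaling_right B) \<union> set (wavelet_right B).
          e \<in> borel_measurable borel \<and> compact (fsupp e) \<and> fsupp e \<subseteq> {..0}"
    and edges_disjoint: "\<forall>j\<ge>level0 B.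
          \<forall>l \<in> phiI B j ` Left_Edge ` {..<length (scaling_left B)} \<union>
                psiI B j ` Left_Edge ` {..<length (wavelet_left B)}.
          \<forall>r \<in> phiI B j ` Right_Edge ` {..<length (scaling_right B)} \<union>
                psiI B j ` Right_Edge ` {..<length (wavelet_right B)}.
            fsupp l \<inter> fsupp r = {}"
    and card_idx: "\<forall>j\<ge>level0 B. card (idx_phi B j) = 2 ^ j \<and> card (idx_psi B j) = 2 ^ j"
    and orthonormal: "\<forall>j\<ge>level0 B.
          l2_orthonormal unit_cube (idx_phi B j) (phiI B j) \<and>
          l2_orthonormal unit_cube (idx_psi B j) (psiI B j)"
    and orthogonal_sum: "\<forall>j\<ge>level0 B.
          VI B (Suc j) = {\<lambda>x. v x + w x | v w. v \<in> VI B j \<and> w \<in> WI B j} \<and>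
          (\<forall>v \<in> VI B j. \<forall>w \<in> WI B j. l2_inner unit_cube v w = 0)"
    and complete: "\<forall>h \<in> l2 unit_cube. \<forall>e>0. \<exists>J v w.
          v \<in> VI B (level0 B) \<and> (\<forall>j\<in>{level0 B..<J}. w j \<in> WI B j) \<and>
          l2_dist unit_cube h (\<lambda>x. v x + (\<Sum>j\<in>{level0 B..<J}. w j x)) < e"
    and polynomials: "\<forall>j\<ge>level0 B. \<forall>p :: real poly.
          degree p < moments B \<longrightarrow> poly p \<in> VI B j"

definition phi_tensor :: "wavelet_data \<Rightarrow> nat \<Rightarrow> ('d \<Rightarrow> windex) \<Rightarrow> real ^ 'd \<Rightarrow> real" where
  "phi_tensor B j l x = (\<Prod>i\<in>UNIV. phiI B j (l i) (x $ i))"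

definition V_cube :: "wavelet_data \<Rightarrow> nat \<Rightarrow> (real ^ 'd::finite \<Rightarrow> real) set" where
  "V_cube B j = l2_span unit_cube {l. \<forall>i. l i \<in> idx_phi B j} (phi_tensor B j)"

definition proj_V :: "wavelet_data \<Rightarrow> nat \<Rightarrow> (real ^ 'd::finite \<Rightarrow> real) \<Rightarrow> real ^ 'd \<Rightarrow> real" where
  "proj_V B j = l2_proj unit_cube (V_cube B j)"

definition detail :: "wavelet_data \<Rightarrow> nat \<Rightarrow> (real ^ 'd::finite \<Rightarrow> real) \<Rightarrow> real ^ 'd \<Rightarrow> real" where
  "detail B j h x = proj_V B (Suc j) h x - proj_V B j h x"


section \<open>Function classes\<close>

definition besov_norm :: "wavelet_data \<Rightarrow> real \<Rightarrow> (real ^ 'd::finite \<Rightarrow> real) \<Rightarrow> ereal" where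
  "besov_norm B u h =
     ereal (2 powr (real (level0 B) * u) * l2_norm unit_cube (proj_V B (level0 B) h)) +
     (SUP j\<in>{level0 B..}. ereal (2 powr (real j * u) * l2_norm unit_cube (detail B j h)))"

definition besov_ball :: "wavelet_data \<Rightarrow> real \<Rightarrow> real \<Rightarrow> (real ^ 'd::finite \<Rightarrow> real) set" where
  "besov_ball B u M = {h \<in> l2 unit_cube. besov_norm B u h \<le> ereal M}"

definition fclass :: "wavelet_data \<Rightarrow> real \<Rightarrow> real \<Rightarrow> (real ^ 'd::finite \<Rightarrow> real) set" where
  "fclass B u M = {f \<in> besov_ball B u M. AE x in unit_cube. 0 \<le> f x \<and> f x \<le> 1}"


section \<open>Observations and confidence sets\<close>

definition sample_space :: "nat \<Rightarrow> (nat \<Rightarrow> (real ^ 'd::finite) \<times> bool) measure" where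
  "sample_space n = (\<Pi>\<^sub>M i\<in>{..<n}. unit_cube \<Otimes>\<^sub>M count_space UNIV)"

text \<open>
  The law of one pair: \<open>X\<close> has Lebesgue density \<open>g\<close> on the cube and, given \<open>X = x\<close>, \<open>Y\<close> is
  Bernoulli with success probability \<open>f x\<close>.  (\<open>bernoulli_pmf\<close> clips its parameter
  to \<open>[0,1]\<close>, which matters only on the null set where \<open>f\<close> leaves \<open>[0,1]\<close>.)
\<close>

definition obs_law ::
  "(real ^ 'd::finite \<Rightarrow> real) \<Rightarrow> (real ^ 'd \<Rightarrow> real) \<Rightarrow> ((real ^ 'd) \<times> bool) measure" where
  "obs_law f g = density (unit_cube \<Otimes>\<^sub>M count_space UNIV)
     (\<lambda>(x, y). ennreal (g x * pmf (bernoulli_pmf (f x)) y))"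

definition sample_law ::
  "nat \<Rightarrow> (real ^ 'd::finite \<Rightarrow> real) \<Rightarrow> (real ^ 'd \<Rightarrow> real) \<Rightarrow>
     (nat \<Rightarrow> (real ^ 'd) \<times> bool) measure" where
  "sample_law n f g = (\<Pi>\<^sub>M i\<in>{..<n}. obs_law f g)"

text \<open>Effros-measurable random closed subset of \<open>L\<^sup>2\<close>, a function of the \<open>n\<close> observations.\<close>

definition confidence_set ::
  "nat \<Rightarrow> ((nat \<Rightarrow> (real ^ 'd::finite) \<times> bool) \<Rightarrow> (real ^ 'd \<Rightarrow> real) set) \<Rightarrow> bool" where
  "confidence_set n C \<longleftrightarrow>
     (\<forall>\<omega> \<in> space (sample_space n). closedin (l2_topology unit_cube) (C \<omega>)) \<and>
     (\<forall>U. openin (l2_topology unit_cube) U \<longrightarrow>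
        {\<omega> \<in> space (sample_space n). C \<omega> \<inter> U \<noteq> {}} \<in> sets (sample_space n))"

text \<open>The rates, for sample size \<open>n\<close>, smoothness \<open>s\<close> and dimension \<open>d\<close>.\<close>

definition eps_rate :: "nat \<Rightarrow> nat \<Rightarrow> real \<Rightarrow> real" where
  "eps_rate d n s = real n powr (- s / (2 * s + real d))"

definition rho_rate :: "nat \<Rightarrow> nat \<Rightarrow> real \<Rightarrow> real" where
  "rho_rate d n s = real n powr (- (2 * s) / (4 * s + real d))"

definition separated_class ::
  "wavelet_data \<Rightarrow> real \<Rightarrow> real \<Rightarrow> real \<Rightarrow> real \<Rightarrow> real \<Rightarrow> (real ^ 'd::finite \<Rightarrow> real) set" where
  "separated_class B r t s M b =
     fclass B s M \<union>
     {f \<in> fclass B r M. l2_setdist unit_cube f (besov_ball B t M) \<ge> ereal b}"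

end

theory Submission
  imports Defs
begin

text \<open>
  The result is a testing lower bound.  Let \<open>f\<^sub>0\<close> be a small constant \<open>c\<close>, which belongs to
  \<open>\<F>\<^sub>s(M)\<close>.  At a resolution level \<open>j\<close> with \<open>2\<^sup>j\<close> of the order of \<open>n\<close> to the power
  \<open>2 / (4r + d)\<close>, add a combination \<open>g\<close> with random signs of \<open>N\<close> orthonormal wavelets of that
  level, where \<open>N\<close> is of the order of \<open>2\<^sup>j\<^sup>d\<close>, scaled to the norm
  \<open>\<beta> = \<delta> * 2 powr (- j * r)\<close>, which is of the order of \<open>\<rho>\<^sub>n(r)\<close>.  Three properties of
  \<open>f\<^sub>1 = c + g\<close> matter.

  \<^item> It is a legitimate alternative.  Its only detail is \<open>g\<close>, at level \<open>j\<close>, so it lies in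
    \<open>\<F>\<^sub>r(M)\<close> if \<open>\<delta>\<close> is small (\<open>fclass_level_perturbation\<close>).  A member of the ball \<open>\<B>\<^sub>t(M)\<close>
    has a detail of norm at most \<open>M * 2 powr (- j * t)\<close> there, which is negligible against \<open>\<beta>\<close>
    because \<open>t > r\<close>.  So the distance of \<open>f\<^sub>1\<close> from the ball is nearly \<open>\<beta>\<close> or more, hence for large \<open>n\<close> at least
    \<open>a\<^sub>n = o(\<rho>\<^sub>n(r))\<close> (\<open>dist_level_perturbation_besov_ball\<close>).

  \<^item> It cannot be detected.  The likelihood ratio of the mixture over all signs against \<open>f\<^sub>0\<close>
    has a second moment of at most \<open>exp (N * b\<^sup>2)\<close>, where \<open>b = n * \<beta>\<^sup>2 / (N * c * (1 - c))\<close>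
    (\<open>mixture_indistinguishable\<close>).  The choice of \<open>j\<close> makes \<open>N * b\<^sup>2\<close> at most a constant
    times \<open>\<delta>\<^sup>4\<close>, uniformly in \<open>n\<close>.  So for small \<open>\<delta>\<close> every event that is likely under \<open>f\<^sub>0\<close> is
    nearly as likely under at least one choice of the signs.

  \<^item> It is too far away.  As \<open>s > 2 * r\<close>, the rate \<open>\<epsilon>\<^sub>n(s)\<close> is of smaller order than
    \<open>\<rho>\<^sub>n(r)\<close>, and so than the distance \<open>\<beta>\<close> of \<open>f\<^sub>0\<close> and \<open>f\<^sub>1\<close> (\<open>eps_rate_below_rho_rate\<close>).

  Suppose that a confidence set were honest and adaptive, and let \<open>E\<close> be the event that it contains
  \<open>f\<^sub>0\<close> but nothing farther than \<open>K * \<epsilon>\<^sub>n(s)\<close> from \<open>f\<^sub>0\<close>.  Coverage and small diameter at \<open>f\<^sub>0\<close>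
  give \<open>E\<close> a probability of at least about \<open>1 - \<alpha> - \<alpha>'\<close> under \<open>f\<^sub>0\<close>, hence also under some
  \<open>f\<^sub>1\<close>.  But on \<open>E\<close> the set misses \<open>f\<^sub>1\<close>, so coverage at \<open>f\<^sub>1\<close> bounds that probability by about
  \<open>\<alpha>\<close>.  This contradicts \<open>2 * \<alpha> + \<alpha>' < 1\<close>.

  One point of measure theory needs care: a non-measurable set has \<open>measure\<close> 0, so the bound on the
  diameter says something only because \<open>{diam > x}\<close> is an event.  This follows from the
  separability of \<open>L\<^sup>2\<close> of the cube (\<open>confidence_set_diam_measurable\<close>).
\<close>

section \<open>The Hilbert space structure of square-integrable functions\<close>

lemma l2_measurable [measurable_dest]: "f \<in> l2 M \<Longrightarrow> f \<in> borel_measurable M"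
  by (simp add: l2_def)

lemma l2_square_integrable: "f \<in> l2 M \<Longrightarrow> integrable M (\<lambda>x. (f x)\<^sup>2)"
  by (simp add: l2_def)

lemma l2_mult_integrable:
  assumes "f \<in> l2 M" "g \<in> l2 M" shows "integrable M (\<lambda>x. f x * g x)"
proof (rule Bochner_Integration.integrable_bound)
  show "integrable M (\<lambda>x. (f x)\<^sup>2 + (g x)\<^sup>2)"
    using assms by (auto simp: l2_def)
  show "(\<lambda>x. f x * g x) \<in> borel_measurable M"
    using assms by (auto simp: l2_def)
  have "\<bar>f x * g x\<bar> \<le> (f x)\<^sup>2 + (g x)\<^sup>2" for x
    using sum_squares_bound[of "\<bar>f x\<bar>" "\<bar>g x\<bar>"] abs_ge_zero[of "f x * g x"]
    unfolding abs_mult power2_abs by linarith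
  then show "AE x in M. norm (f x * g x) \<le> norm ((f x)\<^sup>2 + (g x)\<^sup>2)"
    by simp
qed

lemma l2_add: assumes "f \<in> l2 M" "g \<in> l2 M" shows "(\<lambda>x. f x + g x) \<in> l2 M"
  using assms l2_mult_integrable[OF assms]
  by (auto simp: l2_def power2_sum mult.assoc)

lemma l2_cmult: "f \<in> l2 M \<Longrightarrow> (\<lambda>x. c * f x) \<in> l2 M"
  by (auto simp: l2_def power_mult_distrib)

lemma l2_diff: assumes "f \<in> l2 M" "g \<in> l2 M" shows "(\<lambda>x. f x - g x) \<in> l2 M"
  using l2_add[OF assms(1) l2_cmult[OF assms(2), of "-1"]] by simp

lemma l2_zero: "(\<lambda>x. 0) \<in> l2 M"
  by (simp add: l2_def)

lemma l2_sum: "(\<And>i. i \<in> I \<Longrightarrow> F i \<in> l2 M) \<Longrightarrow> (\<lambda>x. \<Sum>i\<in>I. F i x) \<in> l2 M"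
  by (induction I rule: infinite_finite_induct) (auto intro: l2_add l2_zero)

lemma l2_bounded:
  assumes "finite_measure M" "f \<in> borel_measurable M" "\<And>x. x \<in> space M \<Longrightarrow> \<bar>f x\<bar> \<le> K"
  shows "f \<in> l2 M"
proof -
  interpret finite_measure M by fact
  have "(f x)\<^sup>2 \<le> K\<^sup>2" if "x \<in> space M" for x
    using power_mono[OF assms(3)[OF that], of 2] by simp
  then have "integrable M (\<lambda>x. (f x)\<^sup>2)"
    using assms(2) by (intro integrable_const_bound[of _ "K\<^sup>2"]) auto
  then show ?thesis using assms(2) by (simp add: l2_def)
qed

lemma l2_inner_add_left:
  "f \<in> l2 M \<Longrightarrow> g \<in> l2 M \<Longrightarrow> h \<in> l2 M \<Longrightarrow>
     l2_inner M (\<lambda>x. f x + g x) h = l2_inner M f h + l2_inner M g h"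
  by (simp add: l2_inner_def distrib_right l2_mult_integrable)

lemma l2_inner_diff_left:
  "f \<in> l2 M \<Longrightarrow> g \<in> l2 M \<Longrightarrow> h \<in> l2 M \<Longrightarrow>
     l2_inner M (\<lambda>x. f x - g x) h = l2_inner M f h - l2_inner M g h"
  by (simp add: l2_inner_def left_diff_distrib l2_mult_integrable)

lemma l2_inner_commute: "l2_inner M f g = l2_inner M g f"
  by (simp add: l2_inner_def mult.commute)

lemma l2_inner_cmult_left: "l2_inner M (\<lambda>x. c * f x) g = c * l2_inner M f g"
  by (simp add: l2_inner_def mult.assoc)

lemma l2_inner_sum_left:
  assumes "\<And>i. i \<in> I \<Longrightarrow> F i \<in> l2 M" "g \<in> l2 M"
  shows "l2_inner M (\<lambda>x. \<Sum>i\<in>I. F i x) g = (\<Sum>i\<in>I. l2_inner M (F i) g)"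
  by (simp add: l2_inner_def sum_distrib_right assms l2_mult_integrable)

lemma l2_inner_cong_AE:
  assumes "AE x in M. f x = f' x" "f \<in> l2 M" "f' \<in> l2 M" "g \<in> l2 M"
  shows "l2_inner M f g = l2_inner M f' g"
  unfolding l2_inner_def
proof (rule integral_cong_AE)
  show "AE x in M. f x * g x = f' x * g x" using assms(1) by eventually_elim simp
qed (use assms in \<open>auto simp: l2_def\<close>)

lemma l2_norm_nonneg: "0 \<le> l2_norm M f"
  by (simp add: l2_norm_def)

lemma l2_norm_square: "(l2_norm M f)\<^sup>2 = l2_inner M f f"
  by (simp add: l2_norm_def l2_inner_def power2_eq_square[symmetric])

lemma l2_norm_cmult: "l2_norm M (\<lambda>x. c * f x) = \<bar>c\<bar> * l2_norm M f"
  by (simp add: l2_norm_def power_mult_distrib real_sqrt_mult)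

lemma l2_norm_cong_AE:
  assumes "AE x in M. f x = f' x" "f \<in> l2 M" "f' \<in> l2 M"
  shows "l2_norm M f = l2_norm M f'"
proof -
  have "(\<integral>x. (f x)\<^sup>2 \<partial>M) = (\<integral>x. (f' x)\<^sup>2 \<partial>M)"
  proof (rule integral_cong_AE)
    show "AE x in M. (f x)\<^sup>2 = (f' x)\<^sup>2" using assms(1) by eventually_elim simp
  qed (use assms in \<open>auto simp: l2_def\<close>)
  then show ?thesis by (simp add: l2_norm_def)
qed

lemma l2_norm_eq_zero_AE:
  assumes "f \<in> l2 M" "l2_inner M f f = 0" shows "AE x in M. f x = 0"
proof -
  have "AE x in M. (f x)\<^sup>2 = 0"
    using assms integral_nonneg_eq_0_iff_AE[of M "\<lambda>x. (f x)\<^sup>2"]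
    by (auto simp: l2_inner_def l2_def power2_eq_square)
  then show ?thesis by simp
qed

text \<open>The discriminant argument: the squared norm of \<open>s * f - g\<close> is a nonnegative quadratic
  polynomial in \<open>s\<close>.\<close>

lemma l2_Cauchy_Schwarz:
  assumes f: "f \<in> l2 M" and g: "g \<in> l2 M"
  shows "\<bar>l2_inner M f g\<bar> \<le> l2_norm M f * l2_norm M g"
proof -
  let ?a = "l2_inner M f f" and ?b = "l2_inner M f g" and ?c = "l2_inner M g g"
  have q: "0 \<le> ?a * s\<^sup>2 - 2 * (s * ?b) + ?c" for s
  proof -
    have "0 \<le> l2_inner M (\<lambda>x. s * f x - g x) (\<lambda>x. s * f x - g x)"
      by (simp add: l2_inner_def)
    also have "\<dots> = ?a * s\<^sup>2 - 2 * (s * ?b) + ?c"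
    proof -
      have "l2_inner M (\<lambda>x. s * f x - g x) (\<lambda>x. s * f x - g x) =
          (\<integral>x. s\<^sup>2 * (f x * f x) - (2 * s) * (f x * g x) + g x * g x \<partial>M)"
        unfolding l2_inner_def
        by (rule Bochner_Integration.integral_cong) (auto simp: algebra_simps power2_eq_square)
      also have "\<dots> = s\<^sup>2 * ?a - (2 * s) * ?b + ?c"
        by (simp add: l2_mult_integrable f g l2_inner_def)
      finally show ?thesis by simp
    qed
    finally show ?thesis .
  qed
  have "?b\<^sup>2 \<le> ?a * ?c"
  proof (cases "?a = 0")
    case True
    have "?b = 0"
    proof (rule ccontr)
      assume "?b \<noteq> 0"
      \<comment> \<open>the polynomial is affine, and this value of \<open>s\<close> makes it equal to \<open>-1\<close>\<close>
      then show False using q[of "(?c + 1) / (2 * ?b)"] True by simp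
    qed
    then show ?thesis using True by simp
  next
    case False
    then have "?a > 0" by (simp add: l2_inner_def less_le)
    have "0 \<le> ?a * (?a * (?b / ?a)\<^sup>2 - 2 * (?b / ?a * ?b) + ?c)"
      using q[of "?b / ?a"] \<open>?a > 0\<close> by (intro mult_nonneg_nonneg) auto
    also have "\<dots> = ?a * ?c - ?b\<^sup>2"
      using \<open>?a > 0\<close> by (simp add: field_simps power2_eq_square)
    finally show ?thesis by simp
  qed
  then have "\<bar>?b\<bar>\<^sup>2 \<le> (l2_norm M f * l2_norm M g)\<^sup>2"
    by (simp add: power_mult_distrib l2_norm_square)
  then show ?thesis
    by (rule power2_le_imp_le) (simp add: l2_norm_nonneg)
qed

lemma l2_norm_add_square:
  assumes "f \<in> l2 M" "g \<in> l2 M"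
  shows "(l2_norm M (\<lambda>x. f x + g x))\<^sup>2 = (l2_norm M f)\<^sup>2 + 2 * l2_inner M f g + (l2_norm M g)\<^sup>2"
proof -
  have "(l2_norm M (\<lambda>x. f x + g x))\<^sup>2 = (\<integral>x. f x * f x + 2 * (f x * g x) + g x * g x \<partial>M)"
    unfolding l2_norm_square l2_inner_def
    by (rule Bochner_Integration.integral_cong) (auto simp: algebra_simps)
  also have "\<dots> = (l2_norm M f)\<^sup>2 + 2 * l2_inner M f g + (l2_norm M g)\<^sup>2"
    unfolding l2_norm_square by (simp add: l2_mult_integrable assms l2_inner_def)
  finally show ?thesis .
qed

lemma l2_norm_triangle:
  assumes "f \<in> l2 M" "g \<in> l2 M"
  shows "l2_norm M (\<lambda>x. f x + g x) \<le> l2_norm M f + l2_norm M g"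
proof (rule power2_le_imp_le)
  have "l2_inner M f g \<le> l2_norm M f * l2_norm M g"
    using l2_Cauchy_Schwarz[OF assms] by linarith
  then show "(l2_norm M (\<lambda>x. f x + g x))\<^sup>2 \<le> (l2_norm M f + l2_norm M g)\<^sup>2"
    by (simp add: l2_norm_add_square[OF assms] power2_sum)
qed (simp add: l2_norm_nonneg)

lemma l2_dist_nonneg: "0 \<le> l2_dist M f g"
  by (simp add: l2_dist_def l2_norm_nonneg)

lemma l2_dist_commute: "l2_dist M f g = l2_dist M g f"
  by (simp add: l2_dist_def l2_norm_def power2_commute)

lemma l2_dist_self: "l2_dist M f f = 0"
  by (simp add: l2_dist_def l2_norm_def)

lemma l2_dist_triangle:
  assumes "f \<in> l2 M" "g \<in> l2 M" "h \<in> l2 M"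
  shows "l2_dist M f h \<le> l2_dist M f g + l2_dist M g h"
  using l2_norm_triangle[OF l2_diff[OF assms(1,2)] l2_diff[OF assms(2,3)]]
  by (simp add: l2_dist_def)

lemma topspace_l2_topology: "topspace (l2_topology M) = l2 M"
proof
  show "topspace (l2_topology M) \<subseteq> l2 M"
    using openin_topspace[of "l2_topology M"] unfolding openin_l2_topology by blast
  have "openin (l2_topology M) (l2 M)"
    unfolding openin_l2_topology by (auto intro: exI[of _ 1])
  then show "l2 M \<subseteq> topspace (l2_topology M)" by (rule openin_subset)
qed

lemma openin_l2_ball:
  assumes "p \<in> l2 M" shows "openin (l2_topology M) {g \<in> l2 M. l2_dist M p g < e}"
  unfolding openin_l2_topology
proof (intro conjI ballI)
  fix f assume "f \<in> {g \<in> l2 M. l2_dist M p g < e}"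
  then have f: "f \<in> l2 M" "l2_dist M p f < e" by auto
  show "\<exists>e'>0. \<forall>g\<in>l2 M. l2_dist M f g < e' \<longrightarrow> g \<in> {g \<in> l2 M. l2_dist M p g < e}"
  proof (intro exI conjI ballI impI)
    show "0 < e - l2_dist M p f" using f by simp
    fix g assume "g \<in> l2 M" "l2_dist M f g < e - l2_dist M p f"
    then show "g \<in> {g \<in> l2 M. l2_dist M p g < e}"
      using l2_dist_triangle[OF assms f(1), of g] by auto
  qed
qed auto

lemma openin_l2_ball_exterior:
  assumes "p \<in> l2 M" shows "openin (l2_topology M) {g \<in> l2 M. e < l2_dist M p g}"
  unfolding openin_l2_topology
proof (intro conjI ballI)
  fix f assume "f \<in> {g \<in> l2 M. e < l2_dist M p g}"
  then have f: "f \<in> l2 M" "e < l2_dist M p f" by auto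
  show "\<exists>e'>0. \<forall>g\<in>l2 M. l2_dist M f g < e' \<longrightarrow> g \<in> {g \<in> l2 M. e < l2_dist M p g}"
  proof (intro exI conjI ballI impI)
    show "0 < l2_dist M p f - e" using f by simp
    fix g assume "g \<in> l2 M" "l2_dist M f g < l2_dist M p f - e"
    then show "g \<in> {g \<in> l2 M. e < l2_dist M p g}"
      using l2_dist_triangle[OF assms _ f(1), of g] by (auto simp: l2_dist_commute)
  qed
qed auto

section \<open>Separability and measurable events\<close>

text \<open>The closure of \<open>D\<close> in \<open>L\<^sup>2\<close>.\<close>

definition l2_approx :: "'a measure \<Rightarrow> ('a \<Rightarrow> real) set \<Rightarrow> ('a \<Rightarrow> real) set" where
  "l2_approx M D = {f \<in> l2 M. \<forall>e>0. \<exists>g\<in>D. l2_dist M f g < e}"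

lemma l2_approx_limit:
  assumes "f \<in> l2 M" "\<And>n. F n \<in> l2_approx M D" "D \<subseteq> l2 M"
    and "(\<lambda>n. l2_dist M f (F n)) \<longlonglongrightarrow> 0"
  shows "f \<in> l2_approx M D"
  unfolding l2_approx_def
proof (intro CollectI conjI allI impI)
  fix e :: real assume "e > 0"
  then have "\<forall>\<^sub>F n in sequentially. l2_dist M f (F n) < e / 2"
    using assms(4) by (intro order_tendstoD) auto
  then obtain n where n: "l2_dist M f (F n) < e / 2"
    using eventually_happens'[OF sequentially_bot] by blast
  have Fn: "F n \<in> l2 M" using assms(2) by (simp add: l2_approx_def)
  have "e / 2 > 0" using \<open>e > 0\<close> by simp
  then obtain g where g: "g \<in> D" "l2_dist M (F n) g < e / 2"
    using assms(2)[of n] unfolding l2_approx_def by blast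
  show "\<exists>g\<in>D. l2_dist M f g < e"
    using l2_dist_triangle[OF assms(1) Fn, of g] g n assms(3) by (intro bexI[of _ g]) auto
qed fact

lemma l2_approx_add:
  assumes D: "D \<subseteq> l2 M" and add: "\<And>f g. f \<in> D \<Longrightarrow> g \<in> D \<Longrightarrow> (\<lambda>x. f x + g x) \<in> D"
    and f: "f \<in> l2_approx M D" and g: "g \<in> l2_approx M D"
  shows "(\<lambda>x. f x + g x) \<in> l2_approx M D"
  unfolding l2_approx_def
proof (intro CollectI conjI allI impI)
  have fg: "f \<in> l2 M" "g \<in> l2 M" using f g by (auto simp: l2_approx_def)
  then show "(\<lambda>x. f x + g x) \<in> l2 M" by (rule l2_add)
  fix e :: real assume "e > 0"
  then have e: "e / 2 > 0" by simp
  obtain p where p: "p \<in> D" "l2_dist M f p < e / 2"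
    using f e unfolding l2_approx_def by blast
  obtain q where q: "q \<in> D" "l2_dist M g q < e / 2"
    using g e unfolding l2_approx_def by blast
  have "l2_dist M (\<lambda>x. f x + g x) (\<lambda>x. p x + q x) \<le> l2_dist M f p + l2_dist M g q"
    using l2_norm_triangle[of "\<lambda>x. f x - p x" M "\<lambda>x. g x - q x"] fg p q D
    by (auto simp: l2_dist_def l2_diff subset_iff algebra_simps)
  then show "\<exists>h\<in>D. l2_dist M (\<lambda>x. f x + g x) h < e"
    using p q add by (intro bexI[of _ "\<lambda>x. p x + q x"]) auto
qed

text \<open>Only rational multiples of members of \<open>D\<close> are supposed to lie in \<open>D\<close>, which lets \<open>D\<close> be
  countable; a real factor is therefore replaced by a nearby rational one.\<close>

lemma l2_approx_cmult:
  assumes D: "D \<subseteq> l2 M" and cmult: "\<And>f q. f \<in> D \<Longrightarrow> q \<in> \<rat> \<Longrightarrow> (\<lambda>x. q * f x) \<in> D"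
    and f: "f \<in> l2_approx M D"
  shows "(\<lambda>x. c * f x) \<in> l2_approx M D"
  unfolding l2_approx_def
proof (intro CollectI conjI allI impI)
  have fl: "f \<in> l2 M" using f by (auto simp: l2_approx_def)
  then show "(\<lambda>x. c * f x) \<in> l2 M" by (rule l2_cmult)
  fix e :: real assume e: "e > 0"
  have "e / (2 * (\<bar>c\<bar> + 1)) > 0" using e by simp
  then obtain g where g: "g \<in> D" "l2_dist M f g < e / (2 * (\<bar>c\<bar> + 1))"
    using f unfolding l2_approx_def by blast
  have gl: "g \<in> l2 M" using g D by auto
  have "e / (2 * (l2_norm M g + 1)) > 0" using e l2_norm_nonneg[of M g] by simp
  then obtain q where q: "q \<in> \<rat>" "c < q" "q < c + e / (2 * (l2_norm M g + 1))"
    using Rats_dense_in_real[of c "c + e / (2 * (l2_norm M g + 1))"] by auto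
  have "l2_dist M (\<lambda>x. c * f x) (\<lambda>x. c * g x) = \<bar>c\<bar> * l2_dist M f g"
    using l2_norm_cmult[of M c "\<lambda>x. f x - g x"] by (simp add: l2_dist_def right_diff_distrib)
  also have "\<dots> \<le> (\<bar>c\<bar> + 1) * l2_dist M f g"
    by (intro mult_right_mono) (auto simp: l2_dist_nonneg)
  also have "\<dots> < (\<bar>c\<bar> + 1) * (e / (2 * (\<bar>c\<bar> + 1)))"
    using g by (intro mult_strict_left_mono) auto
  also have "\<dots> = e / 2" by (simp add: field_simps)
  finally have 1: "l2_dist M (\<lambda>x. c * f x) (\<lambda>x. c * g x) < e / 2" .
  have "l2_dist M (\<lambda>x. c * g x) (\<lambda>x. q * g x) = \<bar>c - q\<bar> * l2_norm M g"
    using l2_norm_cmult[of M "c - q" g] by (simp add: l2_dist_def left_diff_distrib)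
  also have "\<dots> \<le> (e / (2 * (l2_norm M g + 1))) * (l2_norm M g + 1)"
    using q l2_norm_nonneg[of M g] by (intro mult_mono) auto
  also have "\<dots> = e / 2" using l2_norm_nonneg[of M g] by (simp add: field_simps)
  finally have 2: "l2_dist M (\<lambda>x. c * g x) (\<lambda>x. q * g x) \<le> e / 2" .
  have "l2_dist M (\<lambda>x. c * f x) (\<lambda>x. q * g x) < e"
    using 1 2 l2_dist_triangle[of "\<lambda>x. c * f x" M "\<lambda>x. c * g x" "\<lambda>x. q * g x"] fl gl
    by (auto simp: l2_cmult)
  then show "\<exists>h\<in>D. l2_dist M (\<lambda>x. c * f x) h < e"
    using cmult[OF g(1) q(1)] by blast
qed

lemma l2_dist_dominated_convergence:
  assumes f: "f \<in> l2 M" and F: "\<And>n. F n \<in> l2 M" and w: "w \<in> l2 M"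
    and bound: "\<And>n x. x \<in> space M \<Longrightarrow> \<bar>f x - F n x\<bar> \<le> w x"
    and lim: "\<And>x. x \<in> space M \<Longrightarrow> (\<lambda>n. F n x) \<longlonglongrightarrow> f x"
  shows "(\<lambda>n. l2_dist M f (F n)) \<longlonglongrightarrow> 0"
proof -
  have "(\<lambda>n. \<integral>x. (f x - F n x)\<^sup>2 \<partial>M) \<longlonglongrightarrow> (\<integral>x. 0 \<partial>M)"
  proof (rule integral_dominated_convergence[where w = "\<lambda>x. (w x)\<^sup>2"])
    show "integrable M (\<lambda>x. (w x)\<^sup>2)" using w by (rule l2_square_integrable)
    show "AE x in M. (\<lambda>n. (f x - F n x)\<^sup>2) \<longlonglongrightarrow> 0"
    proof (rule AE_I2)
      fix x assume "x \<in> space M"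
      from tendsto_power[OF tendsto_diff[OF tendsto_const lim[OF this]], of "f x" 2]
      show "(\<lambda>n. (f x - F n x)\<^sup>2) \<longlonglongrightarrow> 0" by simp
    qed
    show "AE x in M. norm ((f x - F n x)\<^sup>2) \<le> (w x)\<^sup>2" for n
      using power_mono[OF bound abs_ge_zero, of _ n 2] by (intro AE_I2) simp
  qed (use f F in \<open>auto intro!: borel_measurable_power borel_measurable_diff l2_measurable\<close>)
  from tendsto_real_sqrt[OF this] show ?thesis
    by (simp add: l2_dist_def l2_norm_def)
qed

text \<open>
  The rational combinations of indicators of a countable generator are dense: the sets whose
  indicator can be approximated form a Dynkin system, and every square-integrable function is a
  dominated limit of simple ones.
\<close>

lemma l2_separable:
  assumes fin: "finite_measure M" and E: "countable E" "Int_stable E" "E \<subseteq> Pow (space M)"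
    and sets: "sets M = sigma_sets (space M) E" and top: "space M \<in> E"
  shows "\<exists>D. countable D \<and> D \<subseteq> l2 M \<and> l2 M = l2_approx M D"
proof -
  interpret finite_measure M by fact
  define cb where "cb xs x = (\<Sum>(q,U)\<leftarrow>xs. q * indicator U x)" for xs :: "(real \<times> 'a set) list" and x
  define D where "D = cb ` lists (\<rat> \<times> E)"
  have ind: "indicator A \<in> l2 M" if "A \<in> sets M" for A
    using that by (intro l2_bounded[OF fin, of _ 1]) (auto simp: indicator_def)
  have Esets: "E \<subseteq> sets M" using E by (auto simp: sets)
  have "countable D"
    unfolding D_def using E countable_rat by (intro countable_image countable_lists countable_SIGMA) auto
  have D: "D \<subseteq> l2 M"
  proof -
    have "cb xs \<in> l2 M" if "xs \<in> lists (\<rat> \<times> E)" for xs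
      using that
    proof (induction xs)
      case Nil
      then show ?case by (simp add: cb_def[abs_def] l2_zero)
    next
      case (Cons a xs)
      obtain q U where a: "a = (q, U)" "U \<in> E" using Cons by auto
      have "(\<lambda>x. q * indicator U x + cb xs x) \<in> l2 M"
        using Cons a Esets by (intro l2_add l2_cmult ind) auto
      then show ?case by (simp add: cb_def[abs_def] a)
    qed
    then show ?thesis by (auto simp: D_def)
  qed
  have add: "(\<lambda>x. f x + g x) \<in> D" if fg: "f \<in> D" "g \<in> D" for f g
  proof -
    obtain xs ys where "f = cb xs" "g = cb ys" "xs \<in> lists (\<rat> \<times> E)" "ys \<in> lists (\<rat> \<times> E)"
      using fg unfolding D_def by blast
    moreover from this have "(\<lambda>x. f x + g x) = cb (xs @ ys)"
      by (simp add: cb_def fun_eq_iff)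
    ultimately show ?thesis unfolding D_def by (intro image_eqI[of _ _ "xs @ ys"]) auto
  qed
  have cmult: "(\<lambda>x. r * f x) \<in> D" if fr: "f \<in> D" "r \<in> \<rat>" for f r
  proof -
    obtain xs where xs: "f = cb xs" "xs \<in> lists (\<rat> \<times> E)"
      using fr unfolding D_def by blast
    have "(\<lambda>x. r * f x) = cb (map (\<lambda>(q, U). (r * q, U)) xs)"
      unfolding xs by (rule ext, induction xs) (auto simp: cb_def algebra_simps)
    moreover have "map (\<lambda>(q, U). (r * q, U)) xs \<in> lists (\<rat> \<times> E)"
      using xs fr by (auto simp: lists_eq_set)
    ultimately show ?thesis unfolding D_def by blast
  qed
  note appr_add = l2_approx_add[OF D add] and appr_cmult = l2_approx_cmult[OF D cmult]
  have appr_0: "(\<lambda>x. 0) \<in> l2_approx M D"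
  proof -
    have "(\<lambda>x. 0) \<in> D"
      unfolding D_def by (rule image_eqI[of _ _ "[]"]) (auto simp: cb_def)
    then show ?thesis
      by (auto simp: l2_approx_def l2_zero intro!: bexI[of _ "\<lambda>x. 0"] simp: l2_dist_self)
  qed
  have appr_sum: "(\<lambda>x. \<Sum>i\<in>I. F i x) \<in> l2_approx M D"
    if "\<And>i. i \<in> I \<Longrightarrow> F i \<in> l2_approx M D" for I :: "'i set" and F
    using that by (induction I rule: infinite_finite_induct) (auto intro: appr_add appr_0)
  have ind_E: "indicator A \<in> l2_approx M D" if A: "A \<in> E" for A
  proof -
    have "indicator A \<in> D"
      unfolding D_def by (rule image_eqI[of _ _ "[(1, A)]"]) (auto simp: cb_def A)
    then show ?thesis
      using ind A Esets
      by (auto simp: l2_approx_def intro!: bexI[of _ "indicator A"] simp: l2_dist_self)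
  qed
  have appr_ind: "indicator A \<in> l2_approx M D" if A: "A \<in> sets M" for A
    using E(2,3) A[unfolded sets]
  proof (induction rule: sigma_sets_induct_disjoint)
    case (basic A)
    then show ?case by (rule ind_E)
  next
    case empty
    then show ?case using appr_0 by (simp add: indicator_def[abs_def])
  next
    case (compl A)
    have "(\<lambda>x. indicator (space M) x + (-1) * indicator A x) \<in> l2_approx M D"
      by (intro appr_add appr_cmult ind_E top compl)
    moreover have "(\<lambda>x. indicator (space M) x + (-1) * indicator A x) = (indicator (space M - A) :: 'a \<Rightarrow> real)"
      using sigma_sets_into_sp[OF E(3) compl(1)] by (auto simp: fun_eq_iff indicator_def)
    ultimately show ?case by simp
  next
    case (union A)
    have Asets: "A i \<in> sets M" for i using union by (auto simp: sets)
    show ?case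
    proof (rule l2_approx_limit[OF _ _ D])
      show "indicator (\<Union>i. A i) \<in> l2 M" using Asets by (intro ind) auto
      show "(\<lambda>x. \<Sum>i<n. indicator (A i) x) \<in> l2_approx M D" for n
        by (rule appr_sum) (rule union)
      show "(\<lambda>n. l2_dist M (indicator (\<Union>i. A i)) (\<lambda>x. \<Sum>i<n. indicator (A i) x)) \<longlonglongrightarrow> 0"
      proof (rule l2_dist_dominated_convergence[where w = "\<lambda>x. 1"])
        have sums: "(\<lambda>i. indicator (A i) x :: real) sums indicator (\<Union>i. A i) x" for x
        proof (cases "\<exists>i. x \<in> A i")
          case True
          then obtain i where i: "x \<in> A i" by blast
          have "indicator (A k) x = (if k = i then 1 else 0 :: real)" for k
          proof (cases "k = i")
            case False
            then have "A k \<inter> A i = {}" using union(1) by (simp add: disjoint_family_on_def)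
            then show ?thesis using False i by (auto simp: indicator_def)
          qed (use i in simp)
          moreover have "indicator (\<Union>i. A i) x = (1::real)" using i by (auto simp: indicator_def)
          ultimately show ?thesis using sums_single[of i "\<lambda>_. 1 :: real"] by simp
        qed auto
        show "(\<lambda>n. \<Sum>i<n. indicator (A i) x) \<longlonglongrightarrow> (indicator (\<Union>i. A i) x :: real)" for x
          using sums[of x] unfolding sums_def .
        fix n and x
        have "(\<Sum>i<n. indicator (A i) x :: real) \<le> indicator (\<Union>i. A i) x"
          using sum_le_suminf[OF sums_summable[OF sums[of x]], of "{..<n}"]
          by (simp add: sums_unique[OF sums[of x], symmetric])
        moreover have "0 \<le> (\<Sum>i<n. indicator (A i) x :: real)" by (intro sum_nonneg) auto
        moreover have "indicator (\<Union>i. A i) x \<le> (1 :: real)" by (auto simp: indicator_def)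
        ultimately show "\<bar>indicator (\<Union>i. A i) x - (\<Sum>i<n. indicator (A i) x)\<bar> \<le> (1::real)"
          by linarith
      next
        show "indicator (\<Union>i. A i) \<in> l2 M" using Asets by (intro ind) auto
        show "(\<lambda>x. 1) \<in> l2 M" by (rule l2_bounded[OF fin, of _ 1]) auto
        show "(\<lambda>x. \<Sum>i<n. indicator (A i) x) \<in> l2 M" for n
          using Asets by (intro l2_sum ind) auto
      qed
    qed
  qed
  have "f \<in> l2_approx M D" if f: "f \<in> l2 M" for f
  proof -
    obtain F where F: "\<And>i. simple_function M (F i)"
      "\<And>x. x \<in> space M \<Longrightarrow> (\<lambda>i. F i x) \<longlonglongrightarrow> f x"
      "\<And>i x. x \<in> space M \<Longrightarrow> \<bar>F i x\<bar> \<le> 2 * \<bar>f x\<bar>"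
      using borel_measurable_implies_sequence_metric[OF l2_measurable[OF f], of 0]
      by auto metis
    have af: "(\<lambda>x. 3 * \<bar>f x\<bar>) \<in> l2 M"
      using f by (intro l2_cmult) (auto simp: l2_def)
    define G where "G i x = (\<Sum>y\<in>F i ` space M. y * indicator (F i -` {y} \<inter> space M) x)" for i x
    have FG: "F i x = G i x" if "x \<in> space M" for i x
      by (rule trans[OF simple_function_indicator_representation_banach[OF F(1) that]])
        (simp add: G_def mult.commute)
    have G: "G i \<in> l2_approx M D" for i
      unfolding G_def[abs_def]
      by (intro appr_sum appr_cmult appr_ind simple_functionD[OF F(1)])
    then have Gl: "G i \<in> l2 M" for i by (auto simp: l2_approx_def)
    show ?thesis
    proof (rule l2_approx_limit[OF f G D])
      show "(\<lambda>n. l2_dist M f (G n)) \<longlonglongrightarrow> 0"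
      proof (rule l2_dist_dominated_convergence[OF f Gl af])
        fix n x assume x: "x \<in> space M"
        show "\<bar>f x - G n x\<bar> \<le> 3 * \<bar>f x\<bar>" using F(3)[OF x, of n] by (simp add: FG[OF x, symmetric])
        show "(\<lambda>n. G n x) \<longlonglongrightarrow> f x" using F(2)[OF x] by (simp add: FG[OF x])
      qed
    qed
  qed
  then have "l2 M = l2_approx M D" by (auto simp: l2_approx_def)
  then show ?thesis using \<open>countable D\<close> D by blast
qed

lemma space_unit_cube: "space unit_cube = cbox 0 One"
  by (simp add: unit_cube_def space_restrict_space)

lemma prob_space_unit_cube: "prob_space (unit_cube :: 'a::euclidean_space measure)"
proof
  have "emeasure (unit_cube :: 'a measure) (cbox 0 One) = emeasure lborel (cbox 0 One :: 'a set)"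
    unfolding unit_cube_def by (rule emeasure_restrict_space) auto
  also have "\<dots> = 1" by (simp add: emeasure_lborel_cbox_eq)
  finally show "emeasure (unit_cube :: 'a measure) (space unit_cube) = 1"
    by (simp add: space_unit_cube)
qed

lemma finite_measure_unit_cube: "finite_measure (unit_cube :: 'a::euclidean_space measure)"
  using prob_space_unit_cube by (rule prob_space.finite_measure)

text \<open>The Borel sets of the cube have a countable generator that is closed under intersection:
  the finite intersections of a countable basis of the topology.\<close>

lemma l2_unit_cube_separable:
  "\<exists>D. countable D \<and> D \<subseteq> l2 unit_cube \<and> l2 unit_cube = l2_approx (unit_cube :: 'a::euclidean_space measure) D"
proof -
  obtain B :: "'a set set" where B: "countable B" "topological_basis B"
    using ex_countable_basis by blast
  define I where "I = Inter ` {F. F \<subseteq> B \<and> finite F}"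
  define E where "E = (\<inter>) (cbox 0 One :: 'a set) ` I"
  have "countable {F. F \<subseteq> B \<and> finite F}"
    using countable_Collect_finite_subset[OF B(1)] by (simp add: conj_commute)
  then have cI: "countable I" unfolding I_def by (rule countable_image)
  have II: "U \<inter> W \<in> I" if "U \<in> I" "W \<in> I" for U W
  proof -
    obtain F G where "U = \<Inter>F" "W = \<Inter>G" "F \<subseteq> B" "G \<subseteq> B" "finite F" "finite G"
      using \<open>U \<in> I\<close> \<open>W \<in> I\<close> unfolding I_def by blast
    then show ?thesis unfolding I_def by (intro image_eqI[of _ _ "F \<union> G"]) auto
  qed
  have "topological_basis I"
  proof -
    have "open U" if "U \<in> I" for U
      using that B(2) unfolding I_def by (auto intro!: open_Inter dest: topological_basis_open)
    moreover have "B \<subseteq> I"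
      unfolding I_def by (auto intro!: image_eqI[of _ _ "{_}"])
    ultimately show ?thesis
      using B(2) unfolding topological_basis_def by (meson order_trans)
  qed
  then have borel: "borel = sigma UNIV I"
    using cI by (intro borel_eq_countable_basis)
  have sets: "sets (unit_cube :: 'a measure) = sigma_sets (cbox 0 One) E"
  proof -
    have "sets (unit_cube :: 'a measure) = (\<inter>) (cbox 0 One) ` sigma_sets UNIV I"
      unfolding unit_cube_def sets_restrict_space sets_lborel by (subst borel) simp
    also have "\<dots> = sigma_sets (cbox 0 One) E"
      unfolding E_def
    proof (rule sigma_sets_Int)
      have "cbox 0 One \<in> sets (borel :: 'a measure)" by simp
      then show "cbox 0 One \<in> sigma_sets UNIV I" by (subst (asm) borel) simp
    qed simp
    finally show ?thesis .
  qed
  show ?thesis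
  proof (rule l2_separable[OF finite_measure_unit_cube, of E])
    show "countable E" unfolding E_def using cI by (rule countable_image)
    show "Int_stable E"
      unfolding Int_stable_def
    proof (intro ballI)
      fix X Y assume "X \<in> E" "Y \<in> E"
      then obtain U W where UW: "U \<in> I" "W \<in> I" "X = cbox 0 One \<inter> U" "Y = cbox 0 One \<inter> W"
        unfolding E_def by blast
      then show "X \<inter> Y \<in> E"
        unfolding E_def using II[OF UW(1,2)] by (intro image_eqI[of _ _ "U \<inter> W"]) auto
    qed
    show "E \<subseteq> Pow (space unit_cube)" by (auto simp: E_def space_unit_cube)
    show "sets (unit_cube :: 'a measure) = sigma_sets (space unit_cube) E"
      by (simp add: sets space_unit_cube)
    have "UNIV \<in> I" unfolding I_def by (intro image_eqI[of _ _ "{}"]) auto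
    then show "space unit_cube \<in> E" unfolding E_def space_unit_cube by (intro image_eqI[of _ _ UNIV]) auto
  qed
qed

lemma confidence_set_subset:
  "confidence_set n C \<Longrightarrow> \<omega> \<in> space (sample_space n) \<Longrightarrow> C \<omega> \<subseteq> l2 unit_cube"
  unfolding confidence_set_def
  using closedin_subset[of "l2_topology unit_cube" "C \<omega>"] by (auto simp: topspace_l2_topology)

lemma confidence_set_hits:
  "confidence_set n C \<Longrightarrow> openin (l2_topology unit_cube) U \<Longrightarrow>
     {\<omega> \<in> space (sample_space n). C \<omega> \<inter> U \<noteq> {}} \<in> sets (sample_space n)"
  by (simp add: confidence_set_def)

text \<open>A closed set contains \<open>f\<close> exactly if it meets all the balls of radius \<open>1 / (k + 1)\<close>
  around \<open>f\<close>.\<close>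

lemma confidence_set_coverage_measurable:
  fixes C :: "(nat \<Rightarrow> (real ^ 'd::finite) \<times> bool) \<Rightarrow> (real ^ 'd \<Rightarrow> real) set"
  assumes C: "confidence_set n C" and f: "f \<in> l2 unit_cube"
  shows "{\<omega> \<in> space (sample_space n). f \<in> C \<omega>} \<in> sets (sample_space n)"
proof -
  let ?U = "\<lambda>k. {g \<in> l2 unit_cube. l2_dist unit_cube f g < 1 / real (Suc k)}"
  have "f \<in> C \<omega> \<longleftrightarrow> (\<forall>k. C \<omega> \<inter> ?U k \<noteq> {})" if \<omega>: "\<omega> \<in> space (sample_space n)" for \<omega>
  proof
    assume "f \<in> C \<omega>"
    then have "f \<in> C \<omega> \<inter> ?U k" for k using f by (simp add: l2_dist_self)
    then show "\<forall>k. C \<omega> \<inter> ?U k \<noteq> {}" by blast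
  next
    assume hit: "\<forall>k. C \<omega> \<inter> ?U k \<noteq> {}"
    show "f \<in> C \<omega>"
    proof (rule ccontr)
      assume "f \<notin> C \<omega>"
      have "openin (l2_topology unit_cube) (l2 unit_cube - C \<omega>)"
        using C \<omega> by (auto simp: confidence_set_def closedin_def topspace_l2_topology)
      then obtain e where e: "e > 0" "\<And>g. g \<in> l2 unit_cube \<Longrightarrow> l2_dist unit_cube f g < e \<Longrightarrow> g \<notin> C \<omega>"
        using f \<open>f \<notin> C \<omega>\<close> unfolding openin_l2_topology by blast
      obtain k where "1 / real (Suc k) < e"
        using nat_approx_posE[OF e(1)] by blast
      moreover obtain g where "g \<in> C \<omega>" "g \<in> ?U k" using hit by blast
      ultimately show False using e(2)[of g] by auto
    qed
  qed
  then have "{\<omega> \<in> space (sample_space n). f \<in> C \<omega>} =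
      (\<Inter>k. {\<omega> \<in> space (sample_space n). C \<omega> \<inter> ?U k \<noteq> {}})"
    by blast
  also have "\<dots> \<in> sets (sample_space n)"
    using confidence_set_hits[OF C openin_l2_ball[OF f]]
    by (intro sets.countable_INT') auto
  finally show ?thesis .
qed

lemma less_l2_diam_iff:
  "ereal c < l2_diam M C \<longleftrightarrow>
     (C = {} \<and> c < 0) \<or> (\<exists>u\<in>C. \<exists>v\<in>C. c < l2_dist M u v)"
  by (auto simp: l2_diam_def less_SUP_iff)

text \<open>
  The diameter involves pairs of points, so a single hitting event does not express it.  But the
  diameter of a nonempty set exceeds \<open>c\<close> exactly if the set meets two balls with centres in a
  countable dense set and a common rational radius, any two points of which are more than \<open>c\<close>
  apart.
\<close>

lemma confidence_set_diam_measurable: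
  fixes C :: "(nat \<Rightarrow> (real ^ 'd::finite) \<times> bool) \<Rightarrow> (real ^ 'd \<Rightarrow> real) set"
  assumes C: "confidence_set n C"
  shows "{\<omega> \<in> space (sample_space n). ereal c < l2_diam unit_cube (C \<omega>)} \<in> sets (sample_space n)"
proof -
  obtain D where D: "countable D" "D \<subseteq> l2 unit_cube"
      "l2 unit_cube = l2_approx (unit_cube :: (real ^ 'd) measure) D"
    using l2_unit_cube_separable by blast
  let ?d = "l2_dist (unit_cube :: (real ^ 'd) measure)"
  let ?ball = "\<lambda>p e. {g \<in> l2 unit_cube. ?d p g < e}"
  let ?hit = "\<lambda>U. {\<omega> \<in> space (sample_space n). C \<omega> \<inter> U \<noteq> {}}"
  \<comment> \<open>by the triangle inequality, points of the open balls around \<open>p\<close> and \<open>q\<close> are then more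
     than \<open>c\<close> apart\<close>
  define T where "T = {(p, q, e). p \<in> D \<and> q \<in> D \<and> e \<in> \<rat> \<and> c \<le> ?d p q - 2 * e}"
  have "T \<subseteq> D \<times> D \<times> \<rat>" by (auto simp: T_def)
  then have cT: "countable T"
    by (rule countable_subset) (intro countable_SIGMA D countable_rat)
  have sub: "C \<omega> \<subseteq> l2 unit_cube" if "\<omega> \<in> space (sample_space n)" for \<omega>
    using confidence_set_subset[OF C that] .
  have far: "(\<exists>u\<in>C \<omega>. \<exists>v\<in>C \<omega>. c < ?d u v) \<longleftrightarrow>
      (\<exists>(p, q, e) \<in> T. C \<omega> \<inter> ?ball p e \<noteq> {} \<and> C \<omega> \<inter> ?ball q e \<noteq> {})"
    if \<omega>: "\<omega> \<in> space (sample_space n)" for \<omega>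
  proof
    assume "\<exists>u\<in>C \<omega>. \<exists>v\<in>C \<omega>. c < ?d u v"
    then obtain u v where uv: "u \<in> C \<omega>" "v \<in> C \<omega>" "c < ?d u v" by blast
    have l: "u \<in> l2 unit_cube" "v \<in> l2 unit_cube" using sub[OF \<omega>] uv by auto
    obtain e where e: "e \<in> \<rat>" "0 < e" "e < (?d u v - c) / 4"
      using Rats_dense_in_real[of 0 "(?d u v - c) / 4"] uv by auto
    have "u \<in> l2_approx unit_cube D" "v \<in> l2_approx unit_cube D"
      using l D(3) by blast+
    then obtain p q where p: "p \<in> D" "?d u p < e" and q: "q \<in> D" "?d v q < e"
      using e(2) unfolding l2_approx_def by blast
    have "?d u v \<le> ?d u p + (?d p q + ?d q v)"
      using l2_dist_triangle[of u unit_cube p v] l2_dist_triangle[of p unit_cube q v] l p q D(2)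
      by (smt (verit) subsetD)
    then have "c \<le> ?d p q - 2 * e"
      using p q e by (simp add: l2_dist_commute[of _ q v])
    then have "(p, q, e) \<in> T" using p q e by (auto simp: T_def)
    moreover have "u \<in> ?ball p e" "v \<in> ?ball q e"
      using l p q by (auto simp: l2_dist_commute)
    ultimately show "\<exists>(p, q, e) \<in> T. C \<omega> \<inter> ?ball p e \<noteq> {} \<and> C \<omega> \<inter> ?ball q e \<noteq> {}"
      using uv by blast
  next
    assume "\<exists>(p, q, e) \<in> T. C \<omega> \<inter> ?ball p e \<noteq> {} \<and> C \<omega> \<inter> ?ball q e \<noteq> {}"
    then obtain p q e u v where *: "(p, q, e) \<in> T" "u \<in> C \<omega>" "u \<in> ?ball p e" "v \<in> C \<omega>" "v \<in> ?ball q e"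
      by blast
    then have pq: "p \<in> l2 unit_cube" "q \<in> l2 unit_cube" "c \<le> ?d p q - 2 * e"
      using D(2) by (auto simp: T_def)
    have "?d p q \<le> ?d p u + (?d u v + ?d v q)"
      using l2_dist_triangle[of p unit_cube u q] l2_dist_triangle[of u unit_cube v q] * pq by auto
    then have "c < ?d u v" using * pq(3) by (simp add: l2_dist_commute[of _ v q])
    then show "\<exists>u\<in>C \<omega>. \<exists>v\<in>C \<omega>. c < ?d u v" using * by blast
  qed
  have empty: "C \<omega> = {} \<longleftrightarrow> \<not> C \<omega> \<inter> l2 unit_cube \<noteq> {}" if "\<omega> \<in> space (sample_space n)" for \<omega>
    using sub[OF that] by blast
  let ?meets = "\<lambda>z \<omega>. case z of (p, q, e) \<Rightarrow> C \<omega> \<inter> ?ball p e \<noteq> {} \<and> C \<omega> \<inter> ?ball q e \<noteq> {}"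
  have "ereal c < l2_diam unit_cube (C \<omega>) \<longleftrightarrow>
      (\<not> C \<omega> \<inter> l2 unit_cube \<noteq> {} \<and> c < 0) \<or> (\<exists>z\<in>T. ?meets z \<omega>)"
    if \<omega>: "\<omega> \<in> space (sample_space n)" for \<omega>
    unfolding less_l2_diam_iff far[OF \<omega>] empty[OF \<omega>] by (rule refl)
  then have "{\<omega> \<in> space (sample_space n). ereal c < l2_diam unit_cube (C \<omega>)} =
      {\<omega> \<in> space (sample_space n). (\<not> C \<omega> \<inter> l2 unit_cube \<noteq> {} \<and> c < 0) \<or> (\<exists>z\<in>T. ?meets z \<omega>)}"
    by (intro Collect_cong conj_cong refl)
  also have "\<dots> \<in> sets (sample_space n)"
  proof (rule sets.sets_Collect_disj[OF sets.sets_Collect_countable_Ex'[OF _ cT]])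
    have "openin (l2_topology unit_cube) (l2 (unit_cube :: (real ^ 'd) measure))"
      using openin_topspace[of "l2_topology unit_cube"] by (simp add: topspace_l2_topology)
    from confidence_set_hits[OF C this]
    show "{\<omega> \<in> space (sample_space n). \<not> C \<omega> \<inter> l2 unit_cube \<noteq> {} \<and> c < 0} \<in> sets (sample_space n)"
      by (rule sets.sets_Collect_conj[OF sets.sets_Collect_const sets.sets_Collect_neg])
    fix z assume "z \<in> T"
    then obtain p q e where z: "z = (p, q, e)" "p \<in> l2 unit_cube" "q \<in> l2 unit_cube"
      using D(2) by (auto simp: T_def)
    show "{\<omega> \<in> space (sample_space n). ?meets z \<omega>} \<in> sets (sample_space n)"
      unfolding z(1) prod.case
      using confidence_set_hits[OF C openin_l2_ball[OF z(3)]]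
        confidence_set_hits[OF C openin_l2_ball[OF z(2)]]
      by (rule sets.sets_Collect_conj)
  qed
  finally show ?thesis .
qed

section \<open>Orthogonal projections\<close>

lemma l2_span_diff:
  assumes "v \<in> l2_span M I F" "w \<in> l2_span M I F"
  shows "(\<lambda>x. v x - w x) \<in> l2_span M I F"
proof -
  obtain c d where cd: "AE x in M. v x = (\<Sum>i\<in>I. c i * F i x)" "AE x in M. w x = (\<Sum>i\<in>I. d i * F i x)"
    using assms by (auto simp: l2_span_def)
  have "AE x in M. v x - w x = (\<Sum>i\<in>I. (c i - d i) * F i x)"
    using cd by eventually_elim (simp add: left_diff_distrib sum_subtractf)
  then show ?thesis using assms by (auto simp: l2_span_def intro: l2_diff exI[of _ "\<lambda>i. c i - d i"])
qed

lemma l2_span_sum: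
  assumes "finite K" "\<And>k. k \<in> K \<Longrightarrow> v k \<in> l2_span M I F"
  shows "(\<lambda>x. \<Sum>k\<in>K. a k * v k x) \<in> l2_span M I F"
proof -
  have "\<forall>k\<in>K. \<exists>c. AE x in M. v k x = (\<Sum>i\<in>I. c i * F i x)"
    using assms by (auto simp: l2_span_def)
  then obtain c where c: "\<And>k. k \<in> K \<Longrightarrow> AE x in M. v k x = (\<Sum>i\<in>I. c k i * F i x)"
    by metis
  have "AE x in M. \<forall>k\<in>K. v k x = (\<Sum>i\<in>I. c k i * F i x)"
    using c assms(1) by (intro AE_finite_allI) auto
  then have "AE x in M. (\<Sum>k\<in>K. a k * v k x) = (\<Sum>i\<in>I. (\<Sum>k\<in>K. a k * c k i) * F i x)"
  proof eventually_elim
    case (elim x)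
    then have "(\<Sum>k\<in>K. a k * v k x) = (\<Sum>k\<in>K. \<Sum>i\<in>I. a k * c k i * F i x)"
      by (simp add: sum_distrib_left mult.assoc)
    also have "\<dots> = (\<Sum>i\<in>I. (\<Sum>k\<in>K. a k * c k i) * F i x)"
      by (subst sum.swap) (simp add: sum_distrib_right)
    finally show ?case .
  qed
  moreover have "(\<lambda>x. \<Sum>k\<in>K. a k * v k x) \<in> l2 M"
    using assms by (intro l2_sum l2_cmult) (auto simp: l2_span_def)
  ultimately show ?thesis by (auto simp: l2_span_def intro: exI[of _ "\<lambda>i. \<Sum>k\<in>K. a k * c k i"])
qed

lemma l2_span_mono:
  assumes "finite I" "\<And>i. i \<in> I \<Longrightarrow> F i \<in> l2_span M J G"
  shows "l2_span M I F \<subseteq> l2_span M J G"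
proof
  fix v assume v: "v \<in> l2_span M I F"
  then obtain c where c: "AE x in M. v x = (\<Sum>i\<in>I. c i * F i x)" by (auto simp: l2_span_def)
  obtain d where d: "AE x in M. (\<Sum>i\<in>I. c i * F i x) = (\<Sum>j\<in>J. d j * G j x)"
    using l2_span_sum[of I F M J G c] assms by (auto simp: l2_span_def)
  have "AE x in M. v x = (\<Sum>j\<in>J. d j * G j x)" using c d by eventually_elim simp
  then show "v \<in> l2_span M J G" using v by (auto simp: l2_span_def)
qed

lemma l2_span_member:
  assumes "finite I" "i \<in> I" "F i \<in> l2 M" shows "F i \<in> l2_span M I F"
proof -
  have "F i x = (\<Sum>k\<in>I. (if k = i then 1 else 0) * F k x)" for x
    using assms by (simp add: if_distrib[of "\<lambda>a. a * _"] sum.delta cong: if_cong)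
  then show ?thesis
    using assms(3) unfolding l2_span_def
    by (intro CollectI conjI exI[of _ "\<lambda>k. if k = i then 1 else 0"] AE_I2)
qed

lemma l2_inner_span_zero:
  assumes "g \<in> l2 M" "\<And>i. i \<in> I \<Longrightarrow> F i \<in> l2 M" "\<And>i. i \<in> I \<Longrightarrow> l2_inner M (F i) g = 0"
    and v: "v \<in> l2_span M I F"
  shows "l2_inner M v g = 0"
proof -
  obtain c where c: "AE x in M. v x = (\<Sum>i\<in>I. c i * F i x)" and vl: "v \<in> l2 M"
    using v by (auto simp: l2_span_def)
  have "l2_inner M v g = l2_inner M (\<lambda>x. \<Sum>i\<in>I. c i * F i x) g"
    using assms by (intro l2_inner_cong_AE[OF c vl]) (auto intro!: l2_sum l2_cmult)
  also have "\<dots> = (\<Sum>i\<in>I. c i * l2_inner M (F i) g)"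
    using assms by (subst l2_inner_sum_left) (auto simp: l2_cmult l2_inner_cmult_left)
  finally show ?thesis using assms by simp
qed

text \<open>The property by which \<open>l2_proj\<close> chooses its value; it determines the projection up to null
  sets.\<close>

definition is_l2_proj :: "'a measure \<Rightarrow> ('a \<Rightarrow> real) set \<Rightarrow> ('a \<Rightarrow> real) \<Rightarrow> ('a \<Rightarrow> real) \<Rightarrow> bool" where
  "is_l2_proj M V h p \<longleftrightarrow> p \<in> V \<and> (\<forall>v\<in>V. l2_inner M (\<lambda>x. h x - p x) v = 0)"

lemma is_l2_proj_orthonormal:
  assumes I: "finite I" and F: "l2_orthonormal M I F" and h: "h \<in> l2 M"
  shows "is_l2_proj M (l2_span M I F) h (\<lambda>x. \<Sum>i\<in>I. l2_inner M h (F i) * F i x)" (is "is_l2_proj M _ h ?p")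
  unfolding is_l2_proj_def
proof (intro conjI ballI)
  have Fl: "F i \<in> l2 M" if "i \<in> I" for i using F that by (simp add: l2_orthonormal_def)
  have pl: "?p \<in> l2 M" using Fl by (intro l2_sum l2_cmult)
  show "?p \<in> l2_span M I F"
    using Fl I by (intro l2_span_sum) (auto intro: l2_span_member)
  fix v assume v: "v \<in> l2_span M I F"
  have "l2_inner M (F i) (\<lambda>x. h x - ?p x) = 0" if i: "i \<in> I" for i
  proof -
    have "l2_inner M ?p (F i) = (\<Sum>k\<in>I. l2_inner M h (F k) * l2_inner M (F k) (F i))"
      using Fl i by (subst l2_inner_sum_left) (auto simp: l2_cmult l2_inner_cmult_left)
    also have "\<dots> = (\<Sum>k\<in>I. if k = i then l2_inner M h (F k) else 0)"
      using F i by (intro sum.cong) (auto simp: l2_orthonormal_def)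
    also have "\<dots> = l2_inner M h (F i)" using I i by simp
    finally show ?thesis
      using l2_inner_diff_left[OF h pl Fl[OF i]] by (simp add: l2_inner_commute)
  qed
  then show "l2_inner M (\<lambda>x. h x - ?p x) v = 0"
    using l2_inner_span_zero[of "\<lambda>x. h x - ?p x" M I F v] Fl v l2_diff[OF h pl]
    by (simp add: l2_inner_commute)
qed

lemma is_l2_proj_unique:
  assumes "is_l2_proj M (l2_span M I F) h p" "is_l2_proj M (l2_span M I F) h q" "h \<in> l2 M"
  shows "AE x in M. p x = q x"
proof -
  let ?V = "l2_span M I F"
  have l: "p \<in> l2 M" "q \<in> l2 M" and V: "p \<in> ?V" "q \<in> ?V"
    using assms by (auto simp: is_l2_proj_def l2_span_def)
  let ?d = "\<lambda>x. p x - q x"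
  have d: "?d \<in> ?V" by (rule l2_span_diff[OF V])
  have dl: "?d \<in> l2 M" using l by (rule l2_diff)
  have "l2_inner M ?d ?d = l2_inner M (\<lambda>x. h x - q x) ?d - l2_inner M (\<lambda>x. h x - p x) ?d"
    using l2_inner_diff_left[of "\<lambda>x. h x - q x" M "\<lambda>x. h x - p x" ?d] dl l assms(3)
    by (simp add: l2_diff)
  also have "\<dots> = 0" using assms d by (simp add: is_l2_proj_def)
  finally show ?thesis using l2_norm_eq_zero_AE[OF dl] by simp
qed

lemma l2_proj_eqI:
  assumes "is_l2_proj M (l2_span M I F) h p" "h \<in> l2 M"
  shows "is_l2_proj M (l2_span M I F) h (l2_proj M (l2_span M I F) h)"
    and "AE x in M. l2_proj M (l2_span M I F) h x = p x"
proof -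
  show *: "is_l2_proj M (l2_span M I F) h (l2_proj M (l2_span M I F) h)"
  proof -
    have "l2_proj M (l2_span M I F) h = (SOME p. is_l2_proj M (l2_span M I F) h p)"
      by (simp add: l2_proj_def is_l2_proj_def)
    then show ?thesis using someI[of "is_l2_proj M (l2_span M I F) h", OF assms(1)] by simp
  qed
  show "AE x in M. l2_proj M (l2_span M I F) h x = p x"
    by (rule is_l2_proj_unique[OF * assms])
qed

section \<open>Tensor products on the cube\<close>

lemma cbox_cart_iff: "x \<in> cbox 0 (One :: real ^ 'd::finite) \<longleftrightarrow> (\<forall>i. x $ i \<in> {0..1})"
proof -
  have "(\<Sum>b\<in>(Basis :: (real ^ 'd) set). b $ i) = 1" for i
  proof -
    have "axis i 1 \<in> (Basis :: (real ^ 'd) set)" by (auto simp: Basis_vec_def)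
    from inner_sum_left_Basis[OF this, of "\<lambda>_. 1"] show ?thesis by (simp add: inner_axis)
  qed
  then show ?thesis by (auto simp: mem_box_cart)
qed

lemma unit_cube_real: "(unit_cube :: real measure) = restrict_space lborel {0..1}"
  by (simp add: unit_cube_def)

text \<open>Fubini's theorem for a product of functions of one coordinate each.  Lebesgue measure is the
  image of a product measure indexed by the standard basis vectors, so the coordinates have to be
  renamed from \<open>i\<close> to \<open>axis i 1\<close>.\<close>

lemma lborel_cart_integral_prod:
  fixes f :: "'d::finite \<Rightarrow> real \<Rightarrow> real"
  assumes f: "\<And>i. integrable lborel (f i)"
  shows "integrable lborel (\<lambda>x :: real ^ 'd. \<Prod>i\<in>UNIV. f i (x $ i))"
    and "(\<integral>x. (\<Prod>i\<in>UNIV. f i (x $ i)) \<partial>(lborel :: (real ^ 'd) measure)) = (\<Prod>i\<in>UNIV. integral\<^sup>L lborel (f i))"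
proof -
  interpret P: product_sigma_finite "\<lambda>b :: real ^ 'd. lborel :: real measure"
    by standard
  let ?P = "\<Pi>\<^sub>M b\<in>(Basis :: (real ^ 'd) set). (lborel :: real measure)"
  let ?T = "\<lambda>g. \<Sum>b\<in>(Basis :: (real ^ 'd) set). g b *\<^sub>R b"
  let ?F = "\<lambda>x :: real ^ 'd. \<Prod>i\<in>UNIV. f i (x $ i)"
  define g where "g b = f (axis_index b)" for b :: "real ^ 'd"
  have bij: "bij_betw (\<lambda>i. axis i 1) UNIV (Basis :: (real ^ 'd) set)"
    by (rule bij_betwI[where g = axis_index]) (auto simp: Basis_vec_def)
  have m: "?T \<in> measurable ?P borel" by measurable
  have fm: "f i \<in> borel_measurable borel" for i using f[of i] by auto
  have Fm: "?F \<in> borel_measurable borel"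
    by (intro borel_measurable_prod measurable_compose[OF _ fm]) auto
  have FT: "?F (?T h) = (\<Prod>b\<in>Basis. g b (h b))" for h
  proof -
    have "?T h $ i = h (axis i 1)" for i
      using inner_sum_left_Basis[of "axis i 1" h] by (simp add: inner_axis)
    then have "?F (?T h) = (\<Prod>i\<in>UNIV. g (axis i 1) (h (axis i 1)))"
      by (simp add: g_def)
    also have "\<dots> = (\<Prod>b\<in>Basis. g b (h b))"
      by (rule prod.reindex_bij_betw[OF bij])
    finally show ?thesis .
  qed
  have g: "integrable lborel (g b)" for b unfolding g_def by (rule f)
  have "integrable ?P (\<lambda>h. \<Prod>b\<in>Basis. g b (h b))"
    by (rule P.product_integrable_prod) (auto simp: g)
  then show "integrable lborel ?F"
    by (subst lborel_eq[where 'a = "real ^ 'd"], subst integrable_distr_eq[OF m Fm]) (simp only: FT)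
  have "integral\<^sup>L lborel ?F = integral\<^sup>L ?P (\<lambda>h. \<Prod>b\<in>Basis. g b (h b))"
    by (subst lborel_eq[where 'a = "real ^ 'd"], subst integral_distr[OF m Fm]) (simp only: FT)
  also have "\<dots> = (\<Prod>b\<in>Basis. integral\<^sup>L lborel (g b))"
    by (rule P.product_integral_prod) (auto simp: g)
  also have "\<dots> = (\<Prod>i\<in>UNIV. integral\<^sup>L lborel (g (axis i 1)))"
    by (rule prod.reindex_bij_betw[OF bij, symmetric])
  finally show "integral\<^sup>L lborel ?F = (\<Prod>i\<in>UNIV. integral\<^sup>L lborel (f i))"
    by (simp add: g_def)
qed

definition tensor :: "('d::finite \<Rightarrow> real \<Rightarrow> real) \<Rightarrow> real ^ 'd \<Rightarrow> real" where
  "tensor f x = (\<Prod>i\<in>UNIV. f i (x $ i))"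

lemma tensor_integral:
  fixes f :: "'d::finite \<Rightarrow> real \<Rightarrow> real"
  assumes f: "\<And>i. integrable unit_cube (f i)"
  shows "integrable unit_cube (tensor f)"
    and "(\<integral>x. tensor f x \<partial>unit_cube) = (\<Prod>i\<in>UNIV. integral\<^sup>L unit_cube (f i))"
proof -
  let ?g = "\<lambda>i y. indicator {0..1} y *\<^sub>R f i y"
  have g: "integrable lborel (?g i)" for i
    using f[of i] by (simp add: unit_cube_real integrable_restrict_space)
  have eq: "indicator (cbox 0 One) x *\<^sub>R tensor f x = (\<Prod>i\<in>UNIV. ?g i (x $ i))" for x :: "real ^ 'd"
  proof (cases "x \<in> cbox 0 One")
    case True
    then show ?thesis by (simp add: tensor_def cbox_cart_iff)
  next
    case False
    then obtain i where "x $ i \<notin> {0..1}" by (auto simp: cbox_cart_iff)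
    then have "(\<Prod>i\<in>UNIV. ?g i (x $ i)) = 0"
      by (intro prod_zero bexI[of _ i]) (auto simp: indicator_def)
    then show ?thesis using False by simp
  qed
  show "integrable unit_cube (tensor f)"
    unfolding unit_cube_def using lborel_cart_integral_prod(1)[where f = ?g, OF g]
    by (subst integrable_restrict_space) (simp, simp only: eq)
  have "(\<integral>x. tensor f x \<partial>unit_cube) = (\<Prod>i\<in>UNIV. integral\<^sup>L lborel (?g i))"
    unfolding unit_cube_def using lborel_cart_integral_prod(2)[where f = ?g, OF g]
    by (subst integral_restrict_space) (simp, simp only: eq)
  also have "\<dots> = (\<Prod>i\<in>UNIV. integral\<^sup>L unit_cube (f i))"
    by (simp add: unit_cube_real integral_restrict_space)
  finally show "(\<integral>x. tensor f x \<partial>unit_cube) = (\<Prod>i\<in>UNIV. integral\<^sup>L unit_cube (f i))" .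
qed

lemma measurable_unit_cube_component:
  "(\<lambda>x. x $ i) \<in> measurable (unit_cube :: (real ^ 'd::finite) measure) unit_cube"
  unfolding unit_cube_def
  by (intro measurable_restrict_space2 measurable_restrict_space1)
     (auto simp: space_restrict_space cbox_cart_iff)

lemma tensor_measurable:
  assumes "\<And>i. f i \<in> borel_measurable unit_cube"
  shows "tensor f \<in> borel_measurable (unit_cube :: (real ^ 'd::finite) measure)"
  unfolding tensor_def[abs_def]
  by (intro borel_measurable_prod measurable_compose[OF measurable_unit_cube_component assms])

lemma tensor_mult: "tensor f x * tensor g x = tensor (\<lambda>i y. f i y * g i y) x"
  by (simp add: tensor_def prod.distrib)

lemma tensor_l2:
  assumes "\<And>i. f i \<in> l2 unit_cube" shows "tensor f \<in> l2 unit_cube"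
proof -
  have "integrable unit_cube (\<lambda>x. tensor f x * tensor f x)"
    unfolding tensor_mult using assms l2_mult_integrable by (intro tensor_integral) blast
  then show ?thesis
    using assms tensor_measurable[of f] by (simp add: l2_def power2_eq_square)
qed

lemma tensor_inner:
  assumes "\<And>i. f i \<in> l2 unit_cube" "\<And>i. g i \<in> l2 unit_cube"
  shows "l2_inner unit_cube (tensor f) (tensor g) = (\<Prod>i\<in>UNIV. l2_inner unit_cube (f i) (g i))"
  unfolding l2_inner_def tensor_mult using assms l2_mult_integrable by (intro tensor_integral) blast

text \<open>The cylinder over a null set of the line is a null set.\<close>

lemma AE_unit_cube_component:
  assumes "AE y in unit_cube. P y"
  shows "AE x in (unit_cube :: (real ^ 'd::finite) measure). P (x $ i)"
proof -
  have "AE y in lborel. y \<in> {0..1} \<longrightarrow> P y"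
    using assms unfolding unit_cube_real by (subst (asm) AE_restrict_space_iff) auto
  then obtain N where N: "{y. \<not> (y \<in> {0..1} \<longrightarrow> P y)} \<subseteq> N" "emeasure lborel N = 0" "N \<in> sets borel"
    by (auto elim!: AE_E)
  have Nm: "N \<in> sets borel" by fact
  let ?S = "{x :: real ^ 'd. x $ i \<in> N}"
  have S: "?S \<in> sets borel"
    using measurable_sets[of "\<lambda>x :: real ^ 'd. x $ i" borel borel N] N(3) by (simp add: vimage_def)
  \<comment> \<open>the indicator of the cylinder as a product: one factor has integral 0, and in the extended
     nonnegative reals \<open>0 * \<infinity> = 0\<close> disposes of the others\<close>
  let ?f = "\<lambda>b :: real ^ 'd. if b = axis i 1 then indicator N else (\<lambda>_. 1 :: ennreal)"
  have ax: "axis i 1 \<in> (Basis :: (real ^ 'd) set)" by (auto simp: Basis_vec_def)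
  have "emeasure lborel ?S = (\<integral>\<^sup>+x. indicator ?S x \<partial>lborel)" using S by simp
  also have "\<dots> = (\<integral>\<^sup>+x. (\<Prod>b\<in>Basis. ?f b (x \<bullet> b)) \<partial>lborel)"
  proof (rule nn_integral_cong)
    fix x :: "real ^ 'd"
    have "(\<Prod>b\<in>Basis. ?f b (x \<bullet> b)) = (\<Prod>b\<in>Basis. if b = axis i 1 then indicator N (x \<bullet> b) else 1)"
      by (intro prod.cong) auto
    also have "\<dots> = indicator N (x $ i)" using ax by (simp add: inner_axis)
    finally show "indicator ?S x = (\<Prod>b\<in>Basis. ?f b (x \<bullet> b))" by (simp add: indicator_def)
  qed
  also have "\<dots> = (\<Prod>b\<in>Basis. (\<integral>\<^sup>+y. ?f b y \<partial>lborel))"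
    using Nm by (intro nn_integral_lborel_prod) auto
  also have "\<dots> = 0"
    using ax N by (intro prod_zero) (auto intro!: bexI[of _ "axis i 1"])
  finally have "?S \<in> null_sets lborel" using S by auto
  then have "AE x in (lborel :: (real ^ 'd) measure). x \<notin> ?S" by (rule AE_not_in)
  then have "AE x in (lborel :: (real ^ 'd) measure). x \<in> cbox 0 One \<longrightarrow> P (x $ i)"
    by eventually_elim (use N(1) in \<open>auto simp: cbox_cart_iff\<close>)
  then show ?thesis unfolding unit_cube_def by (subst AE_restrict_space_iff) auto
qed

text \<open>Expand the product, over the coordinates, of the one-dimensional sums.\<close>

lemma tensor_span:
  fixes F :: "'i \<Rightarrow> real \<Rightarrow> real" and v :: "'d::finite \<Rightarrow> real \<Rightarrow> real"
  assumes I: "finite I" and v: "\<And>i. v i \<in> l2_span unit_cube I F"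
  shows "tensor v \<in> l2_span unit_cube {l. \<forall>i. l i \<in> I} (\<lambda>l. tensor (\<lambda>i. F (l i)))"
proof -
  have "\<forall>i. \<exists>c. AE y in unit_cube. v i y = (\<Sum>k\<in>I. c k * F k y)"
    using v by (auto simp: l2_span_def)
  then obtain c where c: "\<And>i. AE y in unit_cube. v i y = (\<Sum>k\<in>I. c i k * F k y)" by metis
  have "AE x in (unit_cube :: (real ^ 'd) measure). \<forall>i\<in>UNIV. v i (x $ i) = (\<Sum>k\<in>I. c i k * F k (x $ i))"
    using AE_unit_cube_component[OF c] by (intro AE_finite_allI) auto
  then have "AE x in unit_cube. tensor v x =
      (\<Sum>l\<in>{l. \<forall>i. l i \<in> I}. (\<Prod>i\<in>UNIV. c i (l i)) * tensor (\<lambda>i. F (l i)) x)"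
  proof eventually_elim
    case (elim x)
    have "tensor v x = (\<Prod>i\<in>UNIV. \<Sum>k\<in>I. c i k * F k (x $ i))" using elim by (simp add: tensor_def)
    also have "\<dots> = (\<Sum>l\<in>PiE UNIV (\<lambda>_. I). \<Prod>i\<in>UNIV. c i (l i) * F (l i) (x $ i))"
      by (rule prod_sum_PiE) (use I in auto)
    also have "PiE UNIV (\<lambda>_. I) = {l :: 'd \<Rightarrow> 'i. \<forall>i. l i \<in> I}" by auto
    finally show ?case by (simp add: tensor_def prod.distrib)
  qed
  moreover have "tensor v \<in> l2 unit_cube" using v by (intro tensor_l2) (auto simp: l2_span_def)
  ultimately show ?thesis
    unfolding l2_span_def by (intro CollectI conjI exI[of _ "\<lambda>l. \<Prod>i\<in>UNIV. c i (l i)"])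
qed

section \<open>The multiresolution spaces on the cube\<close>

lemma phi_tensor_eq: "phi_tensor B j l = tensor (\<lambda>i. phiI B j (l i))"
  by (simp add: phi_tensor_def tensor_def fun_eq_iff)

lemma V_cube_eq:
  "V_cube B j = l2_span unit_cube {l. \<forall>i. l i \<in> idx_phi B j} (\<lambda>l. tensor (\<lambda>i. phiI B j (l i)))"
  by (simp add: V_cube_def phi_tensor_eq[abs_def])

lemma finite_functions_into:
  "finite I \<Longrightarrow> finite {l :: 'd::finite \<Rightarrow> 'i. \<forall>i. l i \<in> I}"
  using finite_PiE[of "UNIV :: 'd set" "\<lambda>_. I"] by (simp add: PiE_def Pi_def)

lemma tensor_orthonormal:
  fixes F :: "'i \<Rightarrow> real \<Rightarrow> real"
  assumes "l2_orthonormal unit_cube I F"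
  shows "l2_orthonormal unit_cube {l :: 'd::finite \<Rightarrow> 'i. \<forall>i. l i \<in> I} (\<lambda>l. tensor (\<lambda>i. F (l i)))"
  unfolding l2_orthonormal_def
proof (intro conjI ballI)
  have F: "F k \<in> l2 unit_cube" if "k \<in> I" for k using assms that by (simp add: l2_orthonormal_def)
  fix l :: "'d \<Rightarrow> 'i" assume l: "l \<in> {l. \<forall>i. l i \<in> I}"
  then show "tensor (\<lambda>i. F (l i)) \<in> l2 unit_cube" by (intro tensor_l2 F) auto
  fix l' :: "'d \<Rightarrow> 'i" assume l': "l' \<in> {l. \<forall>i. l i \<in> I}"
  have "l2_inner unit_cube (tensor (\<lambda>i. F (l i))) (tensor (\<lambda>i. F (l' i))) =
      (\<Prod>i\<in>UNIV. l2_inner unit_cube (F (l i)) (F (l' i)))"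
    using l l' by (intro tensor_inner F) auto
  also have "\<dots> = (\<Prod>i\<in>UNIV. if l i = l' i then 1 else 0)"
    using l l' assms by (intro prod.cong) (auto simp: l2_orthonormal_def)
  also have "\<dots> = (if l = l' then 1 else 0)"
  proof (cases "l = l'")
    case False
    then obtain i where "l i \<noteq> l' i" by auto
    then have "(\<Prod>i\<in>UNIV. if l i = l' i then 1 else 0 :: real) = 0"
      by (intro prod_zero bexI[of _ i]) auto
    then show ?thesis using False by simp
  qed simp
  finally show "l2_inner unit_cube (tensor (\<lambda>i. F (l i))) (tensor (\<lambda>i. F (l' i))) = (if l = l' then 1 else 0)" .
qed

context cdv_basis
begin

lemma finite_idx: "level0 B \<le> j \<Longrightarrow> finite (idx_phi B j)" "level0 B \<le> j \<Longrightarrow> finite (idx_psi B j)"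
  using card_idx by (auto intro: card_ge_0_finite)

lemma phiI_l2: "level0 B \<le> j \<Longrightarrow> k \<in> idx_phi B j \<Longrightarrow> phiI B j k \<in> l2 unit_cube"
  using orthonormal by (simp add: l2_orthonormal_def)

lemma psiI_l2: "level0 B \<le> j \<Longrightarrow> k \<in> idx_psi B j \<Longrightarrow> psiI B j k \<in> l2 unit_cube"
  using orthonormal by (simp add: l2_orthonormal_def)

lemma phiI_in_VI: "level0 B \<le> j \<Longrightarrow> k \<in> idx_phi B j \<Longrightarrow> phiI B j k \<in> VI B j"
  unfolding VI_def by (intro l2_span_member finite_idx phiI_l2)

lemma psiI_in_WI: "level0 B \<le> j \<Longrightarrow> k \<in> idx_psi B j \<Longrightarrow> psiI B j k \<in> WI B j"
  unfolding WI_def by (intro l2_span_member finite_idx psiI_l2)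

lemma VI_Suc: assumes "level0 B \<le> j" shows "VI B j \<subseteq> VI B (Suc j)" "WI B j \<subseteq> VI B (Suc j)"
proof -
  have eq: "VI B (Suc j) = {\<lambda>x. v x + w x | v w. v \<in> VI B j \<and> w \<in> WI B j}"
    using orthogonal_sum assms by blast
  have 0: "(\<lambda>x. 0) \<in> l2_span M I F" for M :: "real measure" and I :: "windex set" and F
    by (auto simp: l2_span_def l2_zero intro: exI[of _ "\<lambda>_. 0"])
  show "VI B j \<subseteq> VI B (Suc j)"
  proof
    fix v assume "v \<in> VI B j"
    then have "(\<lambda>x. v x + (\<lambda>x. 0) x) \<in> VI B (Suc j)"
      unfolding eq by (intro CollectI exI[of _ v] exI[of _ "\<lambda>x. 0"]) (simp add: WI_def 0)
    then show "v \<in> VI B (Suc j)" by simp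
  qed
  show "WI B j \<subseteq> VI B (Suc j)"
  proof
    fix w assume "w \<in> WI B j"
    then have "(\<lambda>x. (\<lambda>x. 0) x + w x) \<in> VI B (Suc j)"
      unfolding eq by (intro CollectI exI[of _ "\<lambda>x. 0"] exI[of _ w]) (simp add: VI_def 0)
    then show "w \<in> VI B (Suc j)" by simp
  qed
qed

lemma tensor_in_V_cube:
  "level0 B \<le> j \<Longrightarrow> (\<And>i. v i \<in> VI B j) \<Longrightarrow> tensor v \<in> V_cube B j"
  unfolding V_cube_eq by (rule tensor_span[OF finite_idx(1)]) (auto simp: VI_def)

lemma V_cube_Suc:
  assumes "level0 B \<le> j"
  shows "V_cube B j \<subseteq> (V_cube B (Suc j) :: (real ^ 'd::finite \<Rightarrow> real) set)"
proof -
  have "tensor (\<lambda>i. phiI B j (l i)) \<in> V_cube B (Suc j)" if "\<forall>i. l i \<in> idx_phi B j"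
    for l :: "'d \<Rightarrow> windex"
    using that assms VI_Suc(1)[OF assms] phiI_in_VI by (intro tensor_in_V_cube) auto
  then show ?thesis
    using finite_functions_into[OF finite_idx(1)[OF assms]]
    unfolding V_cube_eq by (intro l2_span_mono) auto
qed

lemma V_cube_mono:
  assumes "level0 B \<le> j" "j \<le> j'" shows "V_cube B j \<subseteq> V_cube B j'"
  using assms(2)
proof (induction j' rule: dec_induct)
  case (step k)
  then show ?case using V_cube_Suc[of k] assms(1) by auto
qed simp

text \<open>The polynomial 1 belongs to the one-dimensional spaces, and its tensor power is 1.\<close>

lemma const_in_V_cube:
  assumes "level0 B \<le> j" "0 < moments B" shows "(\<lambda>x :: real ^ 'd::finite. c) \<in> V_cube B j"
proof -
  have "poly [:1:] \<in> VI B j" using polynomials assms by auto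
  then have "tensor (\<lambda>i :: 'd. poly [:1:]) \<in> V_cube B j"
    by (intro tensor_in_V_cube assms)
  moreover have "tensor (\<lambda>i :: 'd. poly [:1:]) = (\<lambda>x. 1)"
    by (simp add: tensor_def fun_eq_iff)
  ultimately have "(\<lambda>x :: real ^ 'd. 1) \<in> V_cube B j" by simp
  then show ?thesis
    using l2_span_sum[of "{()}" "\<lambda>_ _. 1" _ _ _ "\<lambda>_. c"] unfolding V_cube_def by simp
qed

text \<open>Already one wavelet factor makes a tensor orthogonal to \<open>V_cube B j\<close>.\<close>

lemma psi_tensor_orthogonal:
  fixes l :: "'d::finite \<Rightarrow> windex"
  assumes j: "level0 B \<le> j" and l: "\<forall>i. l i \<in> idx_psi B j" and v: "v \<in> V_cube B j"
  shows "l2_inner unit_cube v (tensor (\<lambda>i. psiI B j (l i))) = 0"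
proof (rule l2_inner_span_zero[OF _ _ _ v[unfolded V_cube_eq]])
  show "tensor (\<lambda>i. psiI B j (l i)) \<in> l2 unit_cube"
    using l j by (intro tensor_l2 psiI_l2) auto
  fix k :: "'d \<Rightarrow> windex" assume k: "k \<in> {l. \<forall>i. l i \<in> idx_phi B j}"
  then show "tensor (\<lambda>i. phiI B j (k i)) \<in> l2 unit_cube"
    using j by (intro tensor_l2 phiI_l2) auto
  have "l2_inner unit_cube (phiI B j (k i)) (psiI B j (l i)) = 0" for i
    using orthogonal_sum j phiI_in_VI[OF j] psiI_in_WI[OF j] k l by blast
  then show "l2_inner unit_cube (tensor (\<lambda>i. phiI B j (k i))) (tensor (\<lambda>i. psiI B j (l i))) = 0"
    using k l j by (subst tensor_inner) (auto simp: phiI_l2 psiI_l2)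
qed

lemma psi_tensor_in_V_cube:
  assumes "level0 B \<le> j" "\<forall>i. l i \<in> idx_psi B j"
  shows "tensor (\<lambda>i. psiI B j (l i)) \<in> V_cube B (Suc j)"
  using assms VI_Suc(2)[OF assms(1)] psiI_in_WI by (intro tensor_in_V_cube) auto

lemma proj_V_is_proj:
  assumes "level0 B \<le> j" "h \<in> l2 unit_cube"
  shows "is_l2_proj unit_cube (V_cube B j) h (proj_V B j h)"
proof -
  have "l2_orthonormal unit_cube {l. \<forall>i. l i \<in> idx_phi B j} (\<lambda>l. tensor (\<lambda>i. phiI B j (l i)))"
    using orthonormal assms by (intro tensor_orthonormal) auto
  from is_l2_proj_orthonormal[OF finite_functions_into[OF finite_idx(1)[OF assms(1)]] this assms(2)]
  show ?thesis
    unfolding proj_V_def V_cube_eq by (rule l2_proj_eqI(1)[OF _ assms(2)])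
qed

lemma proj_V_l2: "level0 B \<le> j \<Longrightarrow> h \<in> l2 unit_cube \<Longrightarrow> proj_V B j h \<in> l2 unit_cube"
  using proj_V_is_proj[of j h] by (auto simp: is_l2_proj_def V_cube_def l2_span_def)

lemma proj_V_AE_eq:
  "is_l2_proj unit_cube (V_cube B j) h p \<Longrightarrow> h \<in> l2 unit_cube \<Longrightarrow> AE x in unit_cube. proj_V B j h x = p x"
  unfolding proj_V_def V_cube_def by (rule l2_proj_eqI(2))

section \<open>Besov norms of single-level perturbations\<close>

text \<open>
  The setting is a function \<open>f\<close> from the coarsest space, perturbed by a \<open>g\<close> that lives at the
  single level \<open>j\<close>: in \<open>V_cube B (Suc j)\<close> and orthogonal to \<open>V_cube B j\<close>.  The projections of
  \<open>f + g\<close> switch from \<open>f\<close> to \<open>f + g\<close> between the levels \<open>j\<close> and \<open>Suc j\<close>, so \<open>g\<close> is the only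
  nonzero detail.
\<close>

context
  fixes f g :: "real ^ 'd::finite \<Rightarrow> real" and j :: nat
  assumes j: "level0 B \<le> j"
    and f: "f \<in> V_cube B (level0 B)" and g: "g \<in> V_cube B (Suc j)"
    and orth: "\<And>v. v \<in> V_cube B j \<Longrightarrow> l2_inner unit_cube v g = 0"
begin

lemma level_perturbation_l2: "f \<in> l2 unit_cube" "g \<in> l2 unit_cube"
  using f g by (auto simp: V_cube_def l2_span_def)

lemma proj_V_level_perturbation:
  assumes "level0 B \<le> i"
  shows "AE x in unit_cube. proj_V B i (\<lambda>x. f x + g x) x = (if i \<le> j then f x else f x + g x)"
proof -
  let ?p = "\<lambda>x. if i \<le> j then f x else f x + g x"
  have fi: "f \<in> V_cube B i" using V_cube_mono[OF _ assms] f by auto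
  have "is_l2_proj unit_cube (V_cube B i) (\<lambda>x. f x + g x) ?p"
  proof (cases "i \<le> j")
    case True
    have "l2_inner unit_cube g v = 0" if "v \<in> V_cube B i" for v
      using orth[of v] V_cube_mono[OF assms True] that l2_inner_commute[of unit_cube g v] by auto
    then show ?thesis using True fi by (simp add: is_l2_proj_def)
  next
    case False
    then have "g \<in> V_cube B i" using V_cube_mono[of "Suc j" i] g j by auto
    then have "(\<lambda>x. f x - (-1) * g x) \<in> V_cube B i"
      using fi l2_span_sum[of "{()}" "\<lambda>_. g" _ _ _ "\<lambda>_. -1"]
      unfolding V_cube_def by (intro l2_span_diff) simp_all
    then show ?thesis using False by (simp add: is_l2_proj_def l2_inner_def)
  qed
  then show ?thesis by (rule proj_V_AE_eq) (intro l2_add level_perturbation_l2)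
qed

lemma norm_detail_level_perturbation:
  assumes "level0 B \<le> i"
  shows "l2_norm unit_cube (detail B i (\<lambda>x. f x + g x)) = (if i = j then l2_norm unit_cube g else 0)"
proof -
  let ?h = "\<lambda>x. f x + g x"
  have h: "?h \<in> l2 unit_cube" by (intro l2_add level_perturbation_l2)
  have d: "detail B i ?h \<in> l2 unit_cube"
    unfolding detail_def[abs_def] using assms h by (intro l2_diff proj_V_l2) auto
  have "AE x in unit_cube. detail B i ?h x = (if i = j then g x else 0)"
    using proj_V_level_perturbation[OF assms] proj_V_level_perturbation[of "Suc i", OF le_SucI[OF assms]]
    by eventually_elim (auto simp: detail_def)
  then have "l2_norm unit_cube (detail B i ?h) = l2_norm unit_cube (\<lambda>x. if i = j then g x else 0)"
    using d level_perturbation_l2 by (intro l2_norm_cong_AE) (cases "i = j"; simp add: l2_zero)+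
  then show ?thesis by (simp add: l2_norm_def)
qed

lemma besov_norm_level_perturbation:
  "besov_norm B u (\<lambda>x. f x + g x) \<le>
     ereal (2 powr (real (level0 B) * u) * l2_norm unit_cube f + 2 powr (real j * u) * l2_norm unit_cube g)"
proof -
  have "l2_norm unit_cube (proj_V B (level0 B) (\<lambda>x. f x + g x)) = l2_norm unit_cube f"
    using proj_V_level_perturbation[of "level0 B"] j level_perturbation_l2
    by (intro l2_norm_cong_AE proj_V_l2 l2_add) auto
  moreover have "(SUP i\<in>{level0 B..}. ereal (2 powr (real i * u) * l2_norm unit_cube (detail B i (\<lambda>x. f x + g x)))) \<le>
      ereal (2 powr (real j * u) * l2_norm unit_cube g)"
    by (rule SUP_least) (auto simp: norm_detail_level_perturbation l2_norm_nonneg)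
  ultimately show ?thesis
    unfolding besov_norm_def plus_ereal.simps(1)[symmetric] by (intro add_mono) auto
qed

text \<open>
  Testing against \<open>g\<close> itself: \<open>f\<close> is orthogonal to \<open>g\<close>, and \<open>g\<close> sees only the detail of
  \<open>h\<close> at level \<open>j\<close>, whose norm the ball controls.
\<close>

lemma dist_level_perturbation_besov_ball:
  assumes h: "h \<in> besov_ball B t M" and M: "0 < M"
  shows "l2_norm unit_cube g - M * 2 powr (- (real j * t)) \<le> l2_dist unit_cube (\<lambda>x. f x + g x) h"
proof (cases "l2_norm unit_cube g = 0")
  case True
  have "0 \<le> M * 2 powr (- (real j * t))" using M by simp
  then show ?thesis
    unfolding True using l2_dist_nonneg[of unit_cube "\<lambda>x. f x + g x" h] by linarith
next
  case False
  let ?N = "l2_norm unit_cube" and ?I = "l2_inner (unit_cube :: (real ^ 'd) measure)"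
  note l = level_perturbation_l2
  have hl: "h \<in> l2 unit_cube" and hM: "besov_norm B t h \<le> ereal M"
    using h by (auto simp: besov_ball_def)
  have pos: "?N g > 0" using False l2_norm_nonneg[of unit_cube g] by simp
  have d: "detail B j h \<in> l2 unit_cube"
    unfolding detail_def[abs_def] using j hl by (intro l2_diff proj_V_l2) auto
  have "ereal (2 powr (real j * t) * ?N (detail B j h)) \<le>
      (SUP i\<in>{level0 B..}. ereal (2 powr (real i * t) * ?N (detail B i h)))"
    using j by (intro SUP_upper) auto
  also have "\<dots> \<le> besov_norm B t h"
    unfolding besov_norm_def by (intro add_increasing) (auto simp: l2_norm_nonneg)
  also note hM
  finally have "2 powr (real j * t) * ?N (detail B j h) \<le> M" by simp
  then have dM: "?N (detail B j h) \<le> M * 2 powr (- (real j * t))"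
    by (simp add: powr_minus divide_simps mult.commute)
  have pj: "proj_V B j h \<in> V_cube B j" and pS: "?I (\<lambda>x. h x - proj_V B (Suc j) h x) g = 0"
    using proj_V_is_proj[of j h] proj_V_is_proj[of "Suc j" h] j hl g by (auto simp: is_l2_proj_def)
  have "?I h g = ?I (proj_V B (Suc j) h) g"
    using pS l2_inner_diff_left[OF hl proj_V_l2[OF _ hl] l(2), of "Suc j"] j by simp
  also have "\<dots> = ?I (detail B j h) g"
    using l2_inner_diff_left[OF proj_V_l2[OF _ hl] proj_V_l2[OF _ hl] l(2), of "Suc j" j] j orth[OF pj]
    by (simp add: detail_def[abs_def])
  finally have "?I h g \<le> ?N (detail B j h) * ?N g"
    using l2_Cauchy_Schwarz[OF d l(2)] by linarith
  also have "\<dots> \<le> M * 2 powr (- (real j * t)) * ?N g"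
    using dM pos by (intro mult_right_mono) auto
  finally have 1: "?I h g \<le> M * 2 powr (- (real j * t)) * ?N g" .
  have "?I f g = 0" using orth V_cube_mono[OF _ j] f by blast
  then have "?I (\<lambda>x. (f x + g x) - h x) g = (?N g)\<^sup>2 - ?I h g"
    using l hl by (subst l2_inner_diff_left) (auto simp: l2_inner_add_left l2_norm_square l2_add)
  moreover have "?I (\<lambda>x. (f x + g x) - h x) g \<le> l2_dist unit_cube (\<lambda>x. f x + g x) h * ?N g"
    unfolding l2_dist_def using l2_Cauchy_Schwarz[OF l2_diff[OF l2_add[OF l] hl] l(2)] by linarith
  ultimately have "(?N g - M * 2 powr (- (real j * t))) * ?N g \<le> l2_dist unit_cube (\<lambda>x. f x + g x) h * ?N g"
    using 1 by (simp add: algebra_simps power2_eq_square)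
  then show ?thesis using pos by (rule mult_right_le_imp_le)
qed

end

end

section \<open>Wavelets with disjoint supports\<close>

lemma sum_le_if_at_most_one_nonzero:
  fixes f :: "'a \<Rightarrow> real"
  assumes "0 \<le> c" "\<And>k. k \<in> K \<Longrightarrow> f k \<le> c"
    and one: "\<And>k l. k \<in> K \<Longrightarrow> l \<in> K \<Longrightarrow> f k \<noteq> 0 \<Longrightarrow> f l \<noteq> 0 \<Longrightarrow> k = l"
  shows "sum f K \<le> c"
proof (cases "\<exists>k\<in>K. f k \<noteq> 0")
  case True
  then obtain k where k: "k \<in> K" "f k \<noteq> 0" by blast
  then have "sum f K = sum f {k}" if "finite K"
    using that one by (intro sum.mono_neutral_right) auto
  then show ?thesis using assms k by (cases "finite K") auto
qed (use assms in simp)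

context cdv_basis
begin

lemma wavelet_bounded: "\<exists>\<Psi>>0. \<forall>x. \<bar>wavelet_fun B x\<bar> \<le> \<Psi>"
proof -
  have "holder_zygmund R (wavelet_fun B)"
    using daubechies by (simp add: daubechies_system_def)
  then obtain m :: nat and D :: "nat \<Rightarrow> real \<Rightarrow> real" where "D 0 = wavelet_fun B" "\<forall>i\<le>m. bounded (range (D i))"
    unfolding holder_zygmund_def by blast
  then have "bounded (range (wavelet_fun B))" by (metis le0)
  then show ?thesis unfolding bounded_pos by auto
qed

lemma wavelet_support: "\<exists>A::nat. \<forall>x. wavelet_fun B x \<noteq> 0 \<longrightarrow> \<bar>x\<bar> \<le> real A"
proof -
  have "compact (fsupp (wavelet_fun B))"
    using daubechies by (simp add: daubechies_system_def)
  then obtain b where b: "\<forall>x\<in>fsupp (wavelet_fun B). \<bar>x\<bar> \<le> b"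
    using compact_imp_bounded[of "fsupp (wavelet_fun B)"] by (auto simp: bounded_iff)
  have "\<bar>x\<bar> \<le> real (nat \<lceil>b\<rceil>)" if "wavelet_fun B x \<noteq> 0" for x
  proof -
    have "x \<in> fsupp (wavelet_fun B)" using that closure_subset[of "{x. wavelet_fun B x \<noteq> 0}"] by (auto simp: fsupp_def)
    then have "\<bar>x\<bar> \<le> b" using b by blast
    then show ?thesis using real_nat_ceiling_ge[of b] by linarith
  qed
  then show ?thesis by blast
qed

text \<open>
  Every \<open>(2 * A + 1)\<close>-st translate of a wavelet supported in \<open>[-A, A]\<close>: the supports are
  disjoint, yet a fixed fraction of all \<open>2 ^ j\<close> translates is kept.
\<close>

lemma disjoint_wavelets:
  "\<exists>\<kappa>>0. \<exists>\<Psi>>0. \<exists>j0\<ge>level0 B. \<forall>j\<ge>j0. \<exists>K\<subseteq>idx_psi B j.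
     \<kappa> * 2 ^ j \<le> real (card K) \<and> (\<forall>x. (\<Sum>k\<in>K. \<bar>psiI B j k x\<bar>) \<le> 2 powr (real j / 2) * \<Psi>)"
proof -
  obtain \<Psi> where \<Psi>: "\<Psi> > 0" "\<And>x. \<bar>wavelet_fun B x\<bar> \<le> \<Psi>" using wavelet_bounded by blast
  obtain A :: nat where A: "\<And>x. wavelet_fun B x \<noteq> 0 \<Longrightarrow> \<bar>x\<bar> \<le> real A" using wavelet_support by blast
  define m where "m = 2 * A + 1"
  have m: "m > 0" "2 * A < m" by (auto simp: m_def)
  define \<kappa> where "\<kappa> = 1 / (4 * real m)"
  define j0 where "j0 = max (level0 B) (2 * m)"
  show ?thesis
  proof (rule exI[of _ \<kappa>], rule conjI, simp add: \<kappa>_def m, rule exI[of _ \<Psi>], rule conjI, fact,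
      rule exI[of _ j0], rule conjI, simp add: j0_def, intro allI impI)
    fix j assume j: "j0 \<le> j"
    have "2 * m < 2 ^ (2 * m)" by (rule less_exp)
    also have "\<dots> \<le> 2 ^ j" using j by (intro power_increasing) (auto simp: j0_def)
    finally have big: "2 * m < 2 ^ j" .
    \<comment> \<open>only the translates in the left half of the interval are used, so that the supports stay
       away from the right end\<close>
    define N where "N = 2 ^ j div (2 * m)"
    have N1: "1 \<le> N" unfolding N_def using big m by (simp add: div_greater_zero_iff Suc_le_eq)
    have mN: "2 * (m * N) \<le> 2 ^ j" unfolding N_def
      using times_div_less_eq_dividend[of "2 * m" "2 ^ j"] by (simp add: mult.assoc)
    have "2 ^ j < 2 * m * N + 2 * m"
      unfolding N_def using m mult_div_mod_eq[of "2 * m" "2 ^ j"] mod_less_divisor[of "2 * m" "2 ^ j"]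
      by linarith
    also have "\<dots> \<le> 4 * m * N" using N1 by (simp add: algebra_simps)
    finally have "real (2 ^ j) \<le> real (4 * m * N)" by linarith
    then have cardN: "\<kappa> * 2 ^ j \<le> real N"
      unfolding \<kappa>_def using m by (simp add: field_simps)
    define K where "K = (\<lambda>i. Interior (int (m * Suc i))) ` {..<N}"
    have val: "psiI B j (Interior k) x = 2 powr (real j / 2) * wavelet_fun B (2 ^ j * x - of_int k)" for k x
      by (simp add: psiI_def)
    have inj: "inj_on (\<lambda>i. Interior (int (m * Suc i))) {..<N}"
      using m by (auto simp: inj_on_def)
    have card: "card K = N" unfolding K_def using inj by (simp add: card_image)
    have supp: "\<bar>2 ^ j * x - real (m * Suc i)\<bar> \<le> real A" if "psiI B j (Interior (int (m * Suc i))) x \<noteq> 0" for i x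
      using A[of "2 ^ j * x - real (m * Suc i)"] that unfolding val by auto
    have sub_K: "K \<subseteq> idx_psi B j"
    proof
      fix k assume "k \<in> K"
      then obtain i where i: "i < N" "k = Interior (int (m * Suc i))" by (auto simp: K_def)
      define c where "c = real (m * Suc i)"
      have "m * Suc i \<le> m * N" using i by (intro mult_le_mono2) auto
      then have "2 * (m * Suc i) \<le> 2 ^ j" using mN by linarith
      moreover have le: "m \<le> m * Suc i" by simp
      ultimately have "m * Suc i + A < 2 ^ j" using big m(2) by linarith
      then have "real (m * Suc i + A) < real (2 ^ j)" by (simp only: of_nat_less_iff)
      moreover have "A < m * Suc i" using le m(2) by linarith
      ultimately have c: "real A < c" "c + real A < 2 ^ j"
        unfolding c_def by (simp_all only: of_nat_less_iff of_nat_add of_nat_power of_nat_numeral)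
      have p: "(0 :: real) < 2 ^ j" by simp
      have "fsupp (psiI B j k) \<subseteq> {(c - real A) / 2 ^ j .. (c + real A) / 2 ^ j}"
        unfolding fsupp_def
      proof (rule closure_minimal)
        show "{x. psiI B j k x \<noteq> 0} \<subseteq> {(c - real A) / 2 ^ j .. (c + real A) / 2 ^ j}"
        proof
          fix x assume "x \<in> {x. psiI B j k x \<noteq> 0}"
          then have "\<bar>2 ^ j * x - c\<bar> \<le> real A" using supp[of i x] i by (simp add: c_def)
          then show "x \<in> {(c - real A) / 2 ^ j .. (c + real A) / 2 ^ j}"
            using p by (auto simp: field_simps)
        qed
      qed simp
      also have "\<dots> \<subseteq> {0<..<1}"
      proof -
        have "0 < (c - real A) / 2 ^ j" "(c + real A) / 2 ^ j < 1" using c p by auto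
        then show ?thesis
          by (intro subsetI) (simp only: atLeastAtMost_iff greaterThanLessThan_iff, linarith)
      qed
      finally show "k \<in> idx_psi B j" unfolding i idx_psi_def psiI_def interval_idx_def by blast
    qed
    have card_K: "\<kappa> * 2 ^ j \<le> real (card K)" using cardN card by simp
    have sum_K: "(\<Sum>k\<in>K. \<bar>psiI B j k x\<bar>) \<le> 2 powr (real j / 2) * \<Psi>" for x
    proof (rule sum_le_if_at_most_one_nonzero)
      show "0 \<le> 2 powr (real j / 2) * \<Psi>" using \<Psi> by simp
      show "\<bar>psiI B j k x\<bar> \<le> 2 powr (real j / 2) * \<Psi>" if "k \<in> K" for k
        using that \<Psi>(2) unfolding K_def by (auto simp: val abs_mult)
      fix k l assume "k \<in> K" "l \<in> K" and nz: "\<bar>psiI B j k x\<bar> \<noteq> 0" "\<bar>psiI B j l x\<bar> \<noteq> 0"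
      then obtain i i' where i: "k = Interior (int (m * Suc i))" "l = Interior (int (m * Suc i'))"
        by (auto simp: K_def)
      have "\<bar>real (m * Suc i) - real (m * Suc i')\<bar> \<le> 2 * real A"
        using supp[of i x] supp[of i' x] nz i by simp
      also have "\<dots> < real m" using m(2) by linarith
      also have "real (m * Suc i) - real (m * Suc i') = real m * (real i - real i')"
        by (simp add: algebra_simps)
      finally have "real m * \<bar>real i - real i'\<bar> < real m * 1" by (simp add: abs_mult)
      then have "\<bar>real i - real i'\<bar> < 1" using m by (simp add: mult_less_cancel_left_pos)
      then have "i = i'" by linarith
      then show "k = l" using i by simp
    qed
    show "\<exists>K\<subseteq>idx_psi B j. \<kappa> * 2 ^ j \<le> real (card K) \<and>
        (\<forall>x. (\<Sum>k\<in>K. \<bar>psiI B j k x\<bar>) \<le> 2 powr (real j / 2) * \<Psi>)"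
      by (intro exI[of _ K] conjI allI) (rule sub_K card_K sum_K)+
  qed
qed

text \<open>
  Tensors of the wavelets just selected.  With a wavelet factor in every direction they number a
  fixed fraction of \<open>2 ^ (j * d)\<close>, and the sum of their absolute values is the product of the
  one-dimensional sums, so it still has the size of a single tensor.
\<close>

lemma detail_family:
  "\<exists>\<kappa>>0. \<exists>\<Psi>>0. \<exists>j0\<ge>level0 B. \<forall>j\<ge>j0. \<exists>(\<Lambda> :: ('d::finite \<Rightarrow> windex) set) (W :: ('d \<Rightarrow> windex) \<Rightarrow> real ^ 'd \<Rightarrow> real).
     finite \<Lambda> \<and> \<kappa> * 2 ^ (j * CARD('d)) \<le> real (card \<Lambda>) \<and>
     l2_orthonormal unit_cube \<Lambda> W \<and>
     (\<forall>l\<in>\<Lambda>. W l \<in> V_cube B (Suc j) \<and> (\<forall>v\<in>V_cube B j. l2_inner unit_cube v (W l) = 0)) \<and>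
     (\<forall>x. (\<Sum>l\<in>\<Lambda>. \<bar>W l x\<bar>) \<le> \<Psi> * 2 powr (real (j * CARD('d)) / 2))"
proof -
  let ?d = "CARD('d)"
  obtain \<kappa> \<Psi> j0 where \<kappa>: "\<kappa> > 0" and \<Psi>: "\<Psi> > 0" and j0: "j0 \<ge> level0 B"
    and K: "\<And>j. j \<ge> j0 \<Longrightarrow> \<exists>K\<subseteq>idx_psi B j. \<kappa> * 2 ^ j \<le> real (card K) \<and>
        (\<forall>x. (\<Sum>k\<in>K. \<bar>psiI B j k x\<bar>) \<le> 2 powr (real j / 2) * \<Psi>)"
    using disjoint_wavelets by metis
  show ?thesis
  proof (rule exI[of _ "\<kappa> ^ ?d"], rule conjI, simp add: \<kappa>, rule exI[of _ "\<Psi> ^ ?d"], rule conjI, simp add: \<Psi>,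
      rule exI[of _ j0], rule conjI, fact, intro allI impI)
    fix j assume j: "j0 \<le> j"
    then have lj: "level0 B \<le> j" using j0 by simp
    obtain K where K: "K \<subseteq> idx_psi B j" "\<kappa> * 2 ^ j \<le> real (card K)"
      "\<And>x. (\<Sum>k\<in>K. \<bar>psiI B j k x\<bar>) \<le> 2 powr (real j / 2) * \<Psi>"
      using K[OF j] by blast
    have fK: "finite K" using K(1) finite_idx(2)[OF lj] finite_subset by blast
    define \<Lambda> where "\<Lambda> = {l :: 'd \<Rightarrow> windex. \<forall>i. l i \<in> K}"
    have PiE: "\<Lambda> = PiE UNIV (\<lambda>_. K)" by (auto simp: \<Lambda>_def)
    define W where "W l = tensor (\<lambda>i. psiI B j (l i))" for l :: "'d \<Rightarrow> windex"
    have 1: "finite \<Lambda>" unfolding \<Lambda>_def using fK by (rule finite_functions_into)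
    have 2: "\<kappa> ^ ?d * 2 ^ (j * ?d) \<le> real (card \<Lambda>)"
    proof -
      have "\<kappa> ^ ?d * 2 ^ (j * ?d) = (\<kappa> * 2 ^ j) ^ ?d"
        by (simp add: power_mult_distrib power_mult)
      also have "\<dots> \<le> real (card K) ^ ?d" using K(2) \<kappa> by (intro power_mono) auto
      also have "\<dots> = real (card \<Lambda>)" unfolding PiE by (subst card_PiE) simp_all
      finally show ?thesis .
    qed
    have 3: "l2_orthonormal unit_cube \<Lambda> W"
    proof -
      have "l2_orthonormal unit_cube K (psiI B j)"
        using orthonormal lj K(1) unfolding l2_orthonormal_def by blast
      then show ?thesis unfolding \<Lambda>_def W_def[abs_def] by (rule tensor_orthonormal)
    qed
    have 4: "\<forall>l\<in>\<Lambda>. W l \<in> V_cube B (Suc j) \<and> (\<forall>v\<in>V_cube B j. l2_inner unit_cube v (W l) = 0)"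
      using psi_tensor_in_V_cube[OF lj] psi_tensor_orthogonal[OF lj] K(1)
      unfolding \<Lambda>_def W_def by blast
    have 5: "(\<Sum>l\<in>\<Lambda>. \<bar>W l x\<bar>) \<le> \<Psi> ^ ?d * 2 powr (real (j * ?d) / 2)" for x
    proof -
      have "(\<Sum>l\<in>\<Lambda>. \<bar>W l x\<bar>) = (\<Sum>l\<in>PiE UNIV (\<lambda>_. K). \<Prod>i\<in>UNIV. \<bar>psiI B j (l i) (x $ i)\<bar>)"
        unfolding PiE W_def tensor_def by (simp add: abs_prod)
      also have "\<dots> = (\<Prod>i\<in>UNIV. \<Sum>k\<in>K. \<bar>psiI B j k (x $ i)\<bar>)"
        by (rule prod_sum_PiE[symmetric]) (use fK in auto)
      also have "\<dots> \<le> (\<Prod>i\<in>(UNIV :: 'd set). 2 powr (real j / 2) * \<Psi>)"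
        using K(3) by (intro prod_mono) (auto intro: sum_nonneg)
      also have "\<dots> = \<Psi> ^ ?d * 2 powr (real (j * ?d) / 2)"
        by (simp add: power_mult_distrib powr_realpow[symmetric] powr_powr mult.commute)
      finally show ?thesis .
    qed
    show "\<exists>(\<Lambda> :: ('d \<Rightarrow> windex) set) (W :: ('d \<Rightarrow> windex) \<Rightarrow> real ^ 'd \<Rightarrow> real). finite \<Lambda> \<and> \<kappa> ^ ?d * 2 ^ (j * ?d) \<le> real (card \<Lambda>) \<and>
        l2_orthonormal unit_cube \<Lambda> W \<and>
        (\<forall>l\<in>\<Lambda>. W l \<in> V_cube B (Suc j) \<and> (\<forall>v\<in>V_cube B j. l2_inner unit_cube v (W l) = 0)) \<and>
        (\<forall>x. (\<Sum>l\<in>\<Lambda>. \<bar>W l x\<bar>) \<le> \<Psi> ^ ?d * 2 powr (real (j * ?d) / 2))"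
      by (intro exI[of _ \<Lambda>] exI[of _ W] conjI allI) (rule 1 2 3 4 5)+
  qed
qed

end

section \<open>Likelihood ratios\<close>

abbreviation obs_space :: "((real ^ 'd::finite) \<times> bool) measure" where
  "obs_space \<equiv> unit_cube \<Otimes>\<^sub>M count_space UNIV"

lemma pair_sigma_finite_obs: "pair_sigma_finite (unit_cube :: (real ^ 'd::finite) measure) (count_space (UNIV :: bool set))"
proof -
  interpret finite_measure "unit_cube :: (real ^ 'd) measure" by (rule finite_measure_unit_cube)
  show ?thesis
    by (simp add: pair_sigma_finite_def sigma_finite_measure_axioms sigma_finite_measure_count_space_finite)
qed

lemma measurable_if_snd:
  assumes "f \<in> borel_measurable M" "g \<in> borel_measurable M"
  shows "(\<lambda>z. if snd z then f (fst z) else g (fst z)) \<in> borel_measurable (M \<Otimes>\<^sub>M count_space UNIV)"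
  using assms by measurable

text \<open>The conditional density of the second component.  In contrast to \<open>bernoulli_pmf\<close> nothing is
  clipped, so the formula is affine in \<open>f\<close>; the two agree where \<open>f\<close> takes values in \<open>[0,1]\<close>.\<close>

definition bern_density :: "('a \<Rightarrow> real) \<Rightarrow> 'a \<times> bool \<Rightarrow> real" where
  "bern_density f z = (if snd z then f (fst z) else 1 - f (fst z))"

lemma bern_density_measurable:
  "f \<in> borel_measurable M \<Longrightarrow> bern_density f \<in> borel_measurable (M \<Otimes>\<^sub>M count_space UNIV)"
  unfolding bern_density_def[abs_def] by (intro measurable_if_snd) auto

lemma obs_law_eq:
  assumes f: "f \<in> borel_measurable unit_cube" "\<And>x. x \<in> space unit_cube \<Longrightarrow> 0 \<le> f x \<and> f x \<le> 1"
  shows "obs_law f (\<lambda>x. 1) = density obs_space (bern_density f)"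
proof -
  have eq: "ennreal (1 * pmf (bernoulli_pmf (f (fst z))) (snd z)) = ennreal (bern_density f z)"
    if "z \<in> space obs_space" for z
    using f(2)[of "fst z"] that by (cases "snd z") (auto simp: bern_density_def space_pair_measure)
  have m: "(\<lambda>z. ennreal (bern_density f z)) \<in> borel_measurable obs_space"
    using bern_density_measurable[OF f(1)] by measurable
  then have m': "(\<lambda>z. ennreal (1 * pmf (bernoulli_pmf (f (fst z))) (snd z))) \<in> borel_measurable obs_space"
    using measurable_cong[of "obs_space" "\<lambda>z. ennreal (1 * pmf (bernoulli_pmf (f (fst z))) (snd z))", OF eq] by simp
  show ?thesis
    unfolding obs_law_def case_prod_beta using eq m m' by (intro density_cong) auto
qed

lemma nn_integral_obs:
  fixes h :: "(real ^ 'd::finite) \<times> bool \<Rightarrow> ennreal"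
  assumes "h \<in> borel_measurable obs_space"
  shows "(\<integral>\<^sup>+z. h z \<partial>obs_space) = (\<integral>\<^sup>+x. h (x, True) + h (x, False) \<partial>unit_cube)"
proof -
  interpret pair_sigma_finite "unit_cube :: (real ^ 'd) measure" "count_space (UNIV :: bool set)"
    by (rule pair_sigma_finite_obs)
  show ?thesis
    by (subst M2.nn_integral_fst[OF assms, symmetric])
       (simp add: nn_integral_count_space_finite UNIV_bool add.commute)
qed

lemma prob_space_obs_law:
  fixes f :: "real ^ 'd::finite \<Rightarrow> real"
  assumes f: "f \<in> borel_measurable unit_cube" "\<And>x. x \<in> space unit_cube \<Longrightarrow> 0 \<le> f x \<and> f x \<le> 1"
  shows "prob_space (obs_law f (\<lambda>x. 1))"
proof
  interpret U: prob_space "unit_cube :: (real ^ 'd) measure" by (rule prob_space_unit_cube)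
  have m: "(\<lambda>z. ennreal (bern_density f z)) \<in> borel_measurable obs_space"
    using bern_density_measurable[OF f(1)] by measurable
  have law: "obs_law f (\<lambda>x. 1) = density obs_space (bern_density f)"
    using f by (rule obs_law_eq)
  have "emeasure (obs_law f (\<lambda>x. 1)) (space (obs_law f (\<lambda>x. 1))) =
      (\<integral>\<^sup>+z. ennreal (bern_density f z) \<partial>obs_space)"
    unfolding law by (subst emeasure_density[OF m]) (auto intro!: nn_integral_cong simp: indicator_def)
  also have "\<dots> = (\<integral>\<^sup>+x. ennreal (f x) + ennreal (1 - f x) \<partial>unit_cube)"
    by (subst nn_integral_obs[OF m]) (simp add: bern_density_def)
  also have "\<dots> = (\<integral>\<^sup>+x. 1 \<partial>(unit_cube :: (real ^ 'd) measure))"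
  proof (rule nn_integral_cong)
    fix x :: "real ^ 'd" assume "x \<in> space unit_cube"
    then show "ennreal (f x) + ennreal (1 - f x) = 1"
      using f(2)[of x] ennreal_plus[of "f x" "1 - f x"] by simp
  qed
  finally show "emeasure (obs_law f (\<lambda>x. 1)) (space (obs_law f (\<lambda>x. 1))) = 1"
    by (simp add: U.emeasure_space_1)
qed

lemma sets_obs_law: "sets (obs_law f g) = sets obs_space"
  by (simp add: obs_law_def)

lemma sets_sample_law: "sets (sample_law n f g) = sets (sample_space n)"
  unfolding sample_law_def sample_space_def by (intro sets_PiM_cong refl sets_obs_law)

lemma integral_obs_law:
  fixes f :: "real ^ 'd::finite \<Rightarrow> real"
  assumes f: "f \<in> borel_measurable unit_cube" "\<And>x. x \<in> space unit_cube \<Longrightarrow> 0 \<le> f x \<and> f x \<le> 1"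
    and h: "h \<in> borel_measurable obs_space" "\<And>z. z \<in> space obs_space \<Longrightarrow> \<bar>h z\<bar> \<le> K"
  shows "(\<integral>z. h z \<partial>obs_law f (\<lambda>x. 1)) = (\<integral>x. f x * h (x, True) + (1 - f x) * h (x, False) \<partial>unit_cube)"
proof -
  interpret pair_sigma_finite "unit_cube :: (real ^ 'd) measure" "count_space (UNIV :: bool set)"
    by (rule pair_sigma_finite_obs)
  interpret P: finite_measure "obs_space :: ((real ^ 'd) \<times> bool) measure"
    by (intro finite_measure_pair_measure finite_measure_unit_cube finite_measure_count_space) simp
  note m = bern_density_measurable[OF f(1)]
  have b: "0 \<le> bern_density f z \<and> bern_density f z \<le> 1" if "z \<in> space obs_space" for z
    using f(2)[of "fst z"] that by (auto simp: bern_density_def space_pair_measure)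
  have i: "integrable obs_space (\<lambda>z. bern_density f z * h z)"
  proof (rule P.integrable_const_bound[where B = K])
    show "AE z in obs_space. norm (bern_density f z * h z) \<le> K"
    proof (rule AE_I2)
      fix z :: "(real ^ 'd) \<times> bool" assume z: "z \<in> space obs_space"
      have "\<bar>bern_density f z\<bar> * \<bar>h z\<bar> \<le> 1 * K"
        using b[OF z] h(2)[OF z] by (intro mult_mono) auto
      then show "norm (bern_density f z * h z) \<le> K" by (simp add: abs_mult)
    qed
  qed (use m h in measurable)
  have law: "obs_law f (\<lambda>x. 1) = density obs_space (bern_density f)"
    using f by (rule obs_law_eq)
  have "(\<integral>z. h z \<partial>obs_law f (\<lambda>x. 1)) = (\<integral>z. bern_density f z * h z \<partial>obs_space)"
    unfolding law using b h(1) m by (subst integral_density) auto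
  also have "\<dots> = (\<integral>x. \<integral>y. bern_density f (x, y) * h (x, y) \<partial>count_space UNIV \<partial>unit_cube)"
    by (rule integral_fst'[OF i, symmetric])
  also have "\<dots> = (\<integral>x. f x * h (x, True) + (1 - f x) * h (x, False) \<partial>unit_cube)"
    by (simp add: lebesgue_integral_count_space_finite UNIV_bool bern_density_def add.commute)
  finally show ?thesis .
qed

text \<open>The likelihood ratio of one observation under \<open>c + u\<close> against the constant \<open>c\<close>.\<close>

definition lik_ratio :: "real \<Rightarrow> ('a \<Rightarrow> real) \<Rightarrow> 'a \<times> bool \<Rightarrow> real" where
  "lik_ratio c u z = (if snd z then 1 + u (fst z) / c else 1 - u (fst z) / (1 - c))"

lemma lik_ratio_measurable:
  "u \<in> borel_measurable M \<Longrightarrow> lik_ratio c u \<in> borel_measurable (M \<Otimes>\<^sub>M count_space UNIV)"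
  unfolding lik_ratio_def[abs_def] by (intro measurable_if_snd) auto

lemma lik_ratio_bounds:
  assumes "0 < c" "c \<le> 1/2" "\<bar>u (fst z)\<bar> \<le> c"
  shows "0 \<le> lik_ratio c u z" "\<bar>lik_ratio c u z\<bar> \<le> 2"
proof -
  have "u (fst z) / c \<le> 1" "- 1 \<le> u (fst z) / c" "u (fst z) / (1 - c) \<le> 1" "- 1 \<le> u (fst z) / (1 - c)"
    using assms by (auto simp: pos_divide_le_eq pos_le_divide_eq abs_le_iff)
  then show "0 \<le> lik_ratio c u z" "\<bar>lik_ratio c u z\<bar> \<le> 2"
    unfolding lik_ratio_def abs_le_iff by auto
qed

text \<open>The bound is required everywhere and not just almost everywhere, so that likelihood ratios
  are nonnegative and bounded at every point.\<close>

definition small_funs :: "real \<Rightarrow> (real ^ 'd::finite \<Rightarrow> real) set" where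
  "small_funs c = {u \<in> borel_measurable unit_cube. \<forall>x. \<bar>u x\<bar> \<le> c}"

lemma small_funsD:
  "u \<in> small_funs c \<Longrightarrow> u \<in> borel_measurable unit_cube"
  "u \<in> small_funs c \<Longrightarrow> \<bar>u x\<bar> \<le> c"
  by (auto simp: small_funs_def)

definition sample_lik :: "real \<Rightarrow> nat \<Rightarrow> ('a \<Rightarrow> real) \<Rightarrow> (nat \<Rightarrow> 'a \<times> bool) \<Rightarrow> real" where
  "sample_lik c n u \<omega> = (\<Prod>i<n. lik_ratio c u (\<omega> i))"

context
  fixes c :: real
  assumes c: "0 < c" "c \<le> 1/2"
begin

lemma const_prob: "x \<in> space unit_cube \<Longrightarrow> 0 \<le> c \<and> c \<le> 1"
  using c by auto

lemma obs_law_lik_ratio: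
  fixes u :: "real ^ 'd::finite \<Rightarrow> real"
  assumes u: "u \<in> small_funs c"
  shows "obs_law (\<lambda>x. c + u x) (\<lambda>x. 1) = density (obs_law (\<lambda>x. c) (\<lambda>x. 1)) (lik_ratio c u)"
proof -
  have r: "0 \<le> c + u x \<and> c + u x \<le> 1" for x using small_funsD(2)[OF u, of x] c by (auto simp: abs_le_iff)
  have law: "obs_law (\<lambda>x :: real ^ 'd. c) (\<lambda>x. 1) = density obs_space (bern_density (\<lambda>x. c))"
    using const_prob by (intro obs_law_eq) auto
  have "density (obs_law (\<lambda>x. c) (\<lambda>x. 1)) (lik_ratio c u) =
      density obs_space (\<lambda>z. ennreal (bern_density (\<lambda>x. c) z) * ennreal (lik_ratio c u z))"
    unfolding law
    using bern_density_measurable[of "\<lambda>x. c", OF borel_measurable_const] lik_ratio_measurable[OF small_funsD(1)[OF u]]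
    by (intro density_density_eq measurable_compose[OF _ measurable_ennreal])
  also have "(\<lambda>z. ennreal (bern_density (\<lambda>x. c) z) * ennreal (lik_ratio c u z)) =
      (\<lambda>z. ennreal (bern_density (\<lambda>x. c + u x) z))"
  proof
    fix z :: "(real ^ 'd) \<times> bool"
    have "bern_density (\<lambda>x. c) z * lik_ratio c u z = bern_density (\<lambda>x. c + u x) z"
      using c by (auto simp: bern_density_def lik_ratio_def field_simps)
    moreover have "0 \<le> bern_density (\<lambda>x. c) z" using c by (auto simp: bern_density_def)
    ultimately show "ennreal (bern_density (\<lambda>x. c) z) * ennreal (lik_ratio c u z) =
        ennreal (bern_density (\<lambda>x. c + u x) z)"
      by (simp flip: ennreal_mult')
  qed
  also have "density obs_space (\<lambda>z. ennreal (bern_density (\<lambda>x. c + u x) z)) = obs_law (\<lambda>x. c + u x) (\<lambda>x. 1)"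
    using small_funsD(1)[OF u] r by (intro obs_law_eq[symmetric]) auto
  finally show ?thesis ..
qed

text \<open>
  The ratio is 1 plus \<open>u\<close> times the score \<open>1 / c\<close> or \<open>- 1 / (1 - c)\<close>.  Given the design point,
  the score has mean 0 and variance \<open>1 / (c * (1 - c))\<close>; so the linear terms vanish, and the
  uniform design turns the mean of \<open>u * v\<close> into the inner product.
\<close>

lemma integral_lik_ratio_mult:
  fixes u v :: "real ^ 'd::finite \<Rightarrow> real"
  assumes u: "u \<in> small_funs c" and v: "v \<in> small_funs c"
  shows "(\<integral>z. lik_ratio c u z * lik_ratio c v z \<partial>obs_law (\<lambda>x. c) (\<lambda>x. 1)) =
    1 + l2_inner unit_cube u v / (c * (1 - c))"
proof -
  interpret Q: prob_space "unit_cube :: (real ^ 'd) measure" by (rule prob_space_unit_cube)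
  have l: "u \<in> l2 unit_cube" "v \<in> l2 unit_cube"
    using small_funsD u v by (auto intro!: l2_bounded[OF finite_measure_unit_cube, of _ c])
  have b: "\<bar>lik_ratio c u z * lik_ratio c v z\<bar> \<le> 2 * 2" for z
    unfolding abs_mult using c small_funsD(2) u v by (intro mult_mono lik_ratio_bounds(2)) auto
  have m: "(\<lambda>z. lik_ratio c u z * lik_ratio c v z) \<in> borel_measurable obs_space"
    using u v by (intro borel_measurable_times lik_ratio_measurable small_funsD(1))
  have "(\<integral>z. lik_ratio c u z * lik_ratio c v z \<partial>obs_law (\<lambda>x. c) (\<lambda>x. 1)) =
      (\<integral>x. c * (lik_ratio c u (x, True) * lik_ratio c v (x, True)) +
        (1 - c) * (lik_ratio c u (x, False) * lik_ratio c v (x, False)) \<partial>unit_cube)"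
    by (rule integral_obs_law[OF borel_measurable_const const_prob m b])
  also have "\<dots> = (\<integral>x. 1 + (u x * v x) / (c * (1 - c)) \<partial>unit_cube)"
  proof (intro Bochner_Integration.integral_cong refl)
    fix x
    have k: "c \<noteq> 0" "1 - c \<noteq> 0" using c by auto
    have "c * (lik_ratio c u (x, True) * lik_ratio c v (x, True)) = c + u x + v x + u x * v x / c"
      using k(1) by (simp add: lik_ratio_def field_simps)
    moreover have "(1 - c) * (lik_ratio c u (x, False) * lik_ratio c v (x, False)) =
        (1 - c) - u x - v x + u x * v x / (1 - c)"
      using k(2) unfolding lik_ratio_def fst_conv snd_conv if_False
      by (simp only: ring_distribs times_divide_eq_right times_divide_eq_left
          nonzero_mult_div_cancel_left divide_divide_eq_left) (simp add: divide_simps; algebra)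
    moreover have "u x * v x / c + u x * v x / (1 - c) = u x * v x / (c * (1 - c))"
      using k by (simp add: divide_simps) (simp add: algebra_simps)
    ultimately show "c * (lik_ratio c u (x, True) * lik_ratio c v (x, True)) +
        (1 - c) * (lik_ratio c u (x, False) * lik_ratio c v (x, False)) = 1 + (u x * v x) / (c * (1 - c))"
      by linarith
  qed
  also have "\<dots> = 1 + l2_inner unit_cube u v / (c * (1 - c))"
    using l2_mult_integrable[OF l] by (simp add: l2_inner_def Q.prob_space)
  finally show ?thesis .
qed

lemma sample_lik_nonneg: "u \<in> small_funs c \<Longrightarrow> 0 \<le> sample_lik c n u \<omega>"
  unfolding sample_lik_def using c small_funsD(2) by (intro prod_nonneg lik_ratio_bounds(1) ballI) auto

lemma prob_space_obs: "prob_space (obs_law (\<lambda>x :: real ^ 'd::finite. c) (\<lambda>x. 1))"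
  by (intro prob_space_obs_law const_prob borel_measurable_const)

lemma prob_space_sample: "prob_space (sample_law n (\<lambda>x :: real ^ 'd::finite. c) (\<lambda>x. 1))"
  unfolding sample_law_def by (intro prob_space_PiM prob_space_obs)

lemma product_sigma_finite_obs:
  "product_sigma_finite (\<lambda>i :: nat. obs_law (\<lambda>x :: real ^ 'd::finite. c) (\<lambda>x. 1))"
  unfolding product_sigma_finite_def by (intro allI prob_space_imp_sigma_finite prob_space_obs)

lemma sample_lik_measurable:
  fixes u :: "real ^ 'd::finite \<Rightarrow> real"
  assumes "u \<in> small_funs c" shows "sample_lik c n u \<in> borel_measurable (sample_law n (\<lambda>x. c) (\<lambda>x. 1))"
proof -
  have m: "lik_ratio c u \<in> borel_measurable (obs_law (\<lambda>x. c) (\<lambda>x. 1))"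
    using lik_ratio_measurable[OF small_funsD(1)[OF assms]] by (simp add: measurable_cong_sets[OF sets_obs_law refl])
  show ?thesis
    unfolding sample_lik_def[abs_def] sample_law_def
    by (intro borel_measurable_prod) (rule measurable_compose[OF _ m], rule measurable_component_singleton)
qed

lemma sample_law_density:
  fixes u :: "real ^ 'd::finite \<Rightarrow> real"
  assumes u: "u \<in> small_funs c"
  shows "sample_law n (\<lambda>x. c + u x) (\<lambda>x. 1) = density (sample_law n (\<lambda>x. c) (\<lambda>x. 1)) (sample_lik c n u)"
proof -
  let ?P = "obs_law (\<lambda>x :: real ^ 'd. c) (\<lambda>x. 1)" and ?Q = "obs_law (\<lambda>x. c + u x) (\<lambda>x. 1)"
  have m: "lik_ratio c u \<in> borel_measurable ?P"
    using lik_ratio_measurable[OF small_funsD(1)[OF u]] by (simp add: measurable_cong_sets[OF sets_obs_law refl])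
  interpret P: product_sigma_finite "\<lambda>i :: nat. ?P" by (rule product_sigma_finite_obs)
  have "prob_space ?Q"
  proof (rule prob_space_obs_law)
    show "0 \<le> c + u x \<and> c + u x \<le> 1" for x using small_funsD(2)[OF u, of x] c by (auto simp: abs_le_iff)
  qed (use small_funsD(1)[OF u] in simp)
  then interpret Q: product_sigma_finite "\<lambda>i :: nat. ?Q"
    by (simp add: product_sigma_finite_def prob_space_imp_sigma_finite)
  have sm: "(\<lambda>\<omega>. ennreal (sample_lik c n u \<omega>)) \<in> borel_measurable (Pi\<^sub>M {..<n} (\<lambda>i. ?P))"
    using sample_lik_measurable[OF u, of n] unfolding sample_law_def by measurable
  have "density (Pi\<^sub>M {..<n} (\<lambda>i. ?P)) (\<lambda>\<omega>. ennreal (sample_lik c n u \<omega>)) = Pi\<^sub>M {..<n} (\<lambda>i. ?Q)"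
  proof (rule Q.PiM_eqI)
    show "finite {..<n}" by simp
    show "sets (density (Pi\<^sub>M {..<n} (\<lambda>i. ?P)) (\<lambda>\<omega>. ennreal (sample_lik c n u \<omega>))) = sets (Pi\<^sub>M {..<n} (\<lambda>i. ?Q))"
      unfolding sets_density by (intro sets_PiM_cong refl) (simp add: sets_obs_law)
    fix A assume A: "\<And>i. i \<in> {..<n} \<Longrightarrow> A i \<in> sets ?Q"
    then have AP: "\<And>i. i \<in> {..<n} \<Longrightarrow> A i \<in> sets ?P" by (simp add: sets_obs_law)
    have "emeasure (density (Pi\<^sub>M {..<n} (\<lambda>i. ?P)) (\<lambda>\<omega>. ennreal (sample_lik c n u \<omega>))) (Pi\<^sub>E {..<n} A) =
        (\<integral>\<^sup>+\<omega>. ennreal (sample_lik c n u \<omega>) * indicator (Pi\<^sub>E {..<n} A) \<omega> \<partial>Pi\<^sub>M {..<n} (\<lambda>i. ?P))"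
      using sm AP by (intro emeasure_density) auto
    also have "\<dots> = (\<integral>\<^sup>+\<omega>. (\<Prod>i<n. ennreal (lik_ratio c u (\<omega> i)) * indicator (A i) (\<omega> i)) \<partial>Pi\<^sub>M {..<n} (\<lambda>i. ?P))"
    proof (rule nn_integral_cong)
      fix \<omega> assume \<omega>: "\<omega> \<in> space (Pi\<^sub>M {..<n} (\<lambda>i. ?P))"
      have "ennreal (sample_lik c n u \<omega>) = (\<Prod>i<n. ennreal (lik_ratio c u (\<omega> i)))"
        unfolding sample_lik_def using c small_funsD(2)[OF u] by (intro prod_ennreal[symmetric] lik_ratio_bounds(1))
      moreover have "indicator (Pi\<^sub>E {..<n} A) \<omega> = (\<Prod>i<n. indicator (A i) (\<omega> i) :: ennreal)"
      proof (cases "\<omega> \<in> Pi\<^sub>E {..<n} A")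
        case False
        then obtain i where "i < n" "\<omega> i \<notin> A i"
          using \<omega> by (auto simp: PiE_def space_PiM Pi_def)
        then have "(\<Prod>i<n. indicator (A i) (\<omega> i) :: ennreal) = 0"
          by (intro prod_zero bexI[of _ i]) auto
        then show ?thesis using False by simp
      next
        case True
        then have "(\<Prod>i<n. indicator (A i) (\<omega> i) :: ennreal) = 1"
          by (intro prod.neutral ballI) (auto simp: PiE_def Pi_def)
        then show ?thesis using True by simp
      qed
      ultimately show "ennreal (sample_lik c n u \<omega>) * indicator (Pi\<^sub>E {..<n} A) \<omega> =
          (\<Prod>i<n. ennreal (lik_ratio c u (\<omega> i)) * indicator (A i) (\<omega> i))"
        by (simp add: prod.distrib)
    qed
    also have "\<dots> = (\<Prod>i<n. \<integral>\<^sup>+z. ennreal (lik_ratio c u z) * indicator (A i) z \<partial>?P)"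
      using m AP by (intro P.product_nn_integral_prod) auto
    also have "\<dots> = (\<Prod>i<n. emeasure ?Q (A i))"
      using m AP unfolding obs_law_lik_ratio[OF u]
      by (intro prod.cong refl emeasure_density[symmetric]) auto
    finally show "emeasure (density (Pi\<^sub>M {..<n} (\<lambda>i. ?P)) (\<lambda>\<omega>. ennreal (sample_lik c n u \<omega>))) (Pi\<^sub>E {..<n} A) =
        (\<Prod>i<n. emeasure ?Q (A i))" .
  qed
  then show ?thesis unfolding sample_law_def by (rule sym)
qed

lemma integral_sample_lik_mult:
  fixes u v :: "real ^ 'd::finite \<Rightarrow> real"
  assumes u: "u \<in> small_funs c" and v: "v \<in> small_funs c"
  shows "integrable (sample_law n (\<lambda>x. c) (\<lambda>x. 1)) (\<lambda>\<omega>. sample_lik c n u \<omega> * sample_lik c n v \<omega>)"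
    and "(\<integral>\<omega>. sample_lik c n u \<omega> * sample_lik c n v \<omega> \<partial>sample_law n (\<lambda>x. c) (\<lambda>x. 1)) =
      (1 + l2_inner unit_cube u v / (c * (1 - c))) ^ n"
proof -
  let ?P = "obs_law (\<lambda>x :: real ^ 'd. c) (\<lambda>x. 1)"
  interpret P: product_sigma_finite "\<lambda>i :: nat. ?P" by (rule product_sigma_finite_obs)
  interpret p: prob_space ?P by (rule prob_space_obs)
  have m: "(\<lambda>z. lik_ratio c u z * lik_ratio c v z) \<in> borel_measurable ?P"
    unfolding measurable_cong_sets[OF sets_obs_law refl]
    using u v by (intro borel_measurable_times lik_ratio_measurable small_funsD(1))
  have "\<bar>lik_ratio c u z * lik_ratio c v z\<bar> \<le> 2 * 2" for z
    unfolding abs_mult using c small_funsD(2) u v by (intro mult_mono lik_ratio_bounds(2)) auto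
  then have i: "integrable ?P (\<lambda>z. lik_ratio c u z * lik_ratio c v z)"
    using m by (intro p.integrable_const_bound[where B = 4]) auto
  have eq: "sample_lik c n u \<omega> * sample_lik c n v \<omega> = (\<Prod>i<n. lik_ratio c u (\<omega> i) * lik_ratio c v (\<omega> i))" for \<omega>
    by (simp add: sample_lik_def prod.distrib)
  show "integrable (sample_law n (\<lambda>x. c) (\<lambda>x. 1)) (\<lambda>\<omega>. sample_lik c n u \<omega> * sample_lik c n v \<omega>)"
    unfolding eq sample_law_def using i by (intro P.product_integrable_prod) auto
  have "(\<integral>\<omega>. sample_lik c n u \<omega> * sample_lik c n v \<omega> \<partial>sample_law n (\<lambda>x. c) (\<lambda>x. 1)) =
      (\<Prod>i<n. \<integral>z. lik_ratio c u z * lik_ratio c v z \<partial>?P)"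
    unfolding eq sample_law_def using i by (intro P.product_integral_prod) auto
  then show "(\<integral>\<omega>. sample_lik c n u \<omega> * sample_lik c n v \<omega> \<partial>sample_law n (\<lambda>x. c) (\<lambda>x. 1)) =
      (1 + l2_inner unit_cube u v / (c * (1 - c))) ^ n"
    by (simp add: integral_lik_ratio_mult[OF u v])
qed

end

section \<open>The second-moment bound for mixtures\<close>

text \<open>
  The difference of the two probabilities of \<open>A\<close> is the integral of (mixture likelihood ratio
  minus 1) over \<open>A\<close>; by the Cauchy-Schwarz inequality it is at most the \<open>L\<^sup>2\<close> norm of that
  function, whose square is the second moment of the ratio minus 1.
\<close>

lemma mixture_second_moment:
  fixes L :: "'h \<Rightarrow> 'a \<Rightarrow> real"
  assumes P: "prob_space P" and H: "finite H" "H \<noteq> {}" and A: "A \<in> sets P"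
    and L: "\<And>h. h \<in> H \<Longrightarrow> L h \<in> l2 P" "\<And>h. h \<in> H \<Longrightarrow> (\<integral>x. L h x \<partial>P) = 1"
  shows "measure P A - sqrt ((\<Sum>h\<in>H. \<Sum>k\<in>H. l2_inner P (L h) (L k)) / (real (card H))\<^sup>2 - 1)
    \<le> (\<Sum>h\<in>H. \<integral>x. L h x * indicator A x \<partial>P) / real (card H)"
proof -
  interpret prob_space P by fact
  define m where "m = real (card H)"
  have m: "m > 0" using H by (simp add: m_def card_gt_0_iff)
  \<comment> \<open>the mixture likelihood ratio, centred\<close>
  define D where "D x = (\<Sum>h\<in>H. (1/m) * L h x) - 1" for x
  have one: "(\<lambda>x. 1) \<in> l2 P" by (rule l2_bounded[of _ _ 1]) (auto intro: finite_measure_axioms)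
  have ind: "indicator A \<in> l2 P"
    using A by (intro l2_bounded[of _ _ 1]) (auto intro: finite_measure_axioms simp: indicator_def)
  have S: "(\<lambda>x. \<Sum>h\<in>H. (1/m) * L h x) \<in> l2 P" using L by (intro l2_sum l2_cmult)
  have D: "D \<in> l2 P" unfolding D_def[abs_def] by (rule l2_diff[OF S one])
  have inner_S: "l2_inner P (\<lambda>x. \<Sum>h\<in>H. (1/m) * L h x) f = (\<Sum>h\<in>H. l2_inner P (L h) f) / m" if "f \<in> l2 P" for f
  proof -
    have "l2_inner P (\<lambda>x. \<Sum>h\<in>H. (1/m) * L h x) f = (\<Sum>h\<in>H. l2_inner P (\<lambda>x. (1/m) * L h x) f)"
      using L that by (intro l2_inner_sum_left l2_cmult)
    then show ?thesis unfolding l2_inner_cmult_left by (simp add: sum_divide_distrib)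
  qed
  have L1: "l2_inner P (L h) (\<lambda>x. 1) = 1" if "h \<in> H" for h
    using L(2)[OF that] by (simp add: l2_inner_def)
  have S1: "l2_inner P (\<lambda>x. \<Sum>h\<in>H. (1/m) * L h x) (\<lambda>x. 1) = 1"
    unfolding inner_S[OF one] using L1 m by (simp add: m_def)
  have one1: "l2_inner P (\<lambda>x. 1) (\<lambda>x. 1) = 1" by (simp add: l2_inner_def prob_space)
  have "l2_inner P D D = l2_inner P (\<lambda>x. \<Sum>h\<in>H. (1/m) * L h x) D - l2_inner P (\<lambda>x. 1) D"
    using l2_inner_diff_left[OF S one D] by (simp add: D_def[abs_def])
  also have "l2_inner P (\<lambda>x. 1) D = 0"
    using l2_inner_diff_left[OF S one one] S1 one1 l2_inner_commute[of P D "\<lambda>x. 1"]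
    by (simp add: D_def[abs_def] l2_inner_commute)
  also have "l2_inner P (\<lambda>x. \<Sum>h\<in>H. (1/m) * L h x) D =
      l2_inner P (\<lambda>x. \<Sum>h\<in>H. (1/m) * L h x) (\<lambda>x. \<Sum>h\<in>H. (1/m) * L h x) - 1"
    using l2_inner_diff_left[OF S one S] S1
      l2_inner_commute[of P "\<lambda>x. \<Sum>h\<in>H. (1/m) * L h x" D]
      l2_inner_commute[of P "\<lambda>x. 1" "\<lambda>x. \<Sum>h\<in>H. (1/m) * L h x"]
    unfolding D_def[abs_def] by linarith
  also have "l2_inner P (\<lambda>x. \<Sum>h\<in>H. (1/m) * L h x) (\<lambda>x. \<Sum>h\<in>H. (1/m) * L h x) =
      (\<Sum>h\<in>H. (\<Sum>k\<in>H. l2_inner P (L h) (L k)) / m) / m"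
  proof -
    have "l2_inner P (L h) (\<lambda>x. \<Sum>h\<in>H. (1/m) * L h x) = (\<Sum>k\<in>H. l2_inner P (L h) (L k)) / m" if "h \<in> H" for h
      using inner_S[OF L(1)[OF that]] l2_inner_commute[of P "L h"] by simp
    then show ?thesis unfolding inner_S[OF S] by simp
  qed
  also have "\<dots> = (\<Sum>h\<in>H. \<Sum>k\<in>H. l2_inner P (L h) (L k)) / m\<^sup>2"
    by (simp add: sum_divide_distrib power2_eq_square)
  finally have DD: "l2_norm P D = sqrt ((\<Sum>h\<in>H. \<Sum>k\<in>H. l2_inner P (L h) (L k)) / m\<^sup>2 - 1)"
    using l2_norm_square[of P D] l2_norm_nonneg[of P D] by (simp add: real_sqrt_unique)
  have "l2_inner P D (indicator A) = (\<Sum>h\<in>H. l2_inner P (L h) (indicator A)) / m - measure P A"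
  proof -
    have "l2_inner P (\<lambda>x. 1) (indicator A) = measure P A"
      using A by (simp add: l2_inner_def)
    then show ?thesis
      using l2_inner_diff_left[OF S one ind] inner_S[OF ind] by (simp add: D_def[abs_def])
  qed
  moreover have "\<bar>l2_inner P D (indicator A)\<bar> \<le> l2_norm P D * l2_norm P (indicator A)"
    by (rule l2_Cauchy_Schwarz[OF D ind])
  moreover have "l2_norm P D * l2_norm P (indicator A) \<le> l2_norm P D * 1"
  proof (intro mult_left_mono l2_norm_nonneg)
    have "(l2_norm P (indicator A))\<^sup>2 = measure P A"
      using A by (simp add: l2_norm_square l2_inner_def indicator_inter_arith[symmetric])
    then have "(l2_norm P (indicator A))\<^sup>2 \<le> 1\<^sup>2" by simp
    then show "l2_norm P (indicator A) \<le> 1" by (rule power2_le_imp_le) simp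
  qed
  ultimately have "measure P A - l2_norm P D \<le> (\<Sum>h\<in>H. l2_inner P (L h) (indicator A)) / m"
    by linarith
  then show ?thesis unfolding DD by (simp add: l2_inner_def m_def)
qed

definition signs :: "'i set \<Rightarrow> ('i \<Rightarrow> real) set" where
  "signs I = PiE I (\<lambda>_. {-1, 1})"

lemma signs_finite: "finite I \<Longrightarrow> finite (signs I)"
  by (simp add: signs_def finite_PiE)

lemma card_signs: "finite I \<Longrightarrow> card (signs I) = 2 ^ card I"
  by (simp add: signs_def card_PiE numeral_2_eq_2)

lemma signs_square: "\<eta> \<in> signs I \<Longrightarrow> i \<in> I \<Longrightarrow> \<eta> i * \<eta> i = 1" "\<eta> \<in> signs I \<Longrightarrow> i \<in> I \<Longrightarrow> \<bar>\<eta> i\<bar> = 1"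
  by (force simp: signs_def PiE_def Pi_def)+

text \<open>The signs are independent, so the exponential moment factorizes into hyperbolic cosines.\<close>

lemma sum_signs_exp:
  assumes I: "finite I" and \<theta>: "\<theta> \<in> signs I"
  shows "(\<Sum>\<eta>\<in>signs I. exp (b * (\<Sum>i\<in>I. \<eta> i * \<theta> i))) = (exp b + exp (- b)) ^ card I"
proof -
  have "(\<Sum>\<eta>\<in>signs I. exp (b * (\<Sum>i\<in>I. \<eta> i * \<theta> i))) = (\<Sum>\<eta>\<in>signs I. \<Prod>i\<in>I. exp (b * (\<eta> i * \<theta> i)))"
    using I by (simp add: sum_distrib_left exp_sum)
  also have "\<dots> = (\<Prod>i\<in>I. \<Sum>s\<in>{-1, 1}. exp (b * (s * \<theta> i)))"
    unfolding signs_def by (rule prod_sum_PiE[symmetric]) (use I in auto)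
  also have "\<dots> = (\<Prod>i\<in>I. exp b + exp (- b))"
  proof (rule prod.cong[OF refl])
    fix i assume "i \<in> I"
    then have "\<theta> i = -1 \<or> \<theta> i = 1" using \<theta> by (auto simp: signs_def PiE_def Pi_def)
    then show "(\<Sum>s\<in>{-1, 1}. exp (b * (s * \<theta> i))) = exp b + exp (- b)" by auto
  qed
  finally show ?thesis by simp
qed

text \<open>A weak form of the bound \<open>exp (b\<^sup>2 / 2)\<close> for the hyperbolic cosine; the factor 2 in the
  exponent only changes how small \<open>\<delta>\<close> has to be.\<close>

lemma exp_plus_exp_minus_le:
  assumes "0 \<le> b" "b \<le> (1::real)" shows "exp b + exp (- b) \<le> 2 * exp (b\<^sup>2)"
proof -
  have 1: "exp b \<le> 1 + b + b\<^sup>2" using exp_bound[OF assms] .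
  have "exp (- b) = 1 / exp b" by (simp add: exp_minus inverse_eq_divide)
  also have "\<dots> \<le> 1 / (1 + b)"
    using assms exp_ge_add_one_self[of b] by (intro divide_left_mono) auto
  also have "\<dots> \<le> 1 - b + b\<^sup>2"
  proof -
    have "1 \<le> (1 - b + b\<^sup>2) * (1 + b)"
    proof -
      have "(1 - b + b\<^sup>2) * (1 + b) = 1 + b ^ 3" by (simp add: algebra_simps power2_eq_square power3_eq_cube)
      then show ?thesis using assms by simp
    qed
    then show ?thesis using assms by (simp add: pos_divide_le_eq)
  qed
  finally show ?thesis using 1 exp_ge_add_one_self[of "b\<^sup>2"] by linarith
qed

lemma l2_inner_orthonormal_sums:
  assumes I: "finite I" and W: "l2_orthonormal M I W"
  shows "l2_inner M (\<lambda>x. \<Sum>i\<in>I. a i * W i x) (\<lambda>x. \<Sum>i\<in>I. b i * W i x) = (\<Sum>i\<in>I. a i * b i)"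
proof -
  have Wl: "W i \<in> l2 M" if "i \<in> I" for i using W that by (simp add: l2_orthonormal_def)
  have sl: "(\<lambda>x. \<Sum>i\<in>I. b i * W i x) \<in> l2 M" using Wl by (intro l2_sum l2_cmult)
  have 1: "l2_inner M (W i) (\<lambda>x. \<Sum>i\<in>I. b i * W i x) = b i" if i: "i \<in> I" for i
  proof -
    have "l2_inner M (\<lambda>x. \<Sum>i\<in>I. b i * W i x) (W i) = (\<Sum>k\<in>I. b k * l2_inner M (W k) (W i))"
      using Wl i by (subst l2_inner_sum_left) (auto simp: l2_cmult l2_inner_cmult_left)
    also have "\<dots> = (\<Sum>k\<in>I. if k = i then b k else 0)"
      using W i by (intro sum.cong) (auto simp: l2_orthonormal_def)
    also have "\<dots> = b i" using I i by simp
    finally show ?thesis by (simp add: l2_inner_commute)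
  qed
  have "l2_inner M (\<lambda>x. \<Sum>i\<in>I. a i * W i x) (\<lambda>x. \<Sum>i\<in>I. b i * W i x) =
      (\<Sum>i\<in>I. a i * l2_inner M (W i) (\<lambda>x. \<Sum>i\<in>I. b i * W i x))"
    using Wl sl by (subst l2_inner_sum_left) (auto simp: l2_cmult l2_inner_cmult_left)
  then show ?thesis using 1 by simp
qed

text \<open>
  For two sign vectors the inner product of the likelihood ratios is
  \<open>(1 + y) ^ n \<le> exp (n * y)\<close>, with \<open>n * y = b * (\<Sum>i\<in>I. \<eta> i * \<theta> i)\<close> by orthonormality.
  Averaging over the signs gives at most \<open>exp (b\<^sup>2)\<close> for each index.  The average loss of
  probability is thus bounded, and some sign vector does not lose more than the average.
\<close>

lemma mixture_indistinguishable:
  fixes W :: "'i \<Rightarrow> real ^ 'd::finite \<Rightarrow> real"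
  assumes c: "0 < c" "c \<le> 1/2" and I: "finite I" and W: "l2_orthonormal unit_cube I W"
    and bound: "\<And>x. (\<Sum>i\<in>I. \<bar>\<gamma> * W i x\<bar>) \<le> c"
    and b: "b = real n * \<gamma>\<^sup>2 / (c * (1 - c))" "b \<le> 1"
    and A: "A \<in> sets (sample_space n)"
  shows "\<exists>\<eta>\<in>signs I. measure (sample_law n (\<lambda>x. c) (\<lambda>x. 1)) A - sqrt (exp (real (card I) * b\<^sup>2) - 1)
     \<le> measure (sample_law n (\<lambda>x. c + (\<Sum>i\<in>I. (\<gamma> * \<eta> i) * W i x)) (\<lambda>x. 1)) A"
proof -
  define u where "u \<eta> x = (\<Sum>i\<in>I. (\<gamma> * \<eta> i) * W i x)" for \<eta> and x
  let ?H = "signs I"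
  let ?P = "sample_law n (\<lambda>x :: real ^ 'd. c) (\<lambda>x. 1)"
  have Wl: "W i \<in> l2 unit_cube" if "i \<in> I" for i using W that by (simp add: l2_orthonormal_def)
  have U: "u \<eta> \<in> small_funs c" if \<eta>: "\<eta> \<in> ?H" for \<eta>
  proof -
    have "u \<eta> \<in> l2 unit_cube" unfolding u_def[abs_def] using Wl by (intro l2_sum l2_cmult)
    moreover have "\<bar>u \<eta> x\<bar> \<le> c" for x
    proof -
      have "\<bar>u \<eta> x\<bar> \<le> (\<Sum>i\<in>I. \<bar>(\<gamma> * \<eta> i) * W i x\<bar>)" unfolding u_def by (rule sum_abs)
      also have "\<dots> = (\<Sum>i\<in>I. \<bar>\<gamma> * W i x\<bar>)"
        using signs_square(2)[OF \<eta>] by (intro sum.cong) (auto simp: abs_mult)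
      finally show ?thesis using bound[of x] by simp
    qed
    ultimately show ?thesis by (auto simp: small_funs_def l2_measurable)
  qed
  have U0: "(\<lambda>x. 0) \<in> small_funs c" using c by (simp add: small_funs_def)
  interpret P: prob_space ?P by (rule prob_space_sample[OF c])
  have AP: "A \<in> sets ?P" using A by (simp add: sets_sample_law)
  let ?L = "\<lambda>\<eta>. sample_lik c n (u \<eta>)"
  have L2: "?L \<eta> \<in> l2 ?P" if "\<eta> \<in> ?H" for \<eta>
    using sample_lik_measurable[OF c U[OF that]] integral_sample_lik_mult(1)[OF c U[OF that] U[OF that]]
    by (simp add: l2_def power2_eq_square)
  have L1: "(\<integral>\<omega>. ?L \<eta> \<omega> \<partial>?P) = 1" if "\<eta> \<in> ?H" for \<eta>
  proof -
    have "(\<integral>\<omega>. ?L \<eta> \<omega> * sample_lik c n (\<lambda>x. 0) \<omega> \<partial>?P) =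
        (1 + l2_inner unit_cube (u \<eta>) (\<lambda>x. 0) / (c * (1 - c))) ^ n"
      by (rule integral_sample_lik_mult(2)[OF c U[OF that] U0])
    moreover have "sample_lik c n (\<lambda>x. 0) \<omega> = 1" for \<omega> :: "nat \<Rightarrow> (real ^ 'd) \<times> bool"
    proof -
      have "lik_ratio c (\<lambda>x. 0) z = 1" for z :: "(real ^ 'd) \<times> bool" by (simp add: lik_ratio_def)
      then show ?thesis by (simp add: sample_lik_def)
    qed
    ultimately show ?thesis by (simp add: l2_inner_def)
  qed
  have prob: "(\<integral>\<omega>. ?L \<eta> \<omega> * indicator A \<omega> \<partial>?P) = measure (sample_law n (\<lambda>x. c + u \<eta> x) (\<lambda>x. 1)) A"
    if \<eta>: "\<eta> \<in> ?H" for \<eta>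
  proof -
    have nn: "AE \<omega> in ?P. 0 \<le> ?L \<eta> \<omega>" using sample_lik_nonneg[OF c U[OF \<eta>]] by auto
    have m: "?L \<eta> \<in> borel_measurable ?P" using L2[OF \<eta>] by (rule l2_measurable)
    have "measure (density ?P (?L \<eta>)) A = (\<integral>\<omega>. indicator A \<omega> \<partial>density ?P (?L \<eta>))"
      using AP by simp
    also have "\<dots> = (\<integral>\<omega>. ?L \<eta> \<omega> * indicator A \<omega> \<partial>?P)"
      using m nn AP by (subst integral_density) auto
    finally show ?thesis
      using sample_law_density[OF c U[OF \<eta>]] by simp
  qed
  let ?m = "real (card ?H)"
  have fin: "finite ?H" using I by (rule signs_finite)
  have ne: "?H \<noteq> {}" by (simp add: signs_def PiE_eq_empty_iff)
  have mpos: "?m > 0" using fin ne by (simp add: card_gt_0_iff)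
  have b0: "0 \<le> b" using c by (simp add: b(1))
  have inner_le: "l2_inner ?P (?L \<eta>) (?L \<theta>) \<le> exp (b * (\<Sum>i\<in>I. \<eta> i * \<theta> i))" if \<eta>: "\<eta> \<in> ?H" "\<theta> \<in> ?H" for \<eta> \<theta>
  proof -
    let ?y = "l2_inner unit_cube (u \<eta>) (u \<theta>) / (c * (1 - c))"
    have "0 \<le> 1 + ?y"
    proof -
      have "1 + ?y = (\<integral>z. lik_ratio c (u \<eta>) z * lik_ratio c (u \<theta>) z \<partial>obs_law (\<lambda>x. c) (\<lambda>x. 1))"
        by (rule integral_lik_ratio_mult[OF c U[OF \<eta>(1)] U[OF \<eta>(2)], symmetric])
      also have "\<dots> \<ge> 0"
        using c small_funsD(2)[OF U[OF \<eta>(1)]] small_funsD(2)[OF U[OF \<eta>(2)]]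
        by (intro Bochner_Integration.integral_nonneg mult_nonneg_nonneg lik_ratio_bounds(1)) auto
      finally show ?thesis .
    qed
    have "l2_inner ?P (?L \<eta>) (?L \<theta>) = (1 + ?y) ^ n"
      unfolding l2_inner_def[of ?P] by (rule integral_sample_lik_mult(2)[OF c U[OF \<eta>(1)] U[OF \<eta>(2)]])
    also have "\<dots> \<le> exp ?y ^ n" using \<open>0 \<le> 1 + ?y\<close> by (intro power_mono exp_ge_add_one_self)
    also have "\<dots> = exp (real n * ?y)" by (rule exp_of_nat_mult[symmetric])
    also have "real n * ?y = b * (\<Sum>i\<in>I. \<eta> i * \<theta> i)"
    proof -
      have "l2_inner unit_cube (u \<eta>) (u \<theta>) = (\<Sum>i\<in>I. (\<gamma> * \<eta> i) * (\<gamma> * \<theta> i))"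
        unfolding u_def[abs_def] by (rule l2_inner_orthonormal_sums[OF I W])
      also have "\<dots> = \<gamma>\<^sup>2 * (\<Sum>i\<in>I. \<eta> i * \<theta> i)"
        by (simp add: sum_distrib_left power2_eq_square mult_ac)
      finally show ?thesis by (simp add: b(1))
    qed
    finally show ?thesis .
  qed
  have "(\<Sum>\<eta>\<in>?H. \<Sum>\<theta>\<in>?H. l2_inner ?P (?L \<eta>) (?L \<theta>)) = (\<Sum>\<theta>\<in>?H. \<Sum>\<eta>\<in>?H. l2_inner ?P (?L \<eta>) (?L \<theta>))"
    by (rule sum.swap)
  also have "\<dots> \<le> (\<Sum>\<theta>\<in>?H. \<Sum>\<eta>\<in>?H. exp (b * (\<Sum>i\<in>I. \<eta> i * \<theta> i)))"
    by (intro sum_mono inner_le)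
  also have "\<dots> = ?m * (exp b + exp (- b)) ^ card I"
    using sum_signs_exp[OF I] by simp
  also have "\<dots> \<le> ?m * (2 * exp (b\<^sup>2)) ^ card I"
    using exp_plus_exp_minus_le[OF b0 b(2)] by (intro mult_left_mono power_mono) (auto intro: add_nonneg_nonneg)
  also have "\<dots> = ?m\<^sup>2 * exp (real (card I) * b\<^sup>2)"
    using I by (simp add: card_signs power_mult_distrib exp_of_nat_mult power2_eq_square)
  finally have "(\<Sum>\<eta>\<in>?H. \<Sum>\<theta>\<in>?H. l2_inner ?P (?L \<eta>) (?L \<theta>)) / ?m\<^sup>2 \<le> exp (real (card I) * b\<^sup>2)"
    using mpos by (simp add: pos_divide_le_eq mult.commute)
  then have "measure ?P A - sqrt (exp (real (card I) * b\<^sup>2) - 1)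
      \<le> measure ?P A - sqrt ((\<Sum>\<eta>\<in>?H. \<Sum>\<theta>\<in>?H. l2_inner ?P (?L \<eta>) (?L \<theta>)) / ?m\<^sup>2 - 1)"
    by simp
  also have "\<dots> \<le> (\<Sum>\<eta>\<in>?H. \<integral>\<omega>. ?L \<eta> \<omega> * indicator A \<omega> \<partial>?P) / ?m"
    by (rule mixture_second_moment[OF P.prob_space_axioms fin ne AP L2 L1])
  also have "(\<Sum>\<eta>\<in>?H. \<integral>\<omega>. ?L \<eta> \<omega> * indicator A \<omega> \<partial>?P) =
      (\<Sum>\<eta>\<in>?H. measure (sample_law n (\<lambda>x. c + u \<eta> x) (\<lambda>x. 1)) A)"
    by (rule sum.cong[OF refl prob])
  finally have mean: "?m * (measure ?P A - sqrt (exp (real (card I) * b\<^sup>2) - 1)) \<le>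
      (\<Sum>\<eta>\<in>?H. measure (sample_law n (\<lambda>x. c + u \<eta> x) (\<lambda>x. 1)) A)"
    using mpos by (simp add: pos_le_divide_eq mult.commute)
  show ?thesis
  proof (rule ccontr)
    assume "\<not> ?thesis"
    then have "measure (sample_law n (\<lambda>x. c + u \<eta> x) (\<lambda>x. 1)) A <
        measure ?P A - sqrt (exp (real (card I) * b\<^sup>2) - 1)" if "\<eta> \<in> ?H" for \<eta>
      using that unfolding u_def by (auto simp: not_le)
    then have "(\<Sum>\<eta>\<in>?H. measure (sample_law n (\<lambda>x. c + u \<eta> x) (\<lambda>x. 1)) A) <
        (\<Sum>\<eta>\<in>?H. measure ?P A - sqrt (exp (real (card I) * b\<^sup>2) - 1))"
      by (intro sum_strict_mono fin ne)
    then show False using mean by simp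
  qed
qed

section \<open>Alternatives at one resolution level\<close>

context cdv_basis
begin

text \<open>
  The mixture bound for the wavelets of level \<open>j\<close>, scaled to the norm \<open>\<beta>\<close>.  The \<open>N\<close>
  coefficients have absolute value \<open>\<gamma> = \<beta> / sqrt N\<close>, so the sup norm is at most a constant times \<open>\<beta>\<close>, and
  \<open>N * b\<^sup>2\<close> becomes \<open>(n * \<beta>\<^sup>2)\<^sup>2 / (N * (c * (1 - c))\<^sup>2)\<close> with \<open>N\<close> of the order of \<open>2 ^ (j * d)\<close>.
\<close>

lemma indistinguishable_alternatives:
  assumes c: "0 < c" "c \<le> 1/2"
  shows "\<exists>\<kappa>>0. \<exists>\<Psi>>0. \<exists>j0\<ge>level0 B. \<forall>j\<ge>j0. \<forall>n \<beta> x A.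
    0 < \<beta> \<and> \<beta> * \<Psi> \<le> c \<and> 0 \<le> x \<and> x \<le> 1 \<and> (real n * \<beta>\<^sup>2)\<^sup>2 \<le> x * \<kappa> * 2 ^ (j * CARD('d)) \<and>
    A \<in> sets (sample_space n) \<longrightarrow>
    (\<exists>g :: real ^ 'd::finite \<Rightarrow> real. g \<in> V_cube B (Suc j) \<and> (\<forall>v\<in>V_cube B j. l2_inner unit_cube v g = 0) \<and>
       g \<in> small_funs c \<and> l2_norm unit_cube g = \<beta> \<and>
       measure (sample_law n (\<lambda>x. c) (\<lambda>x. 1)) A - sqrt (exp x - 1)
         \<le> measure (sample_law n (\<lambda>x. c + g x) (\<lambda>x. 1)) A)"
proof -
  let ?d = "CARD('d)"
  obtain \<kappa> \<Psi> j0 where \<kappa>: "\<kappa> > 0" and \<Psi>: "\<Psi> > 0" and j0: "j0 \<ge> level0 B"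
    and fam: "\<And>j. j \<ge> j0 \<Longrightarrow> \<exists>(\<Lambda> :: ('d \<Rightarrow> windex) set) (W :: ('d \<Rightarrow> windex) \<Rightarrow> real ^ 'd \<Rightarrow> real).
     finite \<Lambda> \<and> \<kappa> * 2 ^ (j * ?d) \<le> real (card \<Lambda>) \<and> l2_orthonormal unit_cube \<Lambda> W \<and>
     (\<forall>l\<in>\<Lambda>. W l \<in> V_cube B (Suc j) \<and> (\<forall>v\<in>V_cube B j. l2_inner unit_cube v (W l) = 0)) \<and>
     (\<forall>x. (\<Sum>l\<in>\<Lambda>. \<bar>W l x\<bar>) \<le> \<Psi> * 2 powr (real (j * ?d) / 2))"
    using detail_family[where 'd = 'd] by metis
  let ?k = "c * (1 - c)"
  have k: "?k > 0" using c by simp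
  show ?thesis
  proof (rule exI[of _ "\<kappa> * ?k\<^sup>2"], rule conjI, use \<kappa> c in simp, rule exI[of _ "\<Psi> / sqrt \<kappa>"], rule conjI,
      use \<kappa> \<Psi> in simp, rule exI[of _ j0], rule conjI, rule j0, intro allI impI, elim conjE)
    fix j n \<beta> x and A :: "(nat \<Rightarrow> (real ^ 'd) \<times> bool) set"
    assume j: "j0 \<le> j" and \<beta>: "0 < \<beta>" "\<beta> * (\<Psi> / sqrt \<kappa>) \<le> c" and x: "0 \<le> x" "x \<le> 1"
      and nx: "(real n * \<beta>\<^sup>2)\<^sup>2 \<le> x * (\<kappa> * ?k\<^sup>2) * 2 ^ (j * ?d)" and A: "A \<in> sets (sample_space n)"
    obtain \<Lambda> :: "('d \<Rightarrow> windex) set" and W :: "('d \<Rightarrow> windex) \<Rightarrow> real ^ 'd \<Rightarrow> real"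
      where \<Lambda>: "finite \<Lambda>" and card: "\<kappa> * 2 ^ (j * ?d) \<le> real (card \<Lambda>)" and W: "l2_orthonormal unit_cube \<Lambda> W"
        and WV: "\<And>l. l \<in> \<Lambda> \<Longrightarrow> W l \<in> V_cube B (Suc j)"
        and Wo: "\<And>l v. l \<in> \<Lambda> \<Longrightarrow> v \<in> V_cube B j \<Longrightarrow> l2_inner unit_cube v (W l) = 0"
        and Wb: "\<And>x. (\<Sum>l\<in>\<Lambda>. \<bar>W l x\<bar>) \<le> \<Psi> * 2 powr (real (j * ?d) / 2)"
      using fam[OF j] by blast
    let ?N = "real (card \<Lambda>)" and ?D = "2 ^ (j * ?d) :: real"
    have D: "?D > 0" by simp
    have N: "?N > 0" using card \<kappa> mult_pos_pos[OF \<kappa> D] by linarith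
    define \<gamma> where "\<gamma> = \<beta> / sqrt ?N"
    have \<gamma>: "\<gamma> > 0" using \<beta> N by (simp add: \<gamma>_def)
    have \<gamma>2: "\<gamma>\<^sup>2 = \<beta>\<^sup>2 / ?N" using N by (simp add: \<gamma>_def power_divide)
    define b where "b = real n * \<gamma>\<^sup>2 / ?k"
    have bound: "(\<Sum>l\<in>\<Lambda>. \<bar>\<gamma> * W l y\<bar>) \<le> c" for y
    proof -
      have "(\<Sum>l\<in>\<Lambda>. \<bar>\<gamma> * W l y\<bar>) = \<gamma> * (\<Sum>l\<in>\<Lambda>. \<bar>W l y\<bar>)"
        using \<gamma> by (simp add: abs_mult sum_distrib_left)
      also have "\<dots> \<le> \<gamma> * (\<Psi> * 2 powr (real (j * ?d) / 2))"
        using \<gamma> Wb by (intro mult_left_mono) auto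
      also have "2 powr (real (j * ?d) / 2) = sqrt ?D"
        by (simp add: powr_half_sqrt[symmetric] powr_powr flip: powr_realpow)
      also have "\<gamma> * (\<Psi> * sqrt ?D) = \<beta> * \<Psi> * (sqrt ?D / sqrt ?N)" by (simp add: \<gamma>_def)
      also have "\<dots> \<le> \<beta> * \<Psi> * (1 / sqrt \<kappa>)"
      proof (intro mult_left_mono)
        have "sqrt \<kappa> * sqrt ?D \<le> sqrt ?N"
          unfolding real_sqrt_mult[symmetric] using card by (rule real_sqrt_le_mono)
        then show "sqrt ?D / sqrt ?N \<le> 1 / sqrt \<kappa>"
          using N \<kappa> by (simp add: field_simps)
      qed (use \<beta> \<Psi> in simp)
      also have "\<dots> \<le> c" using \<beta> by simp
      finally show ?thesis .
    qed
    have Nb: "?N * b\<^sup>2 \<le> x"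
    proof -
      have "m * (y / m / q)\<^sup>2 = y\<^sup>2 / (m * q\<^sup>2)" if "m > 0" "q > 0" for m q y :: real
        using that by (simp add: power_divide power2_eq_square field_simps)
      from this[OF N k, of "real n * \<beta>\<^sup>2"]
      have "?N * b\<^sup>2 = (real n * \<beta>\<^sup>2)\<^sup>2 / (?N * ?k\<^sup>2)" unfolding b_def \<gamma>2 by simp
      also have "\<dots> \<le> x"
      proof -
        have "(real n * \<beta>\<^sup>2)\<^sup>2 \<le> x * ?k\<^sup>2 * (\<kappa> * ?D)" using nx by (simp add: mult_ac)
        also have "\<dots> \<le> x * ?k\<^sup>2 * ?N" using card x by (intro mult_left_mono) auto
        finally have "(real n * \<beta>\<^sup>2)\<^sup>2 \<le> x * (?N * ?k\<^sup>2)" by (simp only: mult_ac)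
        moreover have "0 < ?N * ?k\<^sup>2" by (rule mult_pos_pos[OF N zero_less_power[OF k]])
        ultimately show ?thesis by (simp only: pos_divide_le_eq)
      qed
      finally show ?thesis .
    qed
    have b1: "b \<le> 1"
    proof -
      have "1 \<le> ?N" using N by simp
      then have "b\<^sup>2 \<le> ?N * b\<^sup>2" by (simp add: mult_le_cancel_right1)
      then have "b\<^sup>2 \<le> 1\<^sup>2" using Nb x by simp
      then show ?thesis by (rule power2_le_imp_le) simp
    qed
    obtain \<eta> where \<eta>: "\<eta> \<in> signs \<Lambda>"
      "measure (sample_law n (\<lambda>x. c) (\<lambda>x. 1)) A - sqrt (exp (?N * b\<^sup>2) - 1)
         \<le> measure (sample_law n (\<lambda>x. c + (\<Sum>l\<in>\<Lambda>. (\<gamma> * \<eta> l) * W l x)) (\<lambda>x. 1)) A"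
      using mixture_indistinguishable[OF c \<Lambda> W bound b_def b1 A] by blast
    define g where "g x = (\<Sum>l\<in>\<Lambda>. (\<gamma> * \<eta> l) * W l x)" for x
    have gV: "g \<in> V_cube B (Suc j)"
      unfolding g_def[abs_def] V_cube_def using \<Lambda> WV by (intro l2_span_sum) (auto simp: V_cube_def)
    then have gl: "g \<in> l2 unit_cube" by (auto simp: V_cube_def l2_span_def)
    have Wl: "W l \<in> l2 unit_cube" if "l \<in> \<Lambda>" for l using W that by (simp add: l2_orthonormal_def)
    have go: "l2_inner unit_cube v g = 0" if v: "v \<in> V_cube B j" for v
    proof -
      have vl: "v \<in> l2 unit_cube" using v by (auto simp: V_cube_def l2_span_def)
      have "l2_inner unit_cube g v = (\<Sum>l\<in>\<Lambda>. \<gamma> * \<eta> l * l2_inner unit_cube (W l) v)"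
        unfolding g_def[abs_def] using Wl vl by (subst l2_inner_sum_left) (auto simp: l2_cmult l2_inner_cmult_left)
      also have "\<dots> = 0"
        using Wo[OF _ v] l2_inner_commute[of unit_cube _ v] by (intro sum.neutral) auto
      finally show ?thesis by (simp add: l2_inner_commute)
    qed
    have gs: "g \<in> small_funs c"
    proof -
      have "\<bar>g y\<bar> \<le> c" for y
      proof -
        have "\<bar>g y\<bar> \<le> (\<Sum>l\<in>\<Lambda>. \<bar>(\<gamma> * \<eta> l) * W l y\<bar>)" unfolding g_def by (rule sum_abs)
        also have "\<dots> = (\<Sum>l\<in>\<Lambda>. \<bar>\<gamma> * W l y\<bar>)"
          using signs_square(2)[OF \<eta>(1)] by (intro sum.cong) (auto simp: abs_mult)
        finally show ?thesis using bound[of y] by simp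
      qed
      then show ?thesis using gl by (auto simp: small_funs_def l2_measurable)
    qed
    have gn: "l2_norm unit_cube g = \<beta>"
    proof -
      have "(l2_norm unit_cube g)\<^sup>2 = (\<Sum>l\<in>\<Lambda>. (\<gamma> * \<eta> l) * (\<gamma> * \<eta> l))"
        unfolding l2_norm_square unfolding g_def[abs_def] by (rule l2_inner_orthonormal_sums[OF \<Lambda> W])
      also have "\<dots> = (\<Sum>l\<in>\<Lambda>. \<gamma>\<^sup>2)"
      proof (rule sum.cong[OF refl])
        fix l assume "l \<in> \<Lambda>"
        have "(\<gamma> * \<eta> l) * (\<gamma> * \<eta> l) = \<gamma>\<^sup>2 * (\<eta> l * \<eta> l)" by (simp add: power2_eq_square)
        then show "(\<gamma> * \<eta> l) * (\<gamma> * \<eta> l) = \<gamma>\<^sup>2" using signs_square(1)[OF \<eta>(1) \<open>l \<in> \<Lambda>\<close>] by simp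
      qed
      also have "\<dots> = \<beta>\<^sup>2" using N by (simp add: \<gamma>2)
      finally show ?thesis using \<beta> l2_norm_nonneg[of unit_cube g] by (simp add: power2_eq_iff_nonneg)
    qed
    have "sqrt (exp (?N * b\<^sup>2) - 1) \<le> sqrt (exp x - 1)" using Nb by simp
    then have gm: "measure (sample_law n (\<lambda>x. c) (\<lambda>x. 1)) A - sqrt (exp x - 1)
         \<le> measure (sample_law n (\<lambda>x. c + g x) (\<lambda>x. 1)) A"
      using \<eta>(2) unfolding g_def by linarith
    show "\<exists>g. g \<in> V_cube B (Suc j) \<and> (\<forall>v\<in>V_cube B j. l2_inner unit_cube v g = 0) \<and>
       g \<in> small_funs c \<and> l2_norm unit_cube g = \<beta> \<and>
       measure (sample_law n (\<lambda>x. c) (\<lambda>x. 1)) A - sqrt (exp x - 1)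
         \<le> measure (sample_law n (\<lambda>x. c + g x) (\<lambda>x. 1)) A"
      using gV go gs gn gm by (intro exI[of _ g] conjI ballI)
  qed
qed

end

section \<open>Rates\<close>

lemma eventually_powr_ge:
  assumes "0 < p" shows "eventually (\<lambda>n. C \<le> real n powr p) sequentially"
  using eventually_ge_at_top[of "nat \<lceil>max C 1 powr (1 / p)\<rceil>"]
proof eventually_elim
  case (elim n)
  then have "max C 1 powr (1 / p) \<le> real n" by linarith
  then have "(max C 1 powr (1 / p)) powr p \<le> real n powr p"
    using assms by (intro powr_mono2) auto
  then show ?case using assms by (simp add: powr_powr)
qed

text \<open>The smallest \<open>j\<close> with \<open>2 powr (j * (4 * r + d)) \<ge> n\<^sup>2\<close>, for \<open>n \<ge> 1\<close>: the coarsest level at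
  which the mixture bound hides perturbations whose norm is a small multiple of
  \<open>2 powr (- j * r)\<close>.\<close>

definition critical_level :: "nat \<Rightarrow> real \<Rightarrow> nat \<Rightarrow> nat" where
  "critical_level d r n = nat \<lceil>2 * log 2 (real n) / (4 * r + real d)\<rceil>"

lemma level_bounds:
  assumes r: "0 < r" and n: "1 \<le> n"
  shows "real n powr (2 / (4 * r + real d)) \<le> 2 powr real (critical_level d r n)"
    and "2 powr real (critical_level d r n) \<le> 2 * real n powr (2 / (4 * r + real d))"
proof -
  let ?y = "2 * log 2 (real n) / (4 * r + real d)"
  have y: "0 \<le> ?y" using r n by (intro divide_nonneg_nonneg mult_nonneg_nonneg) auto
  have e: "2 powr ?y = real n powr (2 / (4 * r + real d))"
  proof -
    have "2 powr ?y = (2 powr log 2 (real n)) powr (2 / (4 * r + real d))"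
      unfolding powr_powr by (simp add: mult.commute)
    then show ?thesis using n by simp
  qed
  have 1: "?y \<le> real (critical_level d r n)" unfolding critical_level_def by (rule real_nat_ceiling_ge)
  have 2: "real (critical_level d r n) \<le> 1 + ?y" unfolding critical_level_def using y by linarith
  show "real n powr (2 / (4 * r + real d)) \<le> 2 powr real (critical_level d r n)"
    unfolding e[symmetric] using 1 by (intro powr_mono) auto
  have "2 powr real (critical_level d r n) \<le> 2 powr (1 + ?y)" using 2 by (intro powr_mono) auto
  also have "\<dots> = 2 * real n powr (2 / (4 * r + real d))" by (simp add: powr_add e)
  finally show "2 powr real (critical_level d r n) \<le> 2 * real n powr (2 / (4 * r + real d))" .
qed

lemma level_tends_to_infinity:
  assumes r: "0 < r"
  shows "eventually (\<lambda>n. k \<le> critical_level d r n) sequentially"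
proof -
  let ?q = "2 / (4 * r + real d)"
  have "eventually (\<lambda>n. 2 powr real k \<le> real n powr ?q) sequentially"
    using r by (intro eventually_powr_ge) auto
  then show ?thesis
    using eventually_ge_at_top[of 1]
  proof eventually_elim
    case (elim n)
    then have "2 powr real k \<le> 2 powr real (critical_level d r n)"
      using level_bounds(1)[OF r, of n d] by linarith
    then show ?case by simp
  qed
qed

lemma level_sample_size:
  assumes r: "0 < r" and n: "1 \<le> n"
  shows "(real n)\<^sup>2 * (2 powr (- (real (critical_level d r n) * r))) ^ 4 \<le> 2 ^ (critical_level d r n * d)"
proof -
  let ?j = "critical_level d r n" and ?q = "4 * r + real d"
  have q: "?q > 0" using r by simp
  have "(real n)\<^sup>2 = (real n powr (2 / ?q)) powr ?q"
  proof -
    have "2 / y * y = 2" if "y > 0" for y :: real using that by simp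
    from this[OF q] show ?thesis using n unfolding powr_powr by (simp only:) simp
  qed
  also have "\<dots> \<le> (2 powr real ?j) powr ?q"
    using level_bounds(1)[OF r n] q by (intro powr_mono2) auto
  also have "\<dots> = 2 powr (real ?j * r * 4) * 2 powr (real (?j * d))"
    by (simp add: powr_powr algebra_simps flip: powr_add)
  finally have "(real n)\<^sup>2 * 2 powr (- (real ?j * r * 4)) \<le> 2 powr (real (?j * d))"
    by (simp add: powr_minus divide_simps mult.commute)
  moreover have "(2 powr (- (real ?j * r))) ^ 4 = 2 powr (- (real ?j * r * 4))"
    by (simp add: powr_powr flip: powr_realpow)
  moreover have "2 powr (real (?j * d)) = 2 ^ (?j * d)" by (rule powr_realpow) simp
  ultimately show ?thesis by simp
qed

lemma level_rho_rate:
  assumes r: "0 < r" and n: "1 \<le> n"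
  shows "2 powr (- r) * rho_rate d n r \<le> 2 powr (- (real (critical_level d r n) * r))"
proof -
  let ?q = "2 / (4 * r + real d)"
  have "2 powr (- r) * rho_rate d n r = (2 * real n powr ?q) powr (- r)"
    using n by (simp add: rho_rate_def powr_mult powr_powr)
  also have "\<dots> \<le> (2 powr real (critical_level d r n)) powr (- r)"
    using level_bounds(2)[OF r n] r by (intro powr_mono2') auto
  finally show ?thesis by (simp add: powr_powr)
qed

text \<open>This is where \<open>2 * r < s\<close> enters: the two exponents satisfy
  \<open>2 * r / (4 * r + d) < s / (2 * s + d)\<close> exactly under this condition.\<close>

lemma eps_rate_below_rho_rate:
  assumes "0 < r" "2 * r < s" "0 < d" "0 < \<delta>"
  shows "eventually (\<lambda>n. K * eps_rate d n s < \<delta> * rho_rate d n r) sequentially"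
proof -
  let ?e = "s / (2 * s + real d)" and ?r = "(2 * r) / (4 * r + real d)"
  have "?r < ?e" using assms by (simp add: divide_simps) (simp add: algebra_simps)
  then have "eventually (\<lambda>n. \<bar>K\<bar> / \<delta> + 1 \<le> real n powr (?e - ?r)) sequentially"
    by (intro eventually_powr_ge) simp
  then show ?thesis
    using eventually_ge_at_top[of 1]
  proof eventually_elim
    case (elim n)
    have pos: "eps_rate d n s > 0" using elim by (simp add: eps_rate_def)
    have "rho_rate d n r = real n powr (?e - ?r) * eps_rate d n s"
      using elim unfolding rho_rate_def eps_rate_def powr_add[symmetric] by simp
    also have "\<dots> \<ge> (\<bar>K\<bar> / \<delta> + 1) * eps_rate d n s"
      using elim pos by (intro mult_right_mono) auto
    finally have "\<delta> * ((\<bar>K\<bar> / \<delta> + 1) * eps_rate d n s) \<le> \<delta> * rho_rate d n r"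
      using assms by (intro mult_left_mono) auto
    moreover have "\<delta> * ((\<bar>K\<bar> / \<delta> + 1) * eps_rate d n s) = \<bar>K\<bar> * eps_rate d n s + \<delta> * eps_rate d n s"
      using assms by (simp add: field_simps)
    moreover have "K * eps_rate d n s \<le> \<bar>K\<bar> * eps_rate d n s" using pos by (intro mult_right_mono) auto
    moreover have "0 < \<delta> * eps_rate d n s" using pos assms by simp
    ultimately show ?case by linarith
  qed
qed

text \<open>Half of \<open>\<delta> * 2 powr (- j * r)\<close> absorbs \<open>a n\<close>, the other half absorbs the detail of a
  \<open>t\<close>-smooth function.\<close>

lemma separation_exceeds_smoothness_bias:
  assumes r: "0 < r" "r < t" and \<delta>: "0 < \<delta>" and a: "a \<in> o(\<lambda>n. rho_rate d n r)"
  shows "eventually (\<lambda>n. a n \<le> \<delta> * 2 powr (- (real (critical_level d r n) * r)) - M * 2 powr (- (real (critical_level d r n) * t))) sequentially"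
proof -
  obtain k where k: "\<bar>M\<bar> * 2 / \<delta> < (2 powr (t - r)) ^ k"
    using real_arch_pow[of "2 powr (t - r)"] r by auto
  have "eventually (\<lambda>n. norm (a n) \<le> (\<delta> / 2 * 2 powr (- r)) * norm (rho_rate d n r)) sequentially"
    using landau_o.smallD[OF a, of "\<delta> / 2 * 2 powr (- r)"] \<delta> by simp
  then show ?thesis
    using eventually_ge_at_top[of 1] level_tends_to_infinity[OF r(1), of k d]
  proof eventually_elim
    case (elim n)
    let ?j = "critical_level d r n"
    have "a n \<le> (\<delta> / 2) * (2 powr (- r) * rho_rate d n r)"
      using elim(1) by (simp add: rho_rate_def)
    also have "\<dots> \<le> (\<delta> / 2) * 2 powr (- (real ?j * r))"
      using level_rho_rate[OF r(1) elim(2)] \<delta> by (intro mult_left_mono) auto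
    finally have 1: "a n \<le> (\<delta> / 2) * 2 powr (- (real ?j * r))" .
    have "(2 powr (t - r)) ^ k \<le> (2 powr (t - r)) ^ ?j"
      using elim(3) r by (intro power_increasing ge_one_powr_ge_zero) auto
    moreover have "(2 powr (t - r)) ^ ?j = 2 powr (real ?j * (t - r))"
      by (simp add: powr_powr mult.commute flip: powr_realpow)
    ultimately have "\<bar>M\<bar> * 2 / \<delta> \<le> 2 powr (real ?j * (t - r))"
      using k by linarith
    then have "\<bar>M\<bar> \<le> (\<delta> / 2) * 2 powr (real ?j * (t - r))" using \<delta> by (simp add: field_simps)
    then have "\<bar>M\<bar> * 2 powr (- (real ?j * t)) \<le> (\<delta> / 2) * 2 powr (real ?j * (t - r)) * 2 powr (- (real ?j * t))"
      by (intro mult_right_mono) auto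
    also have "\<dots> = (\<delta> / 2) * 2 powr (- (real ?j * r))"
      by (simp add: algebra_simps flip: powr_add)
    finally have "M * 2 powr (- (real ?j * t)) \<le> (\<delta> / 2) * 2 powr (- (real ?j * r))"
      using abs_ge_self[of M] by (smt (verit) mult_right_mono powr_ge_zero)
    then show ?case using 1 by linarith
  qed
qed

section \<open>Impossibility of adaptation\<close>

lemma pick_small_constant:
  fixes y1 y2 y3 :: real
  assumes "0 < y1" "0 < y2" "0 < y3"
  shows "\<exists>\<delta>>0. \<delta> \<le> y1 \<and> \<delta> \<le> y2 \<and> \<delta> ^ 4 \<le> y3"
proof -
  define \<delta> where "\<delta> = min (min y1 y2) (min y3 1)"
  have "\<delta> > 0" "\<delta> \<le> 1" using assms by (auto simp: \<delta>_def)
  then have "\<delta> ^ 4 \<le> \<delta> ^ 1" by (intro power_decreasing) auto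
  then have "\<delta> ^ 4 \<le> y3" by (simp add: \<delta>_def)
  then show ?thesis using \<open>\<delta> > 0\<close> by (intro exI[of _ \<delta>]) (auto simp: \<delta>_def)
qed

lemma prob_space_sample_law_small:
  fixes g :: "real ^ 'd::finite \<Rightarrow> real"
  assumes "0 < c" "c \<le> 1/2" "g \<in> small_funs c"
  shows "prob_space (sample_law n (\<lambda>x. c + g x) (\<lambda>x. 1))"
  unfolding sample_law_def
proof (intro prob_space_PiM prob_space_obs_law)
  show "(\<lambda>x. c + g x) \<in> borel_measurable unit_cube" using small_funsD(1)[OF assms(3)] by simp
  show "0 \<le> c + g x \<and> c + g x \<le> 1" for x using small_funsD(2)[OF assms(3), of x] assms by (auto simp: abs_le_iff)
qed

text \<open>
  A confidence set gives a test of \<open>f\<close> against a distant \<open>h\<close>.  Its acceptance event \<open>E\<close> is likely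
  under \<open>f\<close> if the set covers \<open>f\<close> and has a small diameter, and it excludes coverage of \<open>h\<close>.
  Using \<open>E\<close> in place of the diameter event leaves only the distances from \<open>f\<close> to control.
\<close>

lemma confident_event:
  fixes C :: "(nat \<Rightarrow> (real ^ 'd::finite) \<times> bool) \<Rightarrow> (real ^ 'd \<Rightarrow> real) set" and \<epsilon> :: real
  assumes C: "confidence_set n C" and f: "f \<in> l2 unit_cube"
  defines "E \<equiv> {\<omega> \<in> space (sample_space n). f \<in> C \<omega> \<and>
      \<not> C \<omega> \<inter> {h \<in> l2 unit_cube. \<epsilon> < l2_dist unit_cube f h} \<noteq> {}}"
  shows "E \<in> sets (sample_space n)"
    and "\<lbrakk>prob_space P; sets P = sets (sample_space n)\<rbrakk> \<Longrightarrow>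
      measure P {\<omega> \<in> space P. f \<in> C \<omega>} - measure P {\<omega> \<in> space P. ereal \<epsilon> < l2_diam unit_cube (C \<omega>)} \<le> measure P E"
    and "\<lbrakk>prob_space P; sets P = sets (sample_space n); h \<in> l2 unit_cube; \<epsilon> < l2_dist unit_cube f h\<rbrakk> \<Longrightarrow>
      measure P E + measure P {\<omega> \<in> space P. h \<in> C \<omega>} \<le> 1"
proof -
  note cov = confidence_set_coverage_measurable[OF C]
  show E: "E \<in> sets (sample_space n)"
    unfolding E_def
    by (rule sets.sets_Collect_conj[OF sets.sets_Collect_neg[OF confidence_set_hits[OF C openin_l2_ball_exterior[OF f]]] cov[OF f]])
  {
    assume P: "prob_space P" "sets P = sets (sample_space n)"
    interpret prob_space P by fact
    have sp: "space P = space (sample_space n)" using P(2) by (rule sets_eq_imp_space_eq)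
    let ?F = "{\<omega> \<in> space P. f \<in> C \<omega>}" and ?D = "{\<omega> \<in> space P. ereal \<epsilon> < l2_diam unit_cube (C \<omega>)}"
    have s: "?F \<in> sets P" "?D \<in> sets P" "E \<in> sets P"
      using cov[OF f] confidence_set_diam_measurable[OF C] E by (simp_all add: sp P(2))
    have "?F \<subseteq> E \<union> ?D"
      unfolding E_def sp less_l2_diam_iff by blast
    then have "measure P ?F \<le> measure P (E \<union> ?D)" using s by (intro finite_measure_mono) auto
    also have "\<dots> \<le> measure P E + measure P ?D" using s(3,2) by (rule measure_Un_le)
    finally show "measure P ?F - measure P ?D \<le> measure P E" by simp
  next
    assume P: "prob_space P" "sets P = sets (sample_space n)"
      and h: "h \<in> l2 unit_cube" "\<epsilon> < l2_dist unit_cube f h"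
    interpret prob_space P by fact
    have sp: "space P = space (sample_space n)" using P(2) by (rule sets_eq_imp_space_eq)
    let ?F = "{\<omega> \<in> space P. h \<in> C \<omega>}"
    have s: "?F \<in> sets P" "E \<in> sets P" using cov[OF h(1)] E by (simp_all add: sp P(2))
    have "E \<inter> ?F = {}" using h unfolding E_def by blast
    then have "measure P E + measure P ?F = measure P (E \<union> ?F)"
      using s by (intro finite_measure_Union[symmetric])
    also have "\<dots> \<le> 1" by (rule prob_le_1)
    finally show "measure P E + measure P ?F \<le> 1" .
  }
qed

lemma (in cdv_basis) fclass_level_perturbation:
  fixes g :: "real ^ 'd::finite \<Rightarrow> real"
  assumes c: "0 < c" "c \<le> 1/2" and m: "0 < moments B" and j: "level0 B \<le> j"
    and g: "g \<in> V_cube B (Suc j)" "\<And>v. v \<in> V_cube B j \<Longrightarrow> l2_inner unit_cube v g = 0" "g \<in> small_funs c"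
    and M: "2 powr (real (level0 B) * u) * c + 2 powr (real j * u) * l2_norm unit_cube g \<le> M"
  shows "(\<lambda>x. c + g x) \<in> fclass B u M"
proof -
  interpret Q: prob_space "unit_cube :: (real ^ 'd) measure" by (rule prob_space_unit_cube)
  have cV: "(\<lambda>x :: real ^ 'd. c) \<in> V_cube B (level0 B)" by (rule const_in_V_cube) (use m in auto)
  have norm: "l2_norm unit_cube (\<lambda>x :: real ^ 'd. c) = c"
    using c by (simp add: l2_norm_def Q.prob_space)
  have "besov_norm B u (\<lambda>x. c + g x) \<le>
      ereal (2 powr (real (level0 B) * u) * l2_norm unit_cube (\<lambda>x :: real ^ 'd. c) + 2 powr (real j * u) * l2_norm unit_cube g)"
    by (rule besov_norm_level_perturbation[OF j cV g(1,2)])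
  also have "\<dots> \<le> ereal M" using M norm by simp
  finally have "besov_norm B u (\<lambda>x. c + g x) \<le> ereal M" .
  moreover have "(\<lambda>x. c + g x) \<in> l2 unit_cube"
    using level_perturbation_l2[OF j cV g(1,2)] by (intro l2_add)
  moreover have "0 \<le> c + g x \<and> c + g x \<le> 1" for x
    using small_funsD(2)[OF g(3), of x] c by (auto simp: abs_le_iff)
  ultimately show ?thesis by (simp add: fclass_def besov_ball_def)
qed

theorem theorem5p2:
  fixes B :: wavelet_data
    and S R r t s M \<alpha> \<alpha>' :: real
    and a :: "nat \<Rightarrow> real"
  assumes "0 < S" and "cdv_basis B R" and "S < R" and "S < real (moments B)"
    and "0 < r" and "r < t" and "t \<le> s" and "s < S" and "2 * r < s"
    and "0 < M"
    and "0 < \<alpha>" and "\<alpha> < 1" and "0 < \<alpha>'" and "\<alpha>' < 1" and "2 * \<alpha> + \<alpha>' < 1"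
    and "\<forall>n. 0 \<le> a n" and "a \<in> o(\<lambda>n. rho_rate CARD('d::finite) n r)"
  shows "\<not> (\<exists>C :: nat \<Rightarrow> (nat \<Rightarrow> (real ^ 'd) \<times> bool) \<Rightarrow> (real ^ 'd \<Rightarrow> real) set.
    (\<forall>n. confidence_set n (C n)) \<and>
    liminf (\<lambda>n. INF f \<in> separated_class B r t s M (a n).
        ereal (measure (sample_law n f (\<lambda>x. 1))
          {\<omega> \<in> space (sample_law n f (\<lambda>x. 1)). f \<in> C n \<omega>})) \<ge> ereal (1 - \<alpha>) \<and>
    (\<exists>K :: real. limsup (\<lambda>n. SUP f \<in> fclass B s M.
        ereal (measure (sample_law n f (\<lambda>x. 1))
          {\<omega> \<in> space (sample_law n f (\<lambda>x. 1)).
             l2_diam unit_cube (C n \<omega>) > ereal (K * eps_rate CARD('d) n s)})) \<le> ereal \<alpha>'))"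
proof (rule notI, elim exE conjE)
  fix C :: "nat \<Rightarrow> (nat \<Rightarrow> (real ^ 'd) \<times> bool) \<Rightarrow> (real ^ 'd \<Rightarrow> real) set" and K :: real
  assume C: "\<forall>n. confidence_set n (C n)"
    and honest: "liminf (\<lambda>n. INF f \<in> separated_class B r t s M (a n).
        ereal (measure (sample_law n f (\<lambda>x. 1))
          {\<omega> \<in> space (sample_law n f (\<lambda>x. 1)). f \<in> C n \<omega>})) \<ge> ereal (1 - \<alpha>)"
    and small: "limsup (\<lambda>n. SUP f \<in> fclass B s M.
        ereal (measure (sample_law n f (\<lambda>x. 1))
          {\<omega> \<in> space (sample_law n f (\<lambda>x. 1)).
             l2_diam unit_cube (C n \<omega>) > ereal (K * eps_rate CARD('d) n s)})) \<le> ereal \<alpha>'"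
  interpret cdv_basis B R by fact
  note hyps = assms
  let ?d = "CARD('d)" and ?J0 = "real (level0 B)"
  let ?law = "\<lambda>n (f :: real ^ 'd \<Rightarrow> real). sample_law n f (\<lambda>x. 1)"
  let ?cov = "\<lambda>n (f :: real ^ 'd \<Rightarrow> real). measure (?law n f) {\<omega> \<in> space (?law n f). f \<in> C n \<omega>}"
  let ?wide = "\<lambda>n (f :: real ^ 'd \<Rightarrow> real). measure (?law n f)
      {\<omega> \<in> space (?law n f). l2_diam unit_cube (C n \<omega>) > ereal (K * eps_rate ?d n s)}"
  have m: "0 < moments B" using hyps(1,4) by simp
  \<comment> \<open>Two coverage limits, one diameter limit and the testing error cost \<open>\<tau>\<close> each; the fifth \<open>\<tau>\<close>
     makes the contradiction strict.\<close>
  define \<tau> where "\<tau> = (1 - 2 * \<alpha> - \<alpha>') / 5"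
  have \<tau>: "\<tau> > 0" using hyps(15) by (simp add: \<tau>_def)
  \<comment> \<open>The constant may use half of the Besov radius \<open>M\<close>; the perturbation gets the other half.\<close>
  define c where "c = min (1/2) (M / (2 * 2 powr (?J0 * s)))"
  have c: "0 < c" "c \<le> 1/2" using hyps(10) by (auto simp: c_def)
  have cs: "2 powr (?J0 * s) * c \<le> M / 2"
  proof -
    have "2 powr (?J0 * s) * c \<le> 2 powr (?J0 * s) * (M / (2 * 2 powr (?J0 * s)))"
      by (intro mult_left_mono) (auto simp: c_def)
    then show ?thesis by simp
  qed
  have cr: "2 powr (?J0 * r) * c \<le> M / 2"
  proof -
    have "2 powr (?J0 * r) * c \<le> 2 powr (?J0 * s) * c"
      using c hyps(6,7) by (intro mult_right_mono powr_mono mult_left_mono) auto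
    then show ?thesis using cs by simp
  qed
  \<comment> \<open>The bound on \<open>N * b\<^sup>2\<close> that keeps the testing error below \<open>\<tau>\<close>.\<close>
  define x where "x = min 1 (ln (1 + \<tau>\<^sup>2))"
  have x: "0 < x" "x \<le> 1"
    using \<tau> ln_gt_zero[of "1 + \<tau>\<^sup>2"] by (auto simp: x_def)
  have x\<tau>: "sqrt (exp x - 1) \<le> \<tau>"
  proof -
    have "exp x \<le> exp (ln (1 + \<tau>\<^sup>2))" by (simp add: x_def)
    also have "\<dots> = 1 + \<tau>\<^sup>2" by (intro exp_ln) (simp add: add_pos_nonneg)
    finally have "sqrt (exp x - 1) \<le> sqrt (\<tau>\<^sup>2)" by (intro real_sqrt_le_mono) simp
    then show ?thesis using \<tau> by simp
  qed
  obtain \<kappa> \<Psi> j0 where \<kappa>: "\<kappa> > 0" and \<Psi>: "\<Psi> > 0" and j0: "j0 \<ge> level0 B"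
    and alt: "\<And>j n \<beta> x A. \<lbrakk>j \<ge> j0; 0 < \<beta>; \<beta> * \<Psi> \<le> c; 0 \<le> x; x \<le> 1;
      (real n * \<beta>\<^sup>2)\<^sup>2 \<le> x * \<kappa> * 2 ^ (j * ?d); A \<in> sets (sample_space n)\<rbrakk> \<Longrightarrow>
      \<exists>g :: real ^ 'd \<Rightarrow> real. g \<in> V_cube B (Suc j) \<and> (\<forall>v\<in>V_cube B j. l2_inner unit_cube v g = 0) \<and>
       g \<in> small_funs c \<and> l2_norm unit_cube g = \<beta> \<and>
       measure (?law n (\<lambda>x. c)) A - sqrt (exp x - 1) \<le> measure (?law n (\<lambda>x. c + g x)) A"
    using indistinguishable_alternatives[OF c, where 'd = 'd] by metis
  \<comment> \<open>The three upper bounds on \<open>\<delta>\<close> serve the Besov norm, the range \<open>[0,1]\<close> and the testing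
     error.\<close>
  obtain \<delta> where \<delta>: "\<delta> > 0" "\<delta> \<le> M / 2" "\<delta> \<le> c / \<Psi>" "\<delta> ^ 4 \<le> x * \<kappa>"
    using pick_small_constant[of "M / 2" "c / \<Psi>" "x * \<kappa>"] hyps(10) c \<Psi> \<kappa> x by auto
  define f0 where "f0 = (\<lambda>x :: real ^ 'd. c)"
  have f0_l2: "f0 \<in> l2 unit_cube"
    unfolding f0_def by (rule l2_bounded[OF finite_measure_unit_cube, of _ c]) (use c in auto)
  have f0: "f0 \<in> fclass B s M"
  proof -
    have "(\<lambda>x :: real ^ 'd. 0 :: real) \<in> V_cube B (Suc (level0 B))"
      by (rule const_in_V_cube) (use m in auto)
    then have "(\<lambda>x. c + (\<lambda>x :: real ^ 'd. 0) x) \<in> fclass B s M"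
      using cs hyps(10) c by (intro fclass_level_perturbation[OF c m order_refl])
        (auto simp: l2_inner_def small_funs_def l2_norm_def)
    then show ?thesis by (simp add: f0_def)
  qed
  have "eventually (\<lambda>n. ereal (1 - \<alpha> - \<tau>) < (INF f \<in> separated_class B r t s M (a n). ereal (?cov n f))) sequentially"
    using \<tau> by (intro less_LiminfD less_le_trans[OF _ honest]) simp
  moreover have "eventually (\<lambda>n. (SUP f \<in> fclass B s M. ereal (?wide n f)) < ereal (\<alpha>' + \<tau>)) sequentially"
    using \<tau> by (intro Limsup_lessD le_less_trans[OF small]) simp
  moreover have "eventually (\<lambda>n. j0 \<le> critical_level ?d r n) sequentially"
    by (rule level_tends_to_infinity[OF hyps(5)])
  moreover have "eventually (\<lambda>n. a n \<le> \<delta> * 2 powr (- (real (critical_level ?d r n) * r)) - M * 2 powr (- (real (critical_level ?d r n) * t))) sequentially"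
    by (rule separation_exceeds_smoothness_bias[OF hyps(5,6) \<delta>(1) hyps(17)])
  moreover have "eventually (\<lambda>n. K * eps_rate ?d n s < (\<delta> * 2 powr (- r)) * rho_rate ?d n r) sequentially"
    using \<delta> by (intro eps_rate_below_rho_rate hyps) auto
  ultimately have "eventually (\<lambda>n. False) sequentially"
    using eventually_ge_at_top[of 1]
  proof eventually_elim
    case (elim n)
    define j where "j = critical_level ?d r n"
    define \<beta> where "\<beta> = \<delta> * 2 powr (- (real j * r))"
    have j: "j0 \<le> j" "level0 B \<le> j" using elim(3) j0 by (auto simp: j_def)
    have \<beta>: "0 < \<beta>" using \<delta> by (simp add: \<beta>_def)
    have "2 powr (- (real j * r)) \<le> 2 powr 0" using hyps(5) by (intro powr_mono) auto
    then have \<beta>\<delta>: "\<beta> \<le> \<delta>" using \<delta>(1) unfolding \<beta>_def by simp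
    have \<beta>\<Psi>: "\<beta> * \<Psi> \<le> c"
    proof -
      have "\<beta> * \<Psi> \<le> c / \<Psi> * \<Psi>" using \<beta>\<delta> \<delta>(3) \<Psi> by (intro mult_right_mono) auto
      then show ?thesis using \<Psi> by simp
    qed
    have n\<beta>: "(real n * \<beta>\<^sup>2)\<^sup>2 \<le> x * \<kappa> * 2 ^ (j * ?d)"
    proof -
      have "(real n * \<beta>\<^sup>2)\<^sup>2 = \<delta> ^ 4 * ((real n)\<^sup>2 * (2 powr (- (real j * r))) ^ 4)"
        by (simp add: \<beta>_def power_mult_distrib flip: power_mult)
      also have "\<dots> \<le> (x * \<kappa>) * 2 ^ (j * ?d)"
        using \<delta>(4) level_sample_size[OF hyps(5) elim(6), of ?d] x \<kappa> unfolding j_def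
        by (intro mult_mono) auto
      finally show ?thesis .
    qed
    have conf: "confidence_set n (C n)" using C by simp
    let ?\<epsilon> = "K * eps_rate ?d n s"
    define E where "E = {\<omega> \<in> space (sample_space n). f0 \<in> C n \<omega> \<and>
      \<not> C n \<omega> \<inter> {h \<in> l2 unit_cube. ?\<epsilon> < l2_dist unit_cube f0 h} \<noteq> {}}"
    have E: "E \<in> sets (sample_space n)" unfolding E_def by (rule confident_event(1)[OF conf f0_l2])
    obtain g :: "real ^ 'd \<Rightarrow> real" where g: "g \<in> V_cube B (Suc j)"
        "\<And>v. v \<in> V_cube B j \<Longrightarrow> l2_inner unit_cube v g = 0" "g \<in> small_funs c"
      and g\<beta>: "l2_norm unit_cube g = \<beta>"
      and gE: "measure (?law n f0) E - sqrt (exp x - 1) \<le> measure (?law n (\<lambda>x. c + g x)) E"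
      using alt[OF j(1) \<beta> \<beta>\<Psi> less_imp_le[OF x(1)] x(2) n\<beta> E] unfolding f0_def by blast
    define f1 where "f1 = (\<lambda>x. c + g x)"
    have cV: "(\<lambda>x :: real ^ 'd. c) \<in> V_cube B (level0 B)" by (rule const_in_V_cube) (use m in auto)
    have f1_l2: "f1 \<in> l2 unit_cube"
      unfolding f1_def using level_perturbation_l2[OF j(2) cV g(1,2)] by (intro l2_add)
    have "2 powr (real j * r) * \<beta> = \<delta>" by (simp add: \<beta>_def powr_minus)
    then have f1_r: "f1 \<in> fclass B r M"
      unfolding f1_def using cr \<delta>(2) g\<beta>
      by (intro fclass_level_perturbation[OF c m j(2) g]) simp_all
    have "ereal (a n) \<le> l2_setdist unit_cube f1 (besov_ball B t M)"
      unfolding l2_setdist_def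
    proof (rule INF_greatest)
      fix h :: "real ^ 'd \<Rightarrow> real" assume "h \<in> besov_ball B t M"
      from dist_level_perturbation_besov_ball[OF j(2) cV g(1,2) this hyps(10)]
      show "ereal (a n) \<le> ereal (l2_dist unit_cube f1 h)"
        using elim(4) unfolding g\<beta> \<beta>_def f1_def j_def by simp
    qed
    then have f1: "f1 \<in> separated_class B r t s M (a n)"
      using f1_r by (simp add: separated_class_def)
    have dist: "?\<epsilon> < l2_dist unit_cube f0 f1"
    proof -
      have "l2_dist unit_cube f0 f1 = \<beta>"
        using l2_norm_cmult[of unit_cube "-1" g] g\<beta> by (simp add: l2_dist_def f0_def f1_def)
      moreover have "(\<delta> * 2 powr (- r)) * rho_rate ?d n r \<le> \<beta>"
        using level_rho_rate[OF hyps(5) elim(6), of ?d] \<delta>(1) unfolding \<beta>_def j_def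
        by (simp add: mult.assoc)
      ultimately show ?thesis using elim(5) by linarith
    qed
    have cov: "1 - \<alpha> - \<tau> < ?cov n f" if "f \<in> separated_class B r t s M (a n)" for f
    proof -
      have "ereal (1 - \<alpha> - \<tau>) < ereal (?cov n f)"
        using elim(1) by (rule less_le_trans) (rule INF_lower[OF that])
      then show ?thesis by simp
    qed
    have "ereal (?wide n f0) < ereal (\<alpha>' + \<tau>)"
      by (rule le_less_trans[OF SUP_upper[OF f0] elim(2)])
    then have wide: "?wide n f0 < \<alpha>' + \<tau>" by simp
    have P0: "prob_space (?law n f0)" unfolding f0_def by (rule prob_space_sample[OF c])
    have P1: "prob_space (?law n f1)" unfolding f1_def by (rule prob_space_sample_law_small[OF c g(3)])
    have "?cov n f0 - ?wide n f0 \<le> measure (?law n f0) E"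
      unfolding E_def by (rule confident_event(2)[OF conf f0_l2 P0 sets_sample_law])
    moreover have "measure (?law n f1) E + ?cov n f1 \<le> 1"
      unfolding E_def by (rule confident_event(3)[OF conf f0_l2 P1 sets_sample_law f1_l2 dist])
    moreover have "1 - \<alpha> - \<tau> < ?cov n f0" using f0 by (intro cov) (simp add: separated_class_def)
    moreover have "1 - \<alpha> - \<tau> < ?cov n f1" by (rule cov[OF f1])
    moreover have "5 * \<tau> = 1 - 2 * \<alpha> - \<alpha>'" by (simp add: \<tau>_def)
    ultimately show False
      using wide gE x\<tau> \<tau> unfolding f1_def[symmetric] by linarith
  qed
  then show False by simp
qed

end
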